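(* Suppose $n\ge 6$, $G=GL_n(\mathbb C)$ or $G=SL_n(\mathbb C)$, and $B$ is the Borel subgroup of upper triangular matrices. Let $w_0$ be the longest element of $S_n$ and $s_i=(i,i+1)$. If $3\le i\le n-3$, then there do not exist $x\in\mathfrak g$ and a subspace $H\subseteq\mathfrak g$ with $[\mathfrak b,H]\subseteq H$ such that $\mathcal B(x,H)$ is isomorphic (as a variety) to the Schubert variety $X_{s_iw_0}$.
   Context: $\mathfrak g,\mathfrak b$ are the Lie algebras of $G,B$. The Weyl group is $S_n$, $w_0=[n\,n-1\cdots 1]$ in one-line notation; $\dot w$ is a scalar multiple in $G$ of the permutation matrix with $e_i\mapsto e_{w(i)}$, and $X_w$ is the closure of $B\dot wB/B$ in $G/B$. For $x\in\mathfrak g$, $\mathcal B(x,H)=\{gB\in G/B:g^{-1}xg\in H\}$. *)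

theory Defs
  imports "Jordan_Normal_Form.Determinant" "HOL-Combinatorics.Permutations"
begin

text \<open>Matrices are n x n complex matrices of Jordan_Normal_Form; indices are 0-based
  (paper index k corresponds to index k-1 here).\<close>

datatype grp_type = GL | SL

definition mtrace :: "complex mat \<Rightarrow> complex" where
  "mtrace A = (\<Sum>i<dim_row A. A $$ (i,i))"

definition grp :: "grp_type \<Rightarrow> nat \<Rightarrow> complex mat set" where
  "grp t n = {g \<in> carrier_mat n n. det g \<noteq> 0 \<and> (t = SL \<longrightarrow> det g = 1)}"

definition lie_alg :: "grp_type \<Rightarrow> nat \<Rightarrow> complex mat set" where
  "lie_alg t n = {x \<in> carrier_mat n n. t = SL \<longrightarrow> mtrace x = 0}"

definition borel :: "grp_type \<Rightarrow> nat \<Rightarrow> complex mat set" where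
  "borel t n = {b \<in> grp t n. upper_triangular b}"

definition borel_alg :: "grp_type \<Rightarrow> nat \<Rightarrow> complex mat set" where
  "borel_alg t n = {b \<in> lie_alg t n. upper_triangular b}"

definition coset :: "grp_type \<Rightarrow> nat \<Rightarrow> complex mat \<Rightarrow> complex mat set" where
  "coset t n g = (\<lambda>b. g * b) ` borel t n"

definition flag :: "grp_type \<Rightarrow> nat \<Rightarrow> complex mat set set" where
  "flag t n = coset t n ` grp t n"

definition lie_subspace :: "grp_type \<Rightarrow> nat \<Rightarrow> complex mat set \<Rightarrow> bool" where
  "lie_subspace t n H \<longleftrightarrow> H \<subseteq> lie_alg t n \<and> 0\<^sub>m n n \<in> H \<and>
     (\<forall>a\<in>H. \<forall>b\<in>H. a + b \<in> H) \<and> (\<forall>c::complex. \<forall>a\<in>H. c \<cdot>\<^sub>m a \<in> H)"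

definition b_stable :: "grp_type \<Rightarrow> nat \<Rightarrow> complex mat set \<Rightarrow> bool" where
  "b_stable t n H \<longleftrightarrow> (\<forall>b\<in>borel_alg t n. \<forall>h\<in>H. b * h - h * b \<in> H)"

text \<open>B(x,H) = {gB : g^{-1} x g \<in> H}; g^{-1} x g = y is written as x g = g y.\<close>
definition hess :: "grp_type \<Rightarrow> nat \<Rightarrow> complex mat \<Rightarrow> complex mat set \<Rightarrow> complex mat set set" where
  "hess t n x H = {C \<in> flag t n. \<exists>g\<in>grp t n. C = coset t n g \<and> (\<exists>y\<in>H. x * g = g * y)}"

definition perm_mat :: "nat \<Rightarrow> (nat \<Rightarrow> nat) \<Rightarrow> complex mat" where
  "perm_mat n w = mat n n (\<lambda>(i,j). if i = w j then 1 else 0)"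

text \<open>s_k = (k, k+1) in 1-based notation, i.e. swapping k-1 and k 0-based; w_0 reverses.\<close>
definition s_perm :: "nat \<Rightarrow> nat \<Rightarrow> nat" where
  "s_perm k = (\<lambda>j. if j = k - 1 then k else if j = k then k - 1 else j)"

definition w0_perm :: "nat \<Rightarrow> nat \<Rightarrow> nat" where
  "w0_perm n = (\<lambda>j. if j < n then n - 1 - j else j)"

text \<open>Schubert cell B w B / B (the representative of w is a nonzero multiple of its
  permutation matrix lying in G).\<close>
definition schubert_cell :: "grp_type \<Rightarrow> nat \<Rightarrow> (nat \<Rightarrow> nat) \<Rightarrow> complex mat set set" where
  "schubert_cell t n w = {C \<in> flag t n. \<exists>b\<in>borel t n. \<exists>c::complex. c \<noteq> 0 \<and>
       b * (c \<cdot>\<^sub>m perm_mat n w) \<in> C}"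

text \<open>Affine charts of G/B: C lies in the chart w U^- B/B with coordinates u
  (u lower unitriangular) iff a multiple of P_w u lies in C.\<close>
definition lower_uni :: "nat \<Rightarrow> complex mat set" where
  "lower_uni n = {u \<in> carrier_mat n n. \<forall>i<n. \<forall>j<n.
      (i < j \<longrightarrow> u $$ (i,j) = 0) \<and> (i = j \<longrightarrow> u $$ (i,j) = 1)}"

definition in_chart :: "nat \<Rightarrow> (nat \<Rightarrow> nat) \<Rightarrow> complex mat set \<Rightarrow> complex mat \<Rightarrow> bool" where
  "in_chart n w C u \<longleftrightarrow> u \<in> lower_uni n \<and> (\<exists>c::complex. c \<noteq> 0 \<and> c \<cdot>\<^sub>m (perm_mat n w * u) \<in> C)"

definition coords :: "complex mat \<Rightarrow> nat \<times> nat \<Rightarrow> complex" where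
  "coords u = (\<lambda>(i,j). u $$ (i,j))"

inductive_set polyfun :: "(('v \<Rightarrow> complex) \<Rightarrow> complex) set" where
  pconst: "(\<lambda>_. c) \<in> polyfun"
| pvar: "(\<lambda>z. z v) \<in> polyfun"
| padd: "p \<in> polyfun \<Longrightarrow> q \<in> polyfun \<Longrightarrow> (\<lambda>z. p z + q z) \<in> polyfun"
| pmult: "p \<in> polyfun \<Longrightarrow> q \<in> polyfun \<Longrightarrow> (\<lambda>z. p z * q z) \<in> polyfun"

definition zclosed :: "grp_type \<Rightarrow> nat \<Rightarrow> complex mat set set \<Rightarrow> bool" where
  "zclosed t n S \<longleftrightarrow> S \<subseteq> flag t n \<and> (\<forall>w. w permutes {..<n} \<longrightarrow>
     (\<exists>F \<subseteq> polyfun. \<forall>C\<in>flag t n. \<forall>u. in_chart n w C u \<longrightarrow>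
        (C \<in> S \<longleftrightarrow> (\<forall>p\<in>F. p (coords u) = 0))))"

definition zclosure :: "grp_type \<Rightarrow> nat \<Rightarrow> complex mat set set \<Rightarrow> complex mat set set" where
  "zclosure t n A = \<Inter> {S. zclosed t n S \<and> A \<subseteq> S}"

definition schubert :: "grp_type \<Rightarrow> nat \<Rightarrow> (nat \<Rightarrow> nat) \<Rightarrow> complex mat set set" where
  "schubert t n w = zclosure t n (schubert_cell t n w)"

text \<open>Morphisms between subsets of G/B (with their reduced induced variety structure):
  locally, on a principal open subset of an affine chart, the map lands in an affine
  chart and its chart coordinates are quotients of polynomials.\<close>
definition morphism :: "grp_type \<Rightarrow> nat \<Rightarrow> complex mat set set \<Rightarrow> complex mat set set
     \<Rightarrow> (complex mat set \<Rightarrow> complex mat set) \<Rightarrow> bool" where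
  "morphism t n X Y f \<longleftrightarrow> (\<forall>C\<in>X. f C \<in> Y) \<and>
     (\<forall>C\<in>X. \<exists>w v h g. w permutes {..<n} \<and> v permutes {..<n} \<and> h \<in> polyfun \<and>
        (\<forall>k. g k \<in> polyfun) \<and>
        (\<exists>u. in_chart n w C u \<and> h (coords u) \<noteq> 0) \<and>
        (\<forall>D\<in>X. \<forall>u. in_chart n w D u \<and> h (coords u) \<noteq> 0 \<longrightarrow>
           (\<exists>u'. in_chart n v (f D) u' \<and>
              (\<forall>i<n. \<forall>j<i. u' $$ (i,j) = g (i,j) (coords u) / h (coords u)))))"

definition iso_var :: "grp_type \<Rightarrow> nat \<Rightarrow> complex mat set set \<Rightarrow> complex mat set set \<Rightarrow> bool" where
  "iso_var t n X Y \<longleftrightarrow> (\<exists>f g. morphism t n X Y f \<and> morphism t n Y X g \<and>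
     (\<forall>C\<in>X. g (f C) = C) \<and> (\<forall>D\<in>Y. f (g D) = D))"

end

theory Submission
  imports Defs
begin

text \<open>The obstruction is the multiplicity of singular points. The divisor of flags whose member of dimension
  n - i meets the span of the first i basis vectors contains, in the affine chart at the base point, every
  coordinate 2-plane, because min(i, n - i) is at least 3 and two elementary matrices disturb only two
  columns; so no equation of order at most two holds on it there. If B(x,H) is neither empty nor G/B, then
  x is not scalar and H lies in the hyperplane where the lower left entry vanishes, so B(x,H) satisfies the
  single equation that the lower left entry of the conjugate of x vanishes, which has order at most two at
  every point. An isomorphism has an invertible differential at the base point, which transports one
  situation to the other. If B(x,H) is all of G/B, the same argument applies in the other direction to the
  order-one equation of the divisor at the torus fixed point of its open cell.

  Differentials are taken along curves: a function is called smooth at a point if it maps curves through the point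
  to differentiable functions with derivative linear in the velocity.\<close>

section \<open>Differentials along curves\<close>

text \<open>A transported curve is only known to be differentiable at 0, so no second-order Taylor
  expansion is available for it. The order-two condition is therefore written as a vanishing sum of
  products of two functions that both vanish at 0; division by \<open>s * s\<close> then involves
  first derivatives alone. A morphism comes with rational formulas that describe it only at points
  of the variety, so its differential is meaningful only on velocities of curves inside the variety.
  Every coordinate vector is such a velocity at the base point; hence the coordinate Jacobians of an
  isomorphism and its inverse are mutually inverse matrices. Polarization then turns vanishing on
  the images of coordinate vectors and of their pairwise sums into vanishing everywhere. The line
  \<open>1 + sV\<close> stays in the divisor once \<open>V\<close> has a zero column among the first
  min(i, n - i), but points of the Schubert variety are only available as points or limits of the
  cell. Hence the line is perturbed at order s^2 so that it runs inside the cell for small nonzero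
  s.\<close>

definition smooth_at :: "(('k \<Rightarrow> complex) \<Rightarrow> complex) \<Rightarrow> ('k \<Rightarrow> complex) \<Rightarrow> bool" where
  "smooth_at F a \<longleftrightarrow> (\<exists>S c. finite S \<and> (\<forall>z z'. (\<forall>k. z k 0 = a k) \<longrightarrow>
     (\<forall>k. (z k has_field_derivative z' k) (at 0)) \<longrightarrow>
     ((\<lambda>s. F (\<lambda>k. z k s)) has_field_derivative (\<Sum>k\<in>S. c k * z' k)) (at 0)))"

lemma smooth_atI:
  assumes "finite S"
    and "\<And>z z'. (\<And>k. z k 0 = a k) \<Longrightarrow> (\<And>k. (z k has_field_derivative z' k) (at 0)) \<Longrightarrow>
      ((\<lambda>s. F (\<lambda>k. z k s)) has_field_derivative (\<Sum>k\<in>S. c k * z' k)) (at 0)"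
  shows "smooth_at F a"
  unfolding smooth_at_def using assms by blast

lemma sum_extend_zero:
  assumes "finite T" "S \<subseteq> T"
  shows "(\<Sum>k\<in>T. (if k \<in> S then c k else 0) * (x k :: complex)) = (\<Sum>k\<in>S. c k * x k)"
proof -
  have "(\<Sum>k\<in>T. (if k \<in> S then c k else 0) * x k) = (\<Sum>k\<in>T. if k \<in> S then c k * x k else 0)"
    by (rule sum.cong) auto
  also have "\<dots> = (\<Sum>k\<in>T \<inter> S. c k * x k)"
    by (rule sum.inter_restrict[symmetric]) (rule assms)
  finally show ?thesis using assms(2) by (simp add: Int_absorb1)
qed

lemma smooth_at_const: "smooth_at (\<lambda>_. c) a"
  by (rule smooth_atI[where S = "{}" and c = "\<lambda>_. 0"]) auto

lemma smooth_at_var: "smooth_at (\<lambda>z. z k) a"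
  by (rule smooth_atI[where S = "{k}" and c = "\<lambda>_. 1"]) auto

lemma smooth_at_add:
  assumes "smooth_at F a" "smooth_at G a"
  shows "smooth_at (\<lambda>z. F z + G z) a"
proof -
  from assms(1) obtain S c where S: "finite S" and F: "\<And>z z'. (\<And>k. z k 0 = a k) \<Longrightarrow> (\<And>k. (z k has_field_derivative z' k) (at 0)) \<Longrightarrow>
      ((\<lambda>s. F (\<lambda>k. z k s)) has_field_derivative (\<Sum>k\<in>S. c k * z' k)) (at 0)"
    unfolding smooth_at_def by blast
  from assms(2) obtain T d where T: "finite T" and G: "\<And>z z'. (\<And>k. z k 0 = a k) \<Longrightarrow> (\<And>k. (z k has_field_derivative z' k) (at 0)) \<Longrightarrow>
      ((\<lambda>s. G (\<lambda>k. z k s)) has_field_derivative (\<Sum>k\<in>T. d k * z' k)) (at 0)"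
    unfolding smooth_at_def by blast
  show ?thesis
  proof (rule smooth_atI[where S = "S \<union> T" and c = "\<lambda>k. (if k \<in> S then c k else 0) + (if k \<in> T then d k else 0)"])
    show "finite (S \<union> T)" using S T by simp
    fix z z' assume z: "\<And>k. z k 0 = a k" "\<And>k. (z k has_field_derivative z' k) (at 0)"
    have "(\<Sum>k\<in>S \<union> T. ((if k \<in> S then c k else 0) + (if k \<in> T then d k else 0)) * z' k)
        = (\<Sum>k\<in>S. c k * z' k) + (\<Sum>k\<in>T. d k * z' k)"
      using sum_extend_zero[of "S \<union> T" S c z'] sum_extend_zero[of "S \<union> T" T d z'] S T
      by (simp add: distrib_right sum.distrib)
    then show "((\<lambda>s. F (\<lambda>k. z k s) + G (\<lambda>k. z k s)) has_field_derivative
        (\<Sum>k\<in>S \<union> T. ((if k \<in> S then c k else 0) + (if k \<in> T then d k else 0)) * z' k)) (at 0)"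
      using DERIV_add[OF F[of z z'] G[of z z']] z by simp
  qed
qed

text \<open>The chain rule. The derivative of \<open>F\<close> reads only the finitely many
  coordinates in \<open>S\<close>, so the union of the supports of \<open>G k\<close> over
  \<open>S\<close> is finite again, even when there are infinitely many variables.\<close>

lemma smooth_at_comp:
  assumes F: "smooth_at F (\<lambda>k. G k a)" and G: "\<And>k. smooth_at (G k) a"
  shows "smooth_at (\<lambda>z. F (\<lambda>k. G k z)) a"
proof -
  from F obtain S c where S: "finite S" and F: "\<And>z z'. (\<And>k. z k 0 = G k a) \<Longrightarrow> (\<And>k. (z k has_field_derivative z' k) (at 0)) \<Longrightarrow>
      ((\<lambda>s. F (\<lambda>k. z k s)) has_field_derivative (\<Sum>k\<in>S. c k * z' k)) (at 0)"
    unfolding smooth_at_def by blast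
  define Q where "Q k T d \<longleftrightarrow> finite T \<and> (\<forall>z z'. (\<forall>l. z l 0 = a l) \<longrightarrow>
     (\<forall>l. (z l has_field_derivative z' l) (at 0)) \<longrightarrow>
     ((\<lambda>s. G k (\<lambda>l. z l s)) has_field_derivative (\<Sum>l\<in>T. d l * z' l)) (at 0))" for k T d
  from G have "\<forall>k. \<exists>T d. Q k T d"
    unfolding smooth_at_def Q_def by blast
  then obtain T d where Q: "\<And>k. Q k (T k) (d k)"
    by metis
  then have T: "\<And>k. finite (T k)" and G: "\<And>k z z'. (\<forall>l. z l 0 = a l) \<Longrightarrow>
     (\<forall>l. (z l has_field_derivative z' l) (at 0)) \<Longrightarrow>
     ((\<lambda>s. G k (\<lambda>l. z l s)) has_field_derivative (\<Sum>l\<in>T k. d k l * z' l)) (at 0)"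
    unfolding Q_def by blast+
  let ?T = "\<Union>k\<in>S. T k"
  let ?d = "\<lambda>l. \<Sum>k\<in>S. c k * (if l \<in> T k then d k l else 0)"
  show ?thesis
  proof (rule smooth_atI[where S = ?T and c = ?d])
    show fin: "finite ?T" using S T by simp
    fix z z' assume z: "\<And>k. z k 0 = a k" "\<And>k. (z k has_field_derivative z' k) (at 0)"
    have a: "(\<lambda>k. z k 0) = a" using z by auto
    have "((\<lambda>s. F (\<lambda>k. G k (\<lambda>l. z l s))) has_field_derivative
        (\<Sum>k\<in>S. c k * (\<Sum>l\<in>T k. d k l * z' l))) (at 0)"
      by (rule F) (use a z G[of z z'] in auto)
    moreover have "(\<Sum>k\<in>S. c k * (\<Sum>l\<in>T k. d k l * z' l)) = (\<Sum>l\<in>?T. ?d l * z' l)"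
    proof -
      have "(\<Sum>l\<in>?T. ?d l * z' l) = (\<Sum>k\<in>S. \<Sum>l\<in>?T. c k * ((if l \<in> T k then d k l else 0) * z' l))"
        by (subst sum.swap) (simp add: sum_distrib_right mult.assoc)
      also have "\<dots> = (\<Sum>k\<in>S. c k * (\<Sum>l\<in>T k. d k l * z' l))"
      proof (rule sum.cong[OF refl])
        fix k assume "k \<in> S"
        then have "T k \<subseteq> ?T" by auto
        then show "(\<Sum>l\<in>?T. c k * ((if l \<in> T k then d k l else 0) * z' l)) = c k * (\<Sum>l\<in>T k. d k l * z' l)"
          using sum_extend_zero[OF fin, of "T k" "d k" z'] by (simp only: sum_distrib_left[symmetric])
      qed
      finally show ?thesis by simp
    qed
    ultimately show "((\<lambda>s. F (\<lambda>k. G k (\<lambda>l. z l s))) has_field_derivative (\<Sum>l\<in>?T. ?d l * z' l)) (at 0)"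
      by simp
  qed
qed

text \<open>A binary operation is a function of a \<open>bool\<close>-indexed pair, so products and
  quotients reduce to the chain rule.\<close>

lemma smooth_at_comp2:
  assumes "smooth_at (\<lambda>p :: bool \<Rightarrow> complex. H (p False) (p True)) (\<lambda>b. if b then G a else F a)"
    and "smooth_at F a" "smooth_at G a"
  shows "smooth_at (\<lambda>z. H (F z) (G z)) a"
proof -
  have "smooth_at (\<lambda>z. if k then G z else F z) a" for k
    using assms(2,3) by (cases k) simp_all
  then show ?thesis
    using smooth_at_comp[of "\<lambda>p. H (p False) (p True)" "\<lambda>b z. if b then G z else F z" a] assms(1)
    by simp
qed

lemma smooth_at_mult:
  assumes "smooth_at F a" "smooth_at G a"
  shows "smooth_at (\<lambda>z. F z * G z) a"
proof (rule smooth_at_comp2[where H = "(*)", OF _ assms])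
  show "smooth_at (\<lambda>p. p False * p True) (\<lambda>b. if b then G a else F a)"
  proof (rule smooth_atI[where S = UNIV and c = "\<lambda>b. if b then F a else G a"])
    fix z z' assume z: "\<And>k. z k 0 = (if k then G a else F a)" "\<And>k. (z k has_field_derivative z' k) (at 0)"
    show "((\<lambda>s. z False s * z True s) has_field_derivative (\<Sum>k\<in>UNIV. (if k then F a else G a) * z' k)) (at 0)"
      using DERIV_mult[OF z(2)[of False] z(2)[of True]] z(1)
      by (simp add: UNIV_bool algebra_simps)
  qed simp
qed

lemma smooth_at_divide:
  assumes "smooth_at F a" "smooth_at G a" "G a \<noteq> 0"
  shows "smooth_at (\<lambda>z. F z / G z) a"
proof (rule smooth_at_comp2[where H = "(/)", OF _ assms(1,2)])
  show "smooth_at (\<lambda>p. p False / p True) (\<lambda>b. if b then G a else F a)"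
  proof (rule smooth_atI[where S = UNIV and c = "\<lambda>b. if b then - F a / (G a * G a) else G a / (G a * G a)"])
    fix z z' assume z: "\<And>k. z k 0 = (if k then G a else F a)" "\<And>k. (z k has_field_derivative z' k) (at 0)"
    show "((\<lambda>s. z False s / z True s) has_field_derivative
      (\<Sum>k\<in>UNIV. (if k then - F a / (G a * G a) else G a / (G a * G a)) * z' k)) (at 0)"
      using DERIV_divide[OF z(2)[of False] z(2)[of True]] z(1) assms(3)
      by (simp add: UNIV_bool field_simps)
  qed simp
qed

lemma smooth_at_sum:
  assumes "\<And>i. i \<in> I \<Longrightarrow> smooth_at (F i) a"
  shows "smooth_at (\<lambda>z. \<Sum>i\<in>I. F i z) a"
  using assms
  by (induction I rule: infinite_finite_induct) (simp_all add: smooth_at_const smooth_at_add)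

lemma smooth_at_prod:
  assumes "\<And>i. i \<in> I \<Longrightarrow> smooth_at (F i) a"
  shows "smooth_at (\<lambda>z. \<Prod>i\<in>I. F i z) a"
  using assms
  by (induction I rule: infinite_finite_induct) (simp_all add: smooth_at_const smooth_at_mult)

lemma det_mat_expand:
  "det (mat k k (\<lambda>(i,j). F i j)) = (\<Sum>p\<in>{p. p permutes {0..<k}}. signof p * (\<Prod>i = 0..<k. F i (p i)))"
  unfolding det_def'[of "mat k k (\<lambda>(i,j). F i j)" k, simplified]
  by (rule sum.cong) (auto simp: permutes_in_image intro!: prod.cong)

lemma smooth_at_det:
  assumes "\<And>i j. i < k \<Longrightarrow> j < k \<Longrightarrow> smooth_at (F i j) a"
  shows "smooth_at (\<lambda>z. det (mat k k (\<lambda>(i,j). F i j z))) a"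
  unfolding det_mat_expand
  by (intro smooth_at_sum smooth_at_mult smooth_at_const smooth_at_prod assms)
     (auto dest: permutes_in_image)

lemma polyfun_smooth_at: "p \<in> polyfun \<Longrightarrow> smooth_at p a"
  by (induction rule: polyfun.induct)
     (simp_all add: smooth_at_const smooth_at_var smooth_at_add smooth_at_mult)

lemma polyfun_sum: "(\<And>i. i \<in> I \<Longrightarrow> F i \<in> polyfun) \<Longrightarrow> (\<lambda>z. \<Sum>i\<in>I. F i z) \<in> polyfun"
  by (induction I rule: infinite_finite_induct) (simp_all add: polyfun.intros)

lemma polyfun_prod: "(\<And>i. i \<in> I \<Longrightarrow> F i \<in> polyfun) \<Longrightarrow> (\<lambda>z. \<Prod>i\<in>I. F i z) \<in> polyfun"
  by (induction I rule: infinite_finite_induct) (simp_all add: polyfun.intros)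

lemma polyfun_det:
  assumes "\<And>i j. i < k \<Longrightarrow> j < k \<Longrightarrow> F i j \<in> polyfun"
  shows "(\<lambda>z. det (mat k k (\<lambda>(i,j). F i j z))) \<in> polyfun"
  unfolding det_mat_expand
  by (intro polyfun_sum polyfun.pmult polyfun.pconst polyfun_prod assms)
     (auto dest: permutes_in_image)

text \<open>Stands in for openness of a nonvanishing locus, along a single curve: differentiability
  at 0 gives continuity at 0.\<close>

lemma smooth_at_eventually_nonzero:
  assumes "smooth_at F a" "F a \<noteq> 0" "\<And>k. z k 0 = a k" "\<And>k. (z k has_field_derivative z' k) (at 0)"
  shows "eventually (\<lambda>s. F (\<lambda>k. z k s) \<noteq> 0) (nhds 0)"
proof -
  from assms obtain D where "((\<lambda>s. F (\<lambda>k. z k s)) has_field_derivative D) (at 0)"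
    unfolding smooth_at_def by blast
  then have c: "isCont (\<lambda>s. F (\<lambda>k. z k s)) 0" by (rule DERIV_isCont)
  have "(\<lambda>k. z k 0) = a" using assms(3) by auto
  then have "F (\<lambda>k. z k 0) \<noteq> 0" using assms(2) by simp
  with c have "eventually (\<lambda>s. F (\<lambda>k. z k s) \<noteq> 0) (at 0)"
    unfolding isCont_def by (rule tendsto_imp_eventually_ne)
  with \<open>F (\<lambda>k. z k 0) \<noteq> 0\<close> show ?thesis
    by (simp add: eventually_nhds_conv_at)
qed

section \<open>The flag variety and its affine charts\<close>

definition low_idx :: "nat \<Rightarrow> (nat \<times> nat) set" where
  "low_idx n = {(i,j). j < i \<and> i < n}"

definition low_mat :: "nat \<Rightarrow> (nat \<times> nat \<Rightarrow> complex) \<Rightarrow> complex mat" where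
  "low_mat n z = mat n n (\<lambda>(i,j). if i = j then 1 else if j < i then z (i,j) else 0)"

definition lead_minor :: "complex mat \<Rightarrow> nat \<Rightarrow> complex" where
  "lead_minor M k = det (mat k k (\<lambda>(r,c). M $$ (r,c)))"

text \<open>Cramer's formula for the entry (i,j) of the lower unitriangular factor in M = L U: the
  minor on rows 0..j-1, i and columns 0..j over the leading minor. It makes changes of chart
  rational.\<close>

definition lu_coord :: "complex mat \<Rightarrow> nat \<times> nat \<Rightarrow> complex" where
  "lu_coord M = (\<lambda>(i,j). det (mat (Suc j) (Suc j) (\<lambda>(r,c). M $$ (if r = j then i else r, c)))
     / lead_minor M (Suc j))"

lemma finite_low_idx: "finite (low_idx n)"
  by (rule finite_subset[of _ "{..<n} \<times> {..<n}"]) (auto simp: low_idx_def)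

lemma low_mat_carrier [simp]: "low_mat n z \<in> carrier_mat n n"
  by (simp add: low_mat_def)

lemma dim_low_mat [simp]: "dim_row (low_mat n z) = n" "dim_col (low_mat n z) = n"
  by (simp_all add: low_mat_def)

lemma low_mat_in_lower_uni: "low_mat n z \<in> lower_uni n"
  by (auto simp: low_mat_def lower_uni_def)

lemma lower_uni_index:
  assumes "u \<in> lower_uni n" "i < n"
  shows "u $$ (i,i) = 1" and "j < n \<Longrightarrow> i < j \<Longrightarrow> u $$ (i,j) = 0"
  using assms unfolding lower_uni_def by blast+

lemma low_mat_index: "i < n \<Longrightarrow> j < n \<Longrightarrow>
    low_mat n z $$ (i,j) = (if i = j then 1 else if j < i then z (i,j) else 0)"
  by (simp add: low_mat_def)

lemma lower_uni_eq_low_mat: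
  assumes "u \<in> lower_uni n" "\<And>i j. (i,j) \<in> low_idx n \<Longrightarrow> u $$ (i,j) = z (i,j)"
  shows "u = low_mat n z"
  by (rule eq_matI) (use assms in \<open>auto simp: low_mat_def lower_uni_def low_idx_def\<close>)

lemma low_mat_eqD:
  assumes "low_mat n z = low_mat n z'" "k \<in> low_idx n" shows "z k = z' k"
proof -
  obtain i j where k: "k = (i,j)" by (cases k)
  have "low_mat n z $$ (i,j) = low_mat n z' $$ (i,j)" using assms(1) by simp
  then show ?thesis using assms(2) k by (simp add: low_idx_def low_mat_index)
qed

lemma low_mat_zero: "(\<And>k. k \<in> low_idx n \<Longrightarrow> z k = 0) \<Longrightarrow> low_mat n z = 1\<^sub>m n"
  by (rule eq_matI) (auto simp: low_mat_def low_idx_def)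

lemma mult_index: "A \<in> carrier_mat n n \<Longrightarrow> B \<in> carrier_mat n n \<Longrightarrow> i < n \<Longrightarrow> j < n \<Longrightarrow>
    (A * B) $$ (i,j) = (\<Sum>k<n. A $$ (i,k) * B $$ (k,j))"
  by (auto simp: scalar_prod_def lessThan_atLeast0 intro!: sum.cong)

lemma det_lower_uni: assumes "u \<in> lower_uni n" shows "det u = 1"
proof -
  have u: "u \<in> carrier_mat n n" using assms by (simp add: lower_uni_def)
  have "det u = prod_list (diag_mat u)"
    by (rule det_lower_triangular[OF _ u]) (use assms in \<open>auto simp: lower_uni_def\<close>)
  also have "diag_mat u = map (\<lambda>_. 1) [0..<n]"
    using assms by (auto simp: diag_mat_def lower_uni_def)
  finally show ?thesis by (simp add: map_replicate_const)
qed

lemma grp_GL_iff: "g \<in> grp GL n \<longleftrightarrow> g \<in> carrier_mat n n \<and> det g \<noteq> 0"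
  by (auto simp: grp_def)

lemma borel_GL_iff: "g \<in> borel GL n \<longleftrightarrow> g \<in> carrier_mat n n \<and> upper_triangular g \<and> det g \<noteq> 0"
  by (auto simp: borel_def grp_def)

lemma borel_sub: "borel t n \<subseteq> borel GL n" "grp t n \<subseteq> grp GL n" "borel t n \<subseteq> grp t n"
  by (auto simp: borel_def grp_def)

lemma grp_carrier: "g \<in> grp t n \<Longrightarrow> g \<in> carrier_mat n n"
  by (auto simp: grp_def)

lemma borel_carrier: "g \<in> borel t n \<Longrightarrow> g \<in> carrier_mat n n"
  by (auto simp: borel_def grp_def)

lemma low_mat_grp: "low_mat n z \<in> grp t n"
  using det_lower_uni[OF low_mat_in_lower_uni] by (auto simp: grp_def)

lemma one_borel: "1\<^sub>m n \<in> borel t n" "1\<^sub>m n \<in> grp t n"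
  by (auto simp: borel_def grp_def)

lemma grp_mult: "g \<in> grp t n \<Longrightarrow> h \<in> grp t n \<Longrightarrow> g * h \<in> grp t n"
  by (auto simp: grp_def det_mult[of _ n])

lemma grp_inverse:
  assumes "g \<in> grp t n" obtains h where "h \<in> grp t n" "g * h = 1\<^sub>m n" "h * g = 1\<^sub>m n"
proof -
  have g: "g \<in> carrier_mat n n" "det g \<noteq> 0" using assms by (auto simp: grp_def)
  from det_non_zero_imp_unit[OF g, of "()"] obtain h where h: "h \<in> carrier_mat n n" "g * h = 1\<^sub>m n" "h * g = 1\<^sub>m n"
    by (auto simp: Units_def ring_mat_def)
  have "det g * det h = 1" using det_mult[OF g(1) h(1)] h(2) by simp
  then have "h \<in> grp t n" using h(1) assms by (auto simp: grp_def)
  with h that show ?thesis by blast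
qed

lemma upper_triangular_mult:
  fixes A B :: "complex mat"
  assumes A: "A \<in> carrier_mat n n" "upper_triangular A" and B: "B \<in> carrier_mat n n" "upper_triangular B"
  shows "upper_triangular (A * B)"
proof
  fix i j assume ij: "j < i" "i < dim_row (A * B)"
  then have i: "i < n" using A by simp
  have "(A * B) $$ (i,j) = (\<Sum>k<n. A $$ (i,k) * B $$ (k,j))"
    using ij i by (intro mult_index A B) auto
  also have "\<dots> = 0"
  proof (rule sum.neutral, rule ballI)
    fix k assume k: "k \<in> {..<n}"
    show "A $$ (i,k) * B $$ (k,j) = 0"
    proof (cases "k < i")
      case True then show ?thesis using upper_triangularD[OF A(2), of k i] A(1) i by simp
    next
      case False then show ?thesis using upper_triangularD[OF B(2), of j k] B(1) ij k by simp
    qed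
  qed
  finally show "(A * B) $$ (i,j) = 0" .
qed

lemma borel_diag_nonzero:
  assumes "b \<in> borel GL n" "j < n" shows "b $$ (j,j) \<noteq> 0"
proof -
  have b: "b \<in> carrier_mat n n" "upper_triangular b" "det b \<noteq> 0" using assms by (auto simp: borel_GL_iff)
  from upper_triangular_imp_det_eq_0_iff[OF b(1,2)] b(3) have "0 \<notin> set (diag_mat b)" by simp
  then show ?thesis using assms(2) b(1) by (force simp: diag_mat_def)
qed

lemma borel_GLI:
  assumes "b \<in> carrier_mat n n" "upper_triangular b" "\<And>j. j < n \<Longrightarrow> b $$ (j,j) \<noteq> 0"
  shows "b \<in> borel GL n"
proof -
  from upper_triangular_imp_det_eq_0_iff[OF assms(1,2)] have "det b \<noteq> 0"
    using assms(1,3) by (force simp: diag_mat_def)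
  then show ?thesis using assms by (simp add: borel_GL_iff)
qed

lemma borel_mult: "b \<in> borel t n \<Longrightarrow> b' \<in> borel t n \<Longrightarrow> b * b' \<in> borel t n"
  using upper_triangular_mult[of b n b'] grp_mult[of b t n b'] by (auto simp: borel_def dest: grp_carrier)

text \<open>Entries of the inverse below the diagonal vanish column by column from the left: in
  \<open>(c * b) $$ (i,j)\<close> only the term with the nonzero entry \<open>b $$ (j,j)\<close>
  survives.\<close>

lemma borel_inverse:
  assumes b: "b \<in> borel t n" obtains c where "c \<in> borel t n" "b * c = 1\<^sub>m n" "c * b = 1\<^sub>m n"
proof -
  from b have "b \<in> grp t n" by (simp add: borel_def)
  then obtain c where c: "c \<in> grp t n" "b * c = 1\<^sub>m n" "c * b = 1\<^sub>m n" by (rule grp_inverse)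
  note bc = borel_carrier[OF b] and cc = grp_carrier[OF c(1)]
  have ub: "upper_triangular b" using b by (simp add: borel_def)
  have "c $$ (i,j) = 0" if "j < i" "i < n" for i j
    using that
  proof (induction j rule: less_induct)
    case (less j)
    have "0 = (c * b) $$ (i,j)" using less.prems c(3) by simp
    also have "\<dots> = (\<Sum>k<n. c $$ (i,k) * b $$ (k,j))" using less.prems by (intro mult_index cc bc) auto
    also have "\<dots> = (\<Sum>k<n. if k = j then c $$ (i,j) * b $$ (j,j) else 0)"
    proof (rule sum.cong[OF refl])
      fix k assume k: "k \<in> {..<n}"
      consider "k < j" | "k = j" | "j < k" by linarith
      then show "c $$ (i,k) * b $$ (k,j) = (if k = j then c $$ (i,j) * b $$ (j,j) else 0)"
      proof cases
        case 1 then show ?thesis using less.IH[of k] less.prems by simp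
      next
        case 3 then show ?thesis using upper_triangularD[OF ub, of j k] bc k by simp
      qed simp
    qed
    also have "\<dots> = c $$ (i,j) * b $$ (j,j)" using less.prems by simp
    finally show ?case using borel_diag_nonzero[of b n j] b borel_sub(1)[of t n] less.prems by auto
  qed
  then have "upper_triangular c" using cc by auto
  then have "c \<in> borel t n" using c(1) by (simp add: borel_def)
  with c that show ?thesis by blast
qed

lemma complex_nth_root_exists:
  assumes "n > 0" obtains c :: complex where "c ^ n = z"
proof -
  let ?c = "rcis (root n (cmod z)) (Arg z / n)"
  have "?c ^ n = rcis (root n (cmod z) ^ n) (real n * (Arg z / real n))" by (rule DeMoivre2)
  also have "\<dots> = z" using assms by (simp add: rcis_cmod_Arg)
  finally show ?thesis using that by blast
qed

text \<open>An n-th root of the inverse determinant normalises the determinant to 1, which serves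
  both group types.\<close>

lemma grp_scale:
  assumes "g \<in> grp GL n" "n > 0" obtains c where "c \<noteq> 0" "c \<cdot>\<^sub>m g \<in> grp t n"
proof -
  obtain c where c: "c ^ n = inverse (det g)" using complex_nth_root_exists[OF assms(2)] .
  have d: "det g \<noteq> 0" "g \<in> carrier_mat n n" using assms by (auto simp: grp_GL_iff)
  then have "c ^ n * det g = 1" using c by simp
  moreover from this have "c \<noteq> 0" using assms(2) by (auto simp: zero_power)
  ultimately show ?thesis using that[of c] d by (auto simp: grp_def)
qed

lemma upper_triangular_smult:
  "b \<in> carrier_mat n n \<Longrightarrow> upper_triangular b \<Longrightarrow> upper_triangular (c \<cdot>\<^sub>m b :: complex mat)"
  by (auto intro!: upper_triangularI dest: upper_triangularD)

lemma borel_scale: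
  assumes "b \<in> borel GL n" "n > 0" obtains c where "c \<noteq> 0" "c \<cdot>\<^sub>m b \<in> borel t n"
proof -
  have b: "b \<in> grp GL n" "b \<in> carrier_mat n n" "upper_triangular b" using assms by (auto simp: borel_def grp_def)
  obtain c where "c \<noteq> 0" "c \<cdot>\<^sub>m b \<in> grp t n" using grp_scale[OF b(1) assms(2)] .
  with upper_triangular_smult[OF b(2,3)] that show ?thesis by (auto simp: borel_def)
qed

lemma coset_self: "g \<in> grp t n \<Longrightarrow> g \<in> coset t n g"
  unfolding coset_def using one_borel(1)[of n t] by (force dest: grp_carrier)

text \<open>Comparing determinants puts \<open>b\<close> into the Borel subgroup of type
  \<open>t\<close>, so later computations may use any invertible upper triangular matrix.\<close>

lemma coset_eqI:
  assumes g: "g \<in> grp t n" and h: "h \<in> grp t n" and b: "b \<in> borel GL n" and e: "g * b = h"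
  shows "coset t n g = coset t n h"
proof -
  note [simp] = grp_carrier[OF g] grp_carrier[OF h] borel_carrier[OF b]
  have "det g * det b = det h" using det_mult[of g n b] e by simp
  then have b': "b \<in> borel t n" using g h b by (auto simp: borel_def grp_def)
  obtain c where c: "c \<in> borel t n" "b * c = 1\<^sub>m n" "c * b = 1\<^sub>m n" using borel_inverse[OF b'] .
  note [simp] = borel_carrier[OF c(1)]
  have "g * x \<in> coset t n h" if x: "x \<in> borel t n" for x
  proof -
    note [simp] = borel_carrier[OF x]
    have "h * (c * x) = g * ((b * c) * x)" unfolding e[symmetric]
      by (simp add: assoc_mult_mat[of _ n n _ n _ n] mult_carrier_mat[of _ n n] del: c)
    then have "g * x = h * (c * x)" unfolding c(2) using left_mult_one_mat[of x n n] by simp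
    then show ?thesis unfolding coset_def using borel_mult[OF c(1) x] by blast
  qed
  moreover have "h * x \<in> coset t n g" if x: "x \<in> borel t n" for x
  proof -
    note [simp] = borel_carrier[OF x]
    have "h * x = g * (b * x)" unfolding e[symmetric]
      by (simp add: assoc_mult_mat[of _ n n _ n _ n])
    then show ?thesis unfolding coset_def using borel_mult[OF b' x] by blast
  qed
  ultimately show ?thesis unfolding coset_def by blast
qed

lemma coset_memD: "M \<in> coset t n g \<Longrightarrow> \<exists>b\<in>borel GL n. g * b = M"
  unfolding coset_def using borel_sub(1) by blast

lemma coset_eqD:
  assumes "h \<in> grp t n" "coset t n g = coset t n h"
  shows "\<exists>b\<in>borel GL n. g * b = h"
  using coset_self[OF assms(1)] assms(2) coset_memD by blast

text \<open>The scalar in \<open>in_chart\<close> is absorbed into the triangular matrix; conversely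
  \<open>borel_scale\<close> restores it. Charts can thus be handled over GL for both group
  types.\<close>

lemma in_chart_iff:
  assumes g: "g \<in> grp t n" and n: "n > 0"
  shows "in_chart n w (coset t n g) u \<longleftrightarrow> u \<in> lower_uni n \<and> (\<exists>b\<in>borel GL n. g * b = perm_mat n w * u)"
proof -
  note gc = grp_carrier[OF g]
  have "(\<exists>c. c \<noteq> 0 \<and> c \<cdot>\<^sub>m (perm_mat n w * u) \<in> coset t n g) \<longleftrightarrow> (\<exists>b\<in>borel GL n. g * b = perm_mat n w * u)"
    if u: "u \<in> lower_uni n"
  proof
    have pu: "perm_mat n w * u \<in> carrier_mat n n" using u by (auto simp: perm_mat_def lower_uni_def)
    assume "\<exists>c. c \<noteq> 0 \<and> c \<cdot>\<^sub>m (perm_mat n w * u) \<in> coset t n g"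
    then obtain c b where c: "c \<noteq> 0" and b: "b \<in> borel GL n" "g * b = c \<cdot>\<^sub>m (perm_mat n w * u)"
      using coset_memD by blast
    have "g * (inverse c \<cdot>\<^sub>m b) = inverse c \<cdot>\<^sub>m (c \<cdot>\<^sub>m (perm_mat n w * u))"
      using b(2) mult_smult_distrib[OF gc borel_carrier[OF b(1)], of "inverse c"] by simp
    also have "\<dots> = perm_mat n w * u" using pu c by (auto intro!: eq_matI)
    finally have "g * (inverse c \<cdot>\<^sub>m b) = perm_mat n w * u" .
    moreover have "inverse c \<cdot>\<^sub>m b \<in> borel GL n"
      using b(1) c upper_triangular_smult[of b n] by (auto simp: borel_GL_iff)
    ultimately show "\<exists>b\<in>borel GL n. g * b = perm_mat n w * u" by blast
  next
    assume "\<exists>b\<in>borel GL n. g * b = perm_mat n w * u"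
    then obtain b where b: "b \<in> borel GL n" "g * b = perm_mat n w * u" by blast
    obtain c where c: "c \<noteq> 0" "c \<cdot>\<^sub>m b \<in> borel t n" using borel_scale[OF b(1) n] .
    have "c \<cdot>\<^sub>m (perm_mat n w * u) = g * (c \<cdot>\<^sub>m b)"
      using b(2) mult_smult_distrib[OF gc borel_carrier[OF b(1)], of c] by simp
    then show "\<exists>c. c \<noteq> 0 \<and> c \<cdot>\<^sub>m (perm_mat n w * u) \<in> coset t n g"
      unfolding coset_def using c by blast
  qed
  then show ?thesis unfolding in_chart_def by blast
qed

lemma flagE: assumes "C \<in> flag t n" obtains g where "g \<in> grp t n" "C = coset t n g"
  using assms unfolding flag_def by blast

lemma flagI: "g \<in> grp t n \<Longrightarrow> coset t n g \<in> flag t n"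
  unfolding flag_def by blast

section \<open>Triangular decomposition\<close>

lemma det_zero_iff_kernel:
  "det (mat k k (\<lambda>(r,c). F r c :: complex)) = 0 \<longleftrightarrow>
    (\<exists>a. (\<exists>c<k. a c \<noteq> 0) \<and> (\<forall>r<k. (\<Sum>c<k. F r c * a c) = 0))"
proof -
  let ?A = "mat k k (\<lambda>(r,c). F r c)"
  have mv: "(?A *\<^sub>v vec k a) $ r = (\<Sum>c<k. F r c * a c)" if "r < k" for a r
    using that by (auto simp: scalar_prod_def lessThan_atLeast0 intro!: sum.cong)
  have "det ?A = 0 \<longleftrightarrow> (\<exists>v. v \<in> carrier_vec k \<and> v \<noteq> 0\<^sub>v k \<and> ?A *\<^sub>v v = 0\<^sub>v k)"
    by (rule det_0_iff_vec_prod_zero_field) simp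
  also have "\<dots> \<longleftrightarrow> (\<exists>a. vec k a \<noteq> 0\<^sub>v k \<and> ?A *\<^sub>v vec k a = 0\<^sub>v k)"
  proof
    assume "\<exists>v. v \<in> carrier_vec k \<and> v \<noteq> 0\<^sub>v k \<and> ?A *\<^sub>v v = 0\<^sub>v k"
    then obtain v where v: "v \<in> carrier_vec k" "v \<noteq> 0\<^sub>v k" "?A *\<^sub>v v = 0\<^sub>v k" by blast
    have "vec k (\<lambda>i. v $ i) = v" using v(1) by auto
    then show "\<exists>a. vec k a \<noteq> 0\<^sub>v k \<and> ?A *\<^sub>v vec k a = 0\<^sub>v k"
      using v by (intro exI[of _ "\<lambda>i. v $ i"]) simp
  qed (metis vec_carrier)
  also have "\<dots> \<longleftrightarrow> (\<exists>a. (\<exists>c<k. a c \<noteq> 0) \<and> (\<forall>r<k. (\<Sum>c<k. F r c * a c) = 0))"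
  proof -
    have "vec k a \<noteq> 0\<^sub>v k \<longleftrightarrow> (\<exists>c<k. a c \<noteq> 0)" for a :: "nat \<Rightarrow> complex"
      by (auto simp: vec_eq_iff)
    moreover have "?A *\<^sub>v vec k a = 0\<^sub>v k \<longleftrightarrow> (\<forall>r<k. (\<Sum>c<k. F r c * a c) = 0)" for a
      using mv[of _ a] by (auto simp: vec_eq_iff)
    ultimately show ?thesis by simp
  qed
  finally show ?thesis .
qed

lemma det_nonzero_solve:
  assumes "det (mat k k (\<lambda>(r,c). F r c :: complex)) \<noteq> 0"
  obtains a where "\<And>r. r < k \<Longrightarrow> (\<Sum>c<k. F r c * a c) = e r"
proof -
  let ?A = "mat k k (\<lambda>(r,c). F r c)"
  have "?A \<in> grp GL k" using assms by (simp add: grp_GL_iff)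
  then obtain B where B: "B \<in> grp GL k" "?A * B = 1\<^sub>m k" by (rule grp_inverse)
  note [simp] = grp_carrier[OF B(1)]
  define a where "a c = (\<Sum>l<k. B $$ (c,l) * e l)" for c
  have "(\<Sum>c<k. F r c * a c) = e r" if r: "r < k" for r
  proof -
    have "(\<Sum>c<k. F r c * a c) = (\<Sum>l<k. (\<Sum>c<k. F r c * B $$ (c,l)) * e l)"
      unfolding a_def by (simp add: sum_distrib_left sum_distrib_right mult.assoc) (rule sum.swap)
    also have "\<dots> = (\<Sum>l<k. (?A * B) $$ (r,l) * e l)"
      using r by (intro sum.cong refl arg_cong2[where f = "(*)"]) (subst mult_index[of _ k], auto)
    also have "\<dots> = (\<Sum>l<k. if l = r then e l else 0)"
      unfolding B(2) using r by (intro sum.cong) auto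
    also have "\<dots> = e r" using r by simp
    finally show ?thesis .
  qed
  then show ?thesis by (rule that)
qed

lemma sum_lessThan_trunc:
  fixes k n :: nat
  assumes "k \<le> n" "\<And>c. k \<le> c \<Longrightarrow> c < n \<Longrightarrow> f c = (0::complex)"
  shows "(\<Sum>c<n. f c) = (\<Sum>c<k. f c)"
  by (rule sum.mono_neutral_right) (use assms in \<open>auto simp: not_less[symmetric]\<close>)

lemma lead_minor_kernel_trivial:
  assumes "lead_minor M k \<noteq> 0" "\<And>r. r < k \<Longrightarrow> (\<Sum>c<k. M $$ (r,c) * a c) = 0" "c < k"
  shows "a c = 0"
  using assms det_zero_iff_kernel[of k "\<lambda>r c. M $$ (r,c)"] unfolding lead_minor_def by blast

text \<open>Column elimination: solve the system of size j + 1 with the last unit vector on the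
  right. If coordinate \<open>j\<close> were 0, the invertible minor of size j would force the whole
  vector to be 0.\<close>

lemma pivot_vector:
  assumes "lead_minor M j \<noteq> 0" "lead_minor M (Suc j) \<noteq> 0"
  obtains a where "a j \<noteq> 0" "\<And>c. c > j \<Longrightarrow> a c = 0"
    "\<And>r. r < j \<Longrightarrow> (\<Sum>c<Suc j. M $$ (r,c) * a c) = 0" "(\<Sum>c<Suc j. M $$ (j,c) * a c) = 1"
proof -
  obtain a where a: "\<And>r. r < Suc j \<Longrightarrow> (\<Sum>c<Suc j. M $$ (r,c) * a c) = (if r = j then 1 else 0)"
    using det_nonzero_solve[of "Suc j" "\<lambda>r c. M $$ (r,c)" "\<lambda>r. if r = j then 1 else 0"] assms(2)
    unfolding lead_minor_def by blast
  have "a j \<noteq> 0"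
  proof
    assume z: "a j = 0"
    have "(\<Sum>c<j. M $$ (r,c) * a c) = 0" if "r < j" for r using a[of r] z that by simp
    then have "a c = 0" if "c < j" for c
      using lead_minor_kernel_trivial[OF assms(1)] that by blast
    then have "(\<Sum>c<Suc j. M $$ (j,c) * a c) = 0" using z by simp
    with a[of j] show False by simp
  qed
  moreover define a' where "a' c = (if c \<le> j then a c else 0)" for c
  moreover have "(\<Sum>c<Suc j. M $$ (r,c) * a' c) = (\<Sum>c<Suc j. M $$ (r,c) * a c)" for r
    by (rule sum.cong) (auto simp: a'_def)
  ultimately show ?thesis using a that[of a'] by auto
qed

lemma upper_matrix_mult:
  assumes M: "M \<in> carrier_mat n n" and a: "\<And>j c. j < n \<Longrightarrow> c > j \<Longrightarrow> a j c = (0::complex)"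
    and r: "r < n" "j < n"
  shows "(M * mat n n (\<lambda>(c,j). a j c)) $$ (r,j) = (\<Sum>c<Suc j. M $$ (r,c) * a j c)"
proof -
  have "(M * mat n n (\<lambda>(c,j). a j c)) $$ (r,j) = (\<Sum>c<n. M $$ (r,c) * mat n n (\<lambda>(c,j). a j c) $$ (c,j))"
    using M r by (intro mult_index) auto
  also have "\<dots> = (\<Sum>c<n. M $$ (r,c) * a j c)" using r by (intro sum.cong) auto
  also have "\<dots> = (\<Sum>c<Suc j. M $$ (r,c) * a j c)"
    using r a[of j] by (intro sum_lessThan_trunc) auto
  finally show ?thesis .
qed

lemma LU_exists:
  assumes M: "M \<in> carrier_mat n n" and minors: "\<And>k. k \<le> n \<Longrightarrow> lead_minor M k \<noteq> 0"
  shows "\<exists>b\<in>borel GL n. M * b \<in> lower_uni n"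
proof -
  have "\<exists>a. a j \<noteq> 0 \<and> (\<forall>c>j. a c = 0) \<and> (\<forall>r<j. (\<Sum>c<Suc j. M $$ (r,c) * a c) = 0) \<and>
     (\<Sum>c<Suc j. M $$ (j,c) * a c) = 1" if "j < n" for j
  proof -
    have "lead_minor M j \<noteq> 0" "lead_minor M (Suc j) \<noteq> 0" using minors[of j] minors[of "Suc j"] that by auto
    then show ?thesis by (rule pivot_vector) blast
  qed
  then have "\<forall>j. \<exists>a. j < n \<longrightarrow> a j \<noteq> 0 \<and> (\<forall>c>j. a c = 0) \<and> (\<forall>r<j. (\<Sum>c<Suc j. M $$ (r,c) * a c) = 0) \<and>
     (\<Sum>c<Suc j. M $$ (j,c) * a c) = 1" by blast
  from choice[OF this] obtain a where a: "\<And>j. j < n \<Longrightarrow> a j j \<noteq> 0 \<and> (\<forall>c>j. a j c = 0) \<and>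
     (\<forall>r<j. (\<Sum>c<Suc j. M $$ (r,c) * a j c) = 0) \<and> (\<Sum>c<Suc j. M $$ (j,c) * a j c) = 1" by blast
  let ?b = "mat n n (\<lambda>(c,j). a j c)"
  have "?b \<in> borel GL n"
    by (rule borel_GLI) (use a in auto)
  moreover have "M * ?b \<in> lower_uni n"
  proof -
    have "(M * ?b) $$ (r,j) = (\<Sum>c<Suc j. M $$ (r,c) * a j c)" if "r < n" "j < n" for r j
      using that a by (intro upper_matrix_mult M) auto
    then show ?thesis using a M unfolding lower_uni_def by auto
  qed
  ultimately show ?thesis by blast
qed

text \<open>Because \<open>b\<close> is upper triangular, the first k columns of
  \<open>u * b\<close> involve only the first k columns of \<open>u\<close>, and Cauchy-Binet
  collapses to one term. The row selection \<open>\<rho>\<close> covers both leading minors and the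
  numerators of \<open>lu_coord\<close>.\<close>

lemma det_sub_product:
  assumes u: "u \<in> carrier_mat n n" and b: "b \<in> carrier_mat n n" "upper_triangular b"
    and k: "k \<le> n" and \<rho>: "\<And>r. r < k \<Longrightarrow> \<rho> r < n"
  shows "det (mat k k (\<lambda>(r,c). (u * b) $$ (\<rho> r, c))) =
     det (mat k k (\<lambda>(r,c). u $$ (\<rho> r, c))) * lead_minor b k"
proof -
  let ?u = "mat k k (\<lambda>(r,c). u $$ (\<rho> r, c))" and ?b = "mat k k (\<lambda>(r,c). b $$ (r, c))"
  have "mat k k (\<lambda>(r,c). (u * b) $$ (\<rho> r, c)) = ?u * ?b"
  proof (rule eq_matI)
    fix r c assume "r < dim_row (?u * ?b)" "c < dim_col (?u * ?b)"
    then have rc: "r < k" "c < k" by auto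
    have "(u * b) $$ (\<rho> r, c) = (\<Sum>l<n. u $$ (\<rho> r, l) * b $$ (l,c))"
      using rc k \<rho> by (intro mult_index u b) auto
    also have "\<dots> = (\<Sum>l<k. u $$ (\<rho> r, l) * b $$ (l,c))"
      using k rc b upper_triangularD[OF b(2)] by (intro sum_lessThan_trunc) auto
    also have "\<dots> = (\<Sum>l<k. ?u $$ (r, l) * ?b $$ (l,c))"
      using rc by (intro sum.cong) auto
    also have "\<dots> = (?u * ?b) $$ (r,c)" using rc by (intro mult_index[symmetric]) auto
    finally show "mat k k (\<lambda>(r,c). (u * b) $$ (\<rho> r, c)) $$ (r,c) = (?u * ?b) $$ (r,c)"
      using rc by simp
  qed auto
  then show ?thesis unfolding lead_minor_def using det_mult[of ?u k ?b] by simp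
qed

lemma lead_minor_upper:
  assumes "b \<in> borel GL n" "k \<le> n" shows "lead_minor b k \<noteq> 0"
proof -
  have b: "b \<in> carrier_mat n n" "upper_triangular b" using assms by (auto simp: borel_GL_iff)
  have "mat k k (\<lambda>(r,c). b $$ (r,c)) \<in> borel GL k"
    using b assms borel_diag_nonzero[OF assms(1)]
    by (intro borel_GLI upper_triangularI) (auto dest: upper_triangularD)
  then show ?thesis by (simp add: borel_GL_iff lead_minor_def)
qed

text \<open>Write \<open>M\<close> as the unitriangular matrix times the upper triangular inverse of
  \<open>b\<close>. Numerator and denominator of \<open>lu_coord\<close> both acquire the same
  leading minor of that inverse; what remains of the numerator is lower triangular with diagonal 1,
  ..., 1 and the entry (i,j).\<close>

lemma LU_coords:
  assumes M: "M \<in> carrier_mat n n" and b: "b \<in> borel GL n" and u: "M * b \<in> lower_uni n"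
  shows "M * b = low_mat n (lu_coord M)" "k \<le> n \<Longrightarrow> lead_minor M k \<noteq> 0"
proof -
  obtain c where c: "c \<in> borel GL n" "b * c = 1\<^sub>m n" using borel_inverse[OF b] by blast
  let ?u = "M * b"
  have uc: "?u \<in> carrier_mat n n" using u by (simp add: lower_uni_def)
  have cc: "c \<in> carrier_mat n n" "upper_triangular c" using c(1) by (auto simp: borel_GL_iff)
  have M': "M = ?u * c" using c(2) assoc_mult_mat[OF M borel_carrier[OF b] cc(1)] M by simp
  have lm: "lead_minor M k = lead_minor c k" if "k \<le> n" for k
  proof -
    have "det (mat k k (\<lambda>(r,c). ?u $$ (r, c))) = 1"
    proof (rule det_lower_uni)
      show "mat k k (\<lambda>(r,c). ?u $$ (r, c)) \<in> lower_uni k"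
        unfolding lower_uni_def[of k] using that lower_uni_index[OF u] by auto
    qed
    then show ?thesis using det_sub_product[OF uc cc that, of "\<lambda>r. r"] that M'
      by (simp add: lead_minor_def)
  qed
  then show "k \<le> n \<Longrightarrow> lead_minor M k \<noteq> 0" using lead_minor_upper[OF c(1)] by simp
  show "?u = low_mat n (lu_coord M)"
  proof (rule lower_uni_eq_low_mat[OF u])
    fix i j assume ij: "(i,j) \<in> low_idx n"
    then have ij': "j < i" "i < n" "Suc j \<le> n" by (auto simp: low_idx_def)
    let ?v = "mat (Suc j) (Suc j) (\<lambda>(r,c). ?u $$ (if r = j then i else r, c))"
    have "det (mat (Suc j) (Suc j) (\<lambda>(r,c). M $$ (if r = j then i else r, c))) = det ?v * lead_minor c (Suc j)"
      using det_sub_product[OF uc cc ij'(3), of "\<lambda>r. if r = j then i else r"] ij' M' by simp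
    moreover have "det ?v = ?u $$ (i,j)"
    proof -
      have "det ?v = prod_list (diag_mat ?v)"
        by (rule det_lower_triangular[of "Suc j"]) (use u ij' in \<open>auto simp: lower_uni_def\<close>)
      also have "diag_mat ?v = map (\<lambda>_. 1) [0..<j] @ [?u $$ (i,j)]"
        using u ij' by (auto simp: diag_mat_def lower_uni_index)
      finally show ?thesis by (simp add: map_replicate_const)
    qed
    ultimately show "?u $$ (i,j) = lu_coord M (i,j)"
      using lm[OF ij'(3)] lead_minor_upper[OF c(1) ij'(3)] by (simp add: lu_coord_def)
  qed
qed

lemma LU_decomposition:
  assumes M: "M \<in> carrier_mat n n" and minors: "\<And>k. k \<le> n \<Longrightarrow> lead_minor M k \<noteq> 0"
  obtains b where "b \<in> borel GL n" "M * b = low_mat n (lu_coord M)"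
  using LU_exists[OF assms] LU_coords(1)[OF M] by blast

lemma smooth_at_lead_minor:
  assumes "\<And>i j. i < n \<Longrightarrow> j < n \<Longrightarrow> smooth_at (F i j) a" "k \<le> n"
  shows "smooth_at (\<lambda>z. lead_minor (mat n n (\<lambda>(i,j). F i j z)) k) a"
proof -
  have "smooth_at (\<lambda>z. det (mat k k (\<lambda>(i,j). F i j z))) a"
    by (rule smooth_at_det) (use assms in auto)
  moreover have "mat k k (\<lambda>(r,c). mat n n (\<lambda>(i,j). F i j z) $$ (r,c)) = mat k k (\<lambda>(i,j). F i j z)" for z
    using assms(2) by (intro cong_mat) auto
  ultimately show ?thesis by (simp add: lead_minor_def)
qed

lemma smooth_at_lu_coord:
  assumes F: "\<And>i j. i < n \<Longrightarrow> j < n \<Longrightarrow> smooth_at (F i j) a" and k: "(p,q) \<in> low_idx n"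
    and nz: "lead_minor (mat n n (\<lambda>(i,j). F i j a)) (Suc q) \<noteq> 0"
  shows "smooth_at (\<lambda>z. lu_coord (mat n n (\<lambda>(i,j). F i j z)) (p,q)) a"
proof -
  have pq: "q < p" "p < n" using k by (auto simp: low_idx_def)
  have "smooth_at (\<lambda>z. det (mat (Suc q) (Suc q) (\<lambda>(r,c). F (if r = q then p else r) c z))) a"
    by (rule smooth_at_det) (use F pq in auto)
  moreover have "mat (Suc q) (Suc q) (\<lambda>(r,c). mat n n (\<lambda>(i,j). F i j z) $$ (if r = q then p else r,c))
     = mat (Suc q) (Suc q) (\<lambda>(r,c). F (if r = q then p else r) c z)" for z
    using pq by (intro cong_mat) auto
  ultimately show ?thesis unfolding lu_coord_def
    using smooth_at_lead_minor[of n F a "Suc q"] F nz pq by (auto intro!: smooth_at_divide)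
qed

section \<open>Morphisms along curves\<close>

text \<open>\<open>coords\<close> reads all index pairs. Out of range, the value depends on
  dimensions and indices alone, which makes these coordinates constant along curves.\<close>

lemma mat_index_outside:
  assumes "A \<in> carrier_mat n m" "B \<in> carrier_mat n m" "\<not> (i < n \<and> j < m)"
  shows "A $$ (i,j) = B $$ (i,j)"
proof -
  have "mat n m f $$ (i,j) = mat n m g $$ (i,j)" for f g :: "nat \<times> nat \<Rightarrow> 'a"
  proof (cases "i < n")
    case True
    then have "m \<le> j" using assms(3) by simp
    with True show ?thesis
      by transfer (simp add: mk_mat_def undef_mat_def nth_map_out_of_bound)
  next
    case False
    then show ?thesis
      by transfer (simp add: mk_mat_def undef_mat_def nth_map_out_of_bound)
  qed
  moreover have "A = mat n m (\<lambda>k. A $$ k)" "B = mat n m (\<lambda>k. B $$ k)"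
    by (rule eq_matI; use assms in auto)+
  ultimately show ?thesis by metis
qed

lemma smooth_at_coords_low_mat: "smooth_at (\<lambda>z. coords (low_mat n z) k) a"
proof -
  obtain i j where k: "k = (i,j)" by (cases k)
  show ?thesis
  proof (cases "k \<in> low_idx n")
    case True
    then have "(\<lambda>z. coords (low_mat n z) k) = (\<lambda>z. z k)"
      using k by (auto simp: coords_def low_idx_def low_mat_index)
    then show ?thesis by (simp add: smooth_at_var)
  next
    case False
    have "coords (low_mat n z) k = coords (low_mat n (\<lambda>_. 0)) k" for z
    proof (cases "i < n \<and> j < n")
      case True then show ?thesis using False k by (auto simp: coords_def low_idx_def low_mat_index)
    next
      case False then show ?thesis unfolding k coords_def
        using mat_index_outside[of "low_mat n z" n n "low_mat n (\<lambda>_. 0)" i j] by simp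
    qed
    then have "(\<lambda>z. coords (low_mat n z) k) = (\<lambda>_. coords (low_mat n (\<lambda>_. 0)) k)" by blast
    then show ?thesis by (simp only: smooth_at_const)
  qed
qed

lemma smooth_at_mult_low_mat_entry:
  "i < n \<Longrightarrow> j < n \<Longrightarrow> smooth_at (\<lambda>z. \<Sum>k<n. A $$ (i,k) * low_mat n z $$ (k,j)) a"
proof (intro smooth_at_sum smooth_at_mult smooth_at_const)
  fix k
  show "smooth_at (\<lambda>z. low_mat n z $$ (k,j)) a"
    using smooth_at_coords_low_mat[of n "(k,j)" a] by (simp add: coords_def)
qed

lemma mult_low_mat_eq:
  assumes "A \<in> carrier_mat n n"
  shows "A * low_mat n z = mat n n (\<lambda>(i,j). \<Sum>k<n. A $$ (i,k) * low_mat n z $$ (k,j))"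
  by (rule eq_matI) (use assms mult_index[OF assms low_mat_carrier] in auto)

lemma smooth_at_lu_low:
  assumes "A \<in> carrier_mat n n" "k \<in> low_idx n" "\<And>k. k \<le> n \<Longrightarrow> lead_minor (A * low_mat n a) k \<noteq> 0"
  shows "smooth_at (\<lambda>z. lu_coord (A * low_mat n z) k) a"
proof -
  obtain p q where k: "k = (p,q)" by (cases k)
  have "Suc q \<le> n" using assms(2) k by (auto simp: low_idx_def)
  then show ?thesis
    using smooth_at_lu_coord[of n "\<lambda>i j z. \<Sum>k<n. A $$ (i,k) * low_mat n z $$ (k,j)" a p q]
      smooth_at_mult_low_mat_entry assms k by (simp add: mult_low_mat_eq)
qed

lemma eventually_lead_minors:
  assumes A: "A \<in> carrier_mat n n" and nz: "\<And>k. k \<le> n \<Longrightarrow> lead_minor (A * low_mat n a) k \<noteq> 0"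
    and x: "\<And>k. x k 0 = a k" "\<And>k. (x k has_field_derivative x' k) (at 0)"
  shows "eventually (\<lambda>s. \<forall>k\<le>n. lead_minor (A * low_mat n (\<lambda>k. x k s)) k \<noteq> 0) (nhds 0)"
proof -
  have "eventually (\<lambda>s. \<forall>k\<in>{..n}. lead_minor (A * low_mat n (\<lambda>k. x k s)) k \<noteq> 0) (nhds 0)"
  proof (rule eventually_ball_finite, simp, rule ballI)
    fix k assume "k \<in> {..n}"
    then have k: "k \<le> n" by simp
    have "smooth_at (\<lambda>z. lead_minor (A * low_mat n z) k) a"
      using smooth_at_lead_minor[of n "\<lambda>i j z. \<Sum>k<n. A $$ (i,k) * low_mat n z $$ (k,j)" a k]
        smooth_at_mult_low_mat_entry A k by (simp add: mult_low_mat_eq)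
    then show "eventually (\<lambda>s. lead_minor (A * low_mat n (\<lambda>k. x k s)) k \<noteq> 0) (nhds 0)"
      by (rule smooth_at_eventually_nonzero) (use nz k x in auto)
  qed
  then show ?thesis by (rule eventually_mono) auto
qed

text \<open>Coordinates off \<open>low_idx\<close> are kept identically zero: \<open>low_mat\<close>
  ignores them, but \<open>smooth_at\<close> asks for a differentiable curve in every
  coordinate.\<close>

definition tangent_curve :: "nat \<Rightarrow> (nat \<times> nat \<Rightarrow> complex \<Rightarrow> complex) \<Rightarrow> (nat \<times> nat \<Rightarrow> complex) \<Rightarrow> bool" where
  "tangent_curve n z v \<longleftrightarrow> (\<forall>k. z k 0 = 0) \<and> (\<forall>k. k \<notin> low_idx n \<longrightarrow> z k = (\<lambda>_. 0)) \<and>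
     (\<forall>k\<in>low_idx n. (z k has_field_derivative v k) (at 0))"

lemma tangent_curve_deriv:
  assumes "tangent_curve n z v"
  shows "(z k has_field_derivative (if k \<in> low_idx n then v k else 0)) (at 0)"
proof (cases "k \<in> low_idx n")
  case False
  then have "z k = (\<lambda>_. 0)" using assms unfolding tangent_curve_def by blast
  with False show ?thesis by simp
qed (use assms in \<open>simp add: tangent_curve_def\<close>)

lemma tangent_curve_zero: "tangent_curve n z v \<Longrightarrow> z k 0 = 0"
  unfolding tangent_curve_def by blast

lemma smooth_at_tangent:
  assumes "smooth_at F (\<lambda>_. 0)"
  shows "\<exists>c. \<forall>z v. tangent_curve n z v \<longrightarrow>
     ((\<lambda>s. F (\<lambda>k. z k s)) has_field_derivative (\<Sum>l\<in>low_idx n. c l * v l)) (at 0)"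
proof -
  from assms obtain S c where S: "finite S" and F: "\<And>z z'. (\<And>k. z k 0 = 0) \<Longrightarrow>
      (\<And>k. (z k has_field_derivative z' k) (at 0)) \<Longrightarrow>
      ((\<lambda>s. F (\<lambda>k. z k s)) has_field_derivative (\<Sum>k\<in>S. c k * z' k)) (at 0)"
    unfolding smooth_at_def by blast
  show ?thesis
  proof (intro exI allI impI)
    fix z v assume z: "tangent_curve n z v"
    have "((\<lambda>s. F (\<lambda>k. z k s)) has_field_derivative
       (\<Sum>k\<in>S. c k * (if k \<in> low_idx n then v k else 0))) (at 0)"
      by (rule F) (use tangent_curve_zero[OF z] tangent_curve_deriv[OF z] in auto)
    moreover have "(\<Sum>k\<in>S. c k * (if k \<in> low_idx n then v k else 0)) =
        (\<Sum>l\<in>low_idx n. (if l \<in> S then c l else 0) * v l)"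
    proof -
      have "(\<Sum>k\<in>S. c k * (if k \<in> low_idx n then v k else 0)) = (\<Sum>k\<in>S \<inter> low_idx n. c k * v k)"
        by (subst sum.inter_restrict[OF S]) (rule sum.cong, auto)
      also have "\<dots> = (\<Sum>l\<in>low_idx n. (if l \<in> S then c l else 0) * v l)"
        by (subst Int_commute, subst sum.inter_restrict[OF finite_low_idx]) (rule sum.cong, auto)
      finally show ?thesis .
    qed
    ultimately show "((\<lambda>s. F (\<lambda>k. z k s)) has_field_derivative
       (\<Sum>l\<in>low_idx n. (if l \<in> S then c l else 0) * v l)) (at 0)" by simp
  qed
qed

lemma low_mat_cong: "(\<And>k. k \<in> low_idx n \<Longrightarrow> z k = z' k) \<Longrightarrow> low_mat n z = low_mat n z'"
  by (rule eq_matI) (auto simp: low_mat_def low_idx_def)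

lemma left_factor_invertible:
  assumes "A \<in> carrier_mat n n" "B \<in> carrier_mat n n" "A * B \<in> grp GL n"
  shows "A \<in> grp GL n"
  using assms det_mult[of A n B] by (auto simp: grp_GL_iff)

lemma perm_mat_carrier [simp]: "perm_mat n w \<in> carrier_mat n n"
  by (simp add: perm_mat_def)

text \<open>In coordinates centred at \<open>a\<close> and \<open>b\<close> the morphism is a change
  of chart, then its rational formulas, then another change of chart, each smooth along curves. The
  Jacobian \<open>c\<close> is fixed before the curve is chosen.\<close>

lemma local_lift:
  assumes n: "n > 0" and mor: "morphism t n X Y f" and Y: "Y \<subseteq> flag t n"
    and a: "a \<in> grp t n" and b: "b \<in> grp t n" and aX: "coset t n a \<in> X"
    and fa: "f (coset t n a) = coset t n b"
  shows "\<exists>c. \<forall>z v. tangent_curve n z v \<longrightarrow>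
    eventually (\<lambda>s. coset t n (a * low_mat n (\<lambda>k. z k s)) \<in> X) (nhds 0) \<longrightarrow>
    (\<exists>y. tangent_curve n y (\<lambda>k. \<Sum>l\<in>low_idx n. c k l * v l) \<and>
      eventually (\<lambda>s. f (coset t n (a * low_mat n (\<lambda>k. z k s))) = coset t n (b * low_mat n (\<lambda>k. y k s))) (nhds 0))"
proof -
  note [simp] = grp_carrier[OF a] grp_carrier[OF b]
  have GL: "a \<in> grp GL n" "b \<in> grp GL n" using a b borel_sub(2) by auto
  from mor aX obtain w v h g u0 where h: "h \<in> polyfun" and g: "\<And>k. g k \<in> polyfun"
    and u0: "in_chart n w (coset t n a) u0" "h (coords u0) \<noteq> 0"
    and loc: "\<And>D u. D \<in> X \<Longrightarrow> in_chart n w D u \<Longrightarrow> h (coords u) \<noteq> 0 \<Longrightarrow>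
      \<exists>u'. in_chart n v (f D) u' \<and> (\<forall>i<n. \<forall>j<i. u' $$ (i,j) = g (i,j) (coords u) / h (coords u))"
    unfolding morphism_def by metis
  from u0(1) obtain b0 where u0l: "u0 \<in> lower_uni n" and b0: "b0 \<in> borel GL n" "a * b0 = perm_mat n w * u0"
    unfolding in_chart_iff[OF a n] by blast
  have u0c: "u0 \<in> carrier_mat n n" using u0l by (simp add: lower_uni_def)
  note [simp] = borel_carrier[OF b0(1)]
  have "perm_mat n w * u0 \<in> grp GL n"
    using grp_mult[of a GL n b0] GL b0 borel_sub(3)[of GL n] by auto
  then have "perm_mat n w \<in> grp GL n" using left_factor_invertible u0c by simp
  then obtain p where p: "p \<in> grp GL n" "perm_mat n w * p = 1\<^sub>m n" "p * perm_mat n w = 1\<^sub>m n"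
    by (rule grp_inverse)
  note [simp] = grp_carrier[OF p(1)]
  \<comment> \<open>\<open>perm_mat n w * A = a\<close>, so the triangular decomposition of
    \<open>A * low_mat n z\<close> gives the coordinates of the flag of
    \<open>a * low_mat n z\<close> in the chart of \<open>w\<close>.\<close>
  define A where "A = p * a"
  have A[simp]: "A \<in> carrier_mat n n" unfolding A_def by (rule mult_carrier_mat[of _ n n]) auto
  have PA: "perm_mat n w * A = a" unfolding A_def
    by (subst assoc_mult_mat[symmetric, of _ n n _ n _ n]) (auto simp: p left_mult_one_mat[of _ n n])
  have Ab0: "A * b0 = u0"
  proof -
    have "A * b0 = p * (a * b0)" unfolding A_def by (rule assoc_mult_mat[of _ n n _ n _ n]) auto
    also have "\<dots> = p * perm_mat n w * u0" unfolding b0(2) by (rule assoc_mult_mat[of _ n n _ n _ n, symmetric]) (use u0c in auto)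
    finally show ?thesis using p u0c by simp
  qed
  have zero: "A * low_mat n (\<lambda>_. 0) = A" by (simp add: low_mat_zero right_mult_one_mat[of _ n n])
  have nzA: "lead_minor (A * low_mat n (\<lambda>_. 0)) k \<noteq> 0" if "k \<le> n" for k
    unfolding zero using LU_coords(2)[OF A b0(1) _ that] Ab0 u0l by simp
  have u0eq: "u0 = low_mat n (lu_coord A)" using LU_coords(1)[OF A b0(1)] Ab0 u0l by simp
  define L where "L k = (\<lambda>z. (if k \<in> low_idx n then lu_coord (A * low_mat n z) k else 0))" for k
  have L_low: "low_mat n (\<lambda>k. L k z) = low_mat n (lu_coord (A * low_mat n z))" for z
    by (rule low_mat_cong) (simp add: L_def)
  have smL: "smooth_at (L k) (\<lambda>_. 0)" for k
    using smooth_at_lu_low[OF A _ nzA] by (cases "k \<in> low_idx n") (simp_all add: L_def smooth_at_const)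
  define Q where "Q k z = coords (low_mat n (\<lambda>l. L l z)) k" for k z
  have smQ: "smooth_at (Q k) (\<lambda>_. 0)" for k
    unfolding Q_def by (rule smooth_at_comp[OF smooth_at_coords_low_mat smL])
  have Q0: "(\<lambda>k. Q k (\<lambda>_. 0)) = coords u0"
    unfolding Q_def u0eq L_low zero by simp
  define h1 where "h1 z = h (\<lambda>k. Q k z)" for z
  have smh: "smooth_at h1 (\<lambda>_. 0)" unfolding h1_def
    by (rule smooth_at_comp[OF polyfun_smooth_at[OF h] smQ])
  have h10: "h1 (\<lambda>_. 0) \<noteq> 0" unfolding h1_def Q0 by (rule u0(2))
  \<comment> \<open>Coordinates of the image in the chart of \<open>v\<close>; the default 0 off
    \<open>low_idx\<close> makes them smooth in every index.\<close>
  define R where "R k = (\<lambda>z. (if k \<in> low_idx n then g k (\<lambda>l. Q l z) / h1 z else 0))" for k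
  have smR: "smooth_at (R k) (\<lambda>_. 0)" for k
  proof (cases "k \<in> low_idx n")
    case True
    have "smooth_at (\<lambda>z. g k (\<lambda>l. Q l z) / h1 z) (\<lambda>_. 0)"
      by (rule smooth_at_divide[OF smooth_at_comp[OF polyfun_smooth_at[OF g] smQ] smh h10])
    with True show ?thesis by (simp add: R_def)
  qed (simp add: R_def smooth_at_const)
  have step: "in_chart n v (f D) (low_mat n (\<lambda>k. R k z))"
    if D: "D = coset t n (a * low_mat n z)" "D \<in> X" and nz: "\<And>k. k \<le> n \<Longrightarrow> lead_minor (A * low_mat n z) k \<noteq> 0" "h1 z \<noteq> 0"
    for D z
  proof -
    have Az: "A * low_mat n z \<in> carrier_mat n n" by (rule mult_carrier_mat[of _ n n]) auto
    obtain b1 where b1: "b1 \<in> borel GL n" "A * low_mat n z * b1 = low_mat n (lu_coord (A * low_mat n z))"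
      using LU_decomposition[OF Az nz(1)] by blast
    note [simp] = borel_carrier[OF b1(1)]
    have "a * low_mat n z * b1 = perm_mat n w * (A * low_mat n z * b1)"
      by (subst PA[symmetric]) (simp add: assoc_mult_mat[of _ n n _ n _ n] mult_carrier_mat[of _ n n])
    then have ch: "in_chart n w D (low_mat n (\<lambda>k. L k z))"
      unfolding D(1) L_low using b1 in_chart_iff[OF grp_mult[OF a low_mat_grp] n] low_mat_in_lower_uni by metis
    have Q: "coords (low_mat n (\<lambda>k. L k z)) = (\<lambda>k. Q k z)" by (simp add: Q_def)
    from loc[OF D(2) ch] nz(2) obtain u' where u': "in_chart n v (f D) u'"
       "\<forall>i<n. \<forall>j<i. u' $$ (i,j) = g (i,j) (\<lambda>k. Q k z) / h1 z"
      unfolding Q h1_def by blast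
    have "u' = low_mat n (\<lambda>k. R k z)"
      by (rule lower_uni_eq_low_mat) (use u' in \<open>auto simp: in_chart_def R_def low_idx_def\<close>)
    with u' show ?thesis by simp
  qed
  have "in_chart n v (f (coset t n a)) (low_mat n (\<lambda>k. R k (\<lambda>_. 0)))"
    by (rule step) (use aX nzA h10 in \<open>auto simp: low_mat_zero right_mult_one_mat[of _ n n]\<close>)
  then obtain b1 where b1: "b1 \<in> borel GL n" "b * b1 = perm_mat n v * low_mat n (\<lambda>k. R k (\<lambda>_. 0))"
    unfolding fa in_chart_iff[OF b n] by blast
  note [simp] = borel_carrier[OF b1(1)]
  obtain q where q: "q \<in> grp GL n" "b * q = 1\<^sub>m n" "q * b = 1\<^sub>m n" using grp_inverse[OF GL(2)] by blast
  note [simp] = grp_carrier[OF q(1)]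
  \<comment> \<open>Now \<open>b * A2 = perm_mat n v\<close>, so decomposing \<open>A2\<close> times
    a point of the chart of \<open>v\<close> passes to coordinates centred at
    \<open>b\<close>.\<close>
  define A2 where "A2 = q * perm_mat n v"
  have A2[simp]: "A2 \<in> carrier_mat n n" unfolding A2_def by (rule mult_carrier_mat[of _ n n]) auto
  have bA2: "b * A2 = perm_mat n v" unfolding A2_def
    by (subst assoc_mult_mat[symmetric, of _ n n _ n _ n]) (auto simp: q left_mult_one_mat[of _ n n])
  have A2b1: "A2 * low_mat n (\<lambda>k. R k (\<lambda>_. 0)) = b1"
  proof -
    have "A2 * low_mat n (\<lambda>k. R k (\<lambda>_. 0)) = q * (b * b1)" unfolding A2_def b1(2) by (rule assoc_mult_mat[of _ n n _ n _ n]) auto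
    also have "\<dots> = q * b * b1" by (rule assoc_mult_mat[of _ n n _ n _ n, symmetric]) auto
    finally show ?thesis using q by (simp add: left_mult_one_mat[of _ n n])
  qed
  obtain b1i where b1i: "b1i \<in> borel GL n" "b1 * b1i = 1\<^sub>m n" using borel_inverse[OF b1(1)] by blast
  have one: "1\<^sub>m n = low_mat n (\<lambda>_. 0)" by (simp add: low_mat_zero)
  have one_l: "b1 * b1i \<in> lower_uni n" unfolding b1i(2) one by (rule low_mat_in_lower_uni)
  have nzA2: "lead_minor (A2 * low_mat n (\<lambda>k. R k (\<lambda>_. 0))) k \<noteq> 0" if "k \<le> n" for k
    unfolding A2b1 by (rule LU_coords(2)[OF _ b1i(1) one_l that]) simp
  have lu0: "lu_coord (A2 * low_mat n (\<lambda>k. R k (\<lambda>_. 0))) k = 0" if "k \<in> low_idx n" for k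
    using LU_coords(1)[OF _ b1i(1) one_l] b1i(2) one low_mat_eqD[OF _ that, of "\<lambda>_. 0"] unfolding A2b1 by simp
  define Y' where "Y' k = (\<lambda>z. (if k \<in> low_idx n then lu_coord (A2 * low_mat n (\<lambda>k. R k z)) k else 0))" for k
  have Y'0: "Y' k (\<lambda>_. 0) = 0" for k by (simp add: Y'_def lu0)
  have smY: "smooth_at (Y' k) (\<lambda>_. 0)" for k
  proof (cases "k \<in> low_idx n")
    case True
    have "smooth_at (\<lambda>z. lu_coord (A2 * low_mat n (\<lambda>k. R k z)) k) (\<lambda>_. 0)"
      using smooth_at_comp[OF smooth_at_lu_low[OF A2 True, where a = "\<lambda>k. R k (\<lambda>_. 0)", OF nzA2] smR] .
    with True show ?thesis by (simp add: Y'_def)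
  qed (simp add: Y'_def smooth_at_const)
  have "\<forall>k. \<exists>c. \<forall>z v. tangent_curve n z v \<longrightarrow>
     ((\<lambda>s. Y' k (\<lambda>k. z k s)) has_field_derivative (\<Sum>l\<in>low_idx n. c l * v l)) (at 0)"
    using smooth_at_tangent[OF smY] by blast
  from choice[OF this] obtain c where c: "\<And>k z v. tangent_curve n z v \<Longrightarrow>
     ((\<lambda>s. Y' k (\<lambda>k. z k s)) has_field_derivative (\<Sum>l\<in>low_idx n. c k l * v l)) (at 0)" by blast
  show ?thesis
  proof (intro exI[of _ c] allI impI)
    fix z v' assume z: "tangent_curve n z v'"
      and zX: "eventually (\<lambda>s. coset t n (a * low_mat n (\<lambda>k. z k s)) \<in> X) (nhds 0)"
    have z0: "(\<lambda>k. z k 0) = (\<lambda>_. 0)" using tangent_curve_zero[OF z] by auto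
    note zd = tangent_curve_deriv[OF z]
    let ?z = "\<lambda>s k. z k s"
    have ev1: "eventually (\<lambda>s. \<forall>k\<le>n. lead_minor (A * low_mat n (?z s)) k \<noteq> 0) (nhds 0)"
      by (rule eventually_lead_minors[where a = "\<lambda>_. 0"]) (use nzA zd tangent_curve_zero[OF z] in auto)
    have ev2: "eventually (\<lambda>s. h1 (?z s) \<noteq> 0) (nhds 0)"
      by (rule smooth_at_eventually_nonzero[OF smh h10]) (use zd tangent_curve_zero[OF z] in auto)
    have "\<exists>D. ((\<lambda>s. R k (?z s)) has_field_derivative D) (at 0)" for k
      using smooth_at_tangent[OF smR, of n k] z by blast
    then obtain R' where R': "\<And>k. ((\<lambda>s. R k (?z s)) has_field_derivative R' k) (at 0)" by metis
    have ev3: "eventually (\<lambda>s. \<forall>k\<le>n. lead_minor (A2 * low_mat n (\<lambda>k. R k (?z s))) k \<noteq> 0) (nhds 0)"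
      by (rule eventually_lead_minors[where a = "\<lambda>k. R k (\<lambda>_. 0)"]) (use nzA2 R' z0 in auto)
    let ?y = "\<lambda>k s. Y' k (?z s)"
    have "tangent_curve n ?y (\<lambda>k. \<Sum>l\<in>low_idx n. c k l * v' l)"
      unfolding tangent_curve_def
    proof (intro conjI allI ballI impI)
      show "Y' k (?z 0) = 0" for k unfolding z0 by (rule Y'0)
      show "(\<lambda>s. Y' k (?z s)) = (\<lambda>_. 0)" if "k \<notin> low_idx n" for k using that by (simp add: Y'_def)
      show "((\<lambda>s. Y' k (?z s)) has_field_derivative (\<Sum>l\<in>low_idx n. c k l * v' l)) (at 0)" for k
        by (rule c[OF z])
    qed
    moreover have "eventually (\<lambda>s. f (coset t n (a * low_mat n (?z s))) = coset t n (b * low_mat n (\<lambda>k. ?y k s))) (nhds 0)"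
      using zX ev1 ev2 ev3
    proof eventually_elim
      case (elim s)
      let ?D = "coset t n (a * low_mat n (?z s))"
      have ch: "in_chart n v (f ?D) (low_mat n (\<lambda>k. R k (?z s)))"
        by (rule step) (use elim in auto)
      have "f ?D \<in> flag t n" using mor elim(1) Y unfolding morphism_def by blast
      then obtain g2 where g2: "g2 \<in> grp t n" "f ?D = coset t n g2" by (rule flagE)
      note [simp] = grp_carrier[OF g2(1)]
      from ch obtain b2 where b2: "b2 \<in> borel GL n" "g2 * b2 = perm_mat n v * low_mat n (\<lambda>k. R k (?z s))"
        unfolding g2(2) in_chart_iff[OF g2(1) n] by blast
      let ?M = "A2 * low_mat n (\<lambda>k. R k (?z s))"
      have M: "?M \<in> carrier_mat n n" by (rule mult_carrier_mat[of _ n n]) auto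
      obtain b3 where b3: "b3 \<in> borel GL n" "?M * b3 = low_mat n (lu_coord ?M)"
        using LU_decomposition[OF M] elim by blast
      note [simp] = borel_carrier[OF b2(1)] borel_carrier[OF b3(1)]
      have "g2 * (b2 * b3) = g2 * b2 * b3" by (rule assoc_mult_mat[of _ n n _ n _ n, symmetric]) auto
      also have "\<dots> = b * (?M * b3)" unfolding b2(2) bA2[symmetric]
        by (simp add: assoc_mult_mat[of _ n n _ n _ n] mult_carrier_mat[of _ n n])
      also have "\<dots> = b * low_mat n (\<lambda>k. ?y k s)" unfolding b3(2)
        by (rule arg_cong[where f = "\<lambda>x. b * x"], rule low_mat_cong) (simp add: Y'_def)
      finally have "g2 * (b2 * b3) = b * low_mat n (\<lambda>k. ?y k s)" .
      then show ?case unfolding g2(2)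
        using coset_eqI[OF g2(1) grp_mult[OF b low_mat_grp] borel_mult[OF b2(1) b3(1)]] by blast
    qed
    ultimately show "\<exists>y. tangent_curve n y (\<lambda>k. \<Sum>l\<in>low_idx n. c k l * v' l) \<and>
      eventually (\<lambda>s. f (coset t n (a * low_mat n (?z s))) = coset t n (b * low_mat n (\<lambda>k. y k s))) (nhds 0)"
      by blast
  qed
qed

text \<open>Enumerating \<open>J\<close> turns both families into square matrices, where a left
  inverse is a right inverse.\<close>

lemma finite_left_inverse_right_inverse:
  fixes A B :: "'k \<Rightarrow> 'k \<Rightarrow> complex"
  assumes J: "finite J"
    and BA: "\<And>i j. i \<in> J \<Longrightarrow> j \<in> J \<Longrightarrow> (\<Sum>k\<in>J. B i k * A k j) = (if i = j then 1 else 0)"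
    and ij: "i \<in> J" "j \<in> J"
  shows "(\<Sum>k\<in>J. A i k * B k j) = (if i = j then 1 else 0)"
proof -
  let ?N = "card J"
  obtain e where e: "bij_betw e {..<?N} J"
    using ex_bij_betw_nat_finite[OF J] by (auto simp: lessThan_atLeast0)
  let ?A = "mat ?N ?N (\<lambda>(i,j). A (e i) (e j))" and ?B = "mat ?N ?N (\<lambda>(i,j). B (e i) (e j))"
  have eJ: "e p \<in> J" if "p < ?N" for p using e that by (auto simp: bij_betw_def)
  have inj: "e p = e q \<longleftrightarrow> p = q" if "p < ?N" "q < ?N" for p q
    using e that by (auto simp: bij_betw_def inj_on_def)
  have ent: "(mat ?N ?N (\<lambda>(i,j). F (e i) (e j)) * mat ?N ?N (\<lambda>(i,j). G (e i) (e j))) $$ (p,q)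
     = (\<Sum>k\<in>J. F (e p) k * G k (e q))" if "p < ?N" "q < ?N" for p q and F G :: "'k \<Rightarrow> 'k \<Rightarrow> complex"
  proof -
    have "(mat ?N ?N (\<lambda>(i,j). F (e i) (e j)) * mat ?N ?N (\<lambda>(i,j). G (e i) (e j))) $$ (p,q)
       = (\<Sum>k<?N. F (e p) (e k) * G (e k) (e q))"
      using that by (subst mult_index[of _ ?N]) auto
    also have "\<dots> = (\<Sum>k\<in>J. F (e p) k * G k (e q))"
      by (rule sum.reindex_bij_betw[OF e])
    finally show ?thesis .
  qed
  have "?B * ?A = 1\<^sub>m ?N"
  proof (rule eq_matI)
    fix p q assume "p < dim_row (1\<^sub>m ?N)" "q < dim_col (1\<^sub>m ?N)"
    then have pq: "p < ?N" "q < ?N" by auto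
    show "(?B * ?A) $$ (p,q) = 1\<^sub>m ?N $$ (p,q)"
      using ent[OF pq, of B A] BA[OF eJ[OF pq(1)] eJ[OF pq(2)]] inj[OF pq] pq by simp
  qed auto
  then have AB: "?A * ?B = 1\<^sub>m ?N" by (rule mat_mult_left_right_inverse[rotated 2]) auto
  have "i \<in> e ` {..<?N}" "j \<in> e ` {..<?N}" using ij e by (auto simp: bij_betw_def)
  then obtain p q where pq: "p < ?N" "q < ?N" "i = e p" "j = e q" by auto
  show ?thesis using ent[OF pq(1,2), of A B] inj[OF pq(1,2)] pq AB by simp
qed

definition curve_in :: "grp_type \<Rightarrow> nat \<Rightarrow> complex mat set set \<Rightarrow> complex mat \<Rightarrow> (nat \<times> nat \<Rightarrow> complex) \<Rightarrow>
    (nat \<times> nat \<Rightarrow> complex \<Rightarrow> complex) \<Rightarrow> bool" where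
  "curve_in t n X a v z \<longleftrightarrow> tangent_curve n z v \<and>
     eventually (\<lambda>s. coset t n (a * low_mat n (\<lambda>k. z k s)) \<in> X) (nhds 0)"

definition unit_at :: "'k \<Rightarrow> 'k \<Rightarrow> complex" where
  "unit_at k = (\<lambda>l. if l = k then 1 else 0)"

lemma left_inverse_cancel:
  fixes y :: "complex mat"
  assumes "q \<in> carrier_mat n n" "a \<in> carrier_mat n n" "y \<in> carrier_mat n n" "q * a = 1\<^sub>m n"
  shows "q * (a * y) = y"
  using assoc_mult_mat[OF assms(1-3)] assms(3,4) by simp

text \<open>Uniqueness of triangular decomposition: both matrices are the unitriangular factor of
  \<open>low_mat n z\<close>.\<close>

lemma low_mat_coset_inj:
  assumes a: "a \<in> grp t n" and e: "coset t n (a * low_mat n z) = coset t n (a * low_mat n z')"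
  shows "low_mat n z = low_mat n z'"
proof -
  note ac = grp_carrier[OF a]
  obtain b where b: "b \<in> borel GL n" "a * low_mat n z * b = a * low_mat n z'"
    using coset_eqD[OF grp_mult[OF a low_mat_grp] e] by blast
  note bc = borel_carrier[OF b(1)]
  obtain q where q: "q \<in> grp t n" "q * a = 1\<^sub>m n" using grp_inverse[OF a] by blast
  note qc = grp_carrier[OF q(1)]
  have "low_mat n z * b = q * (a * (low_mat n z * b))"
    using left_inverse_cancel[OF qc ac mult_carrier_mat[OF low_mat_carrier bc] q(2)] by simp
  also have "\<dots> = q * (a * low_mat n z')"
    using b(2) assoc_mult_mat[OF ac low_mat_carrier bc] by simp
  also have "\<dots> = low_mat n z'" by (rule left_inverse_cancel[OF qc ac low_mat_carrier q(2)])
  finally have 1: "low_mat n z * b = low_mat n z'" .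
  have 2: "low_mat n z * 1\<^sub>m n = low_mat n z" by (simp add: right_mult_one_mat[of _ n n])
  have "low_mat n z * b = low_mat n (lu_coord (low_mat n z))"
    by (rule LU_coords(1)[OF low_mat_carrier b(1)]) (simp add: 1 low_mat_in_lower_uni)
  moreover have "low_mat n z * 1\<^sub>m n = low_mat n (lu_coord (low_mat n z))"
    by (rule LU_coords(1)[OF low_mat_carrier one_borel(1)]) (simp add: 2 low_mat_in_lower_uni)
  ultimately show ?thesis using 1 2 by simp
qed

text \<open>Going forth and back along curves with coordinate velocities shows d c = 1; for square
  matrices also c d = 1. The latter says that the columns of \<open>c\<close> span.\<close>

lemma iso_differential:
  assumes n: "n > 0" and f: "morphism t n X Y f" and g: "morphism t n Y X g"
    and gf: "\<And>C. C \<in> X \<Longrightarrow> g (f C) = C"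
    and X: "X \<subseteq> flag t n" and Y: "Y \<subseteq> flag t n" and a: "a \<in> grp t n" and b: "b \<in> grp t n"
    and aX: "coset t n a \<in> X" and fa: "f (coset t n a) = coset t n b"
    and cur: "\<And>k. k \<in> low_idx n \<Longrightarrow> \<exists>z. curve_in t n X a (unit_at k) z"
  obtains c d where
    "\<And>i j. i \<in> low_idx n \<Longrightarrow> j \<in> low_idx n \<Longrightarrow> (\<Sum>k\<in>low_idx n. c i k * d k j) = (if i = j then 1 else 0)"
    "\<And>z v. curve_in t n X a v z \<Longrightarrow> \<exists>y. curve_in t n Y b (\<lambda>k. \<Sum>l\<in>low_idx n. c k l * v l) y"
proof -
  let ?J = "low_idx n"
  from local_lift[OF n f Y a b aX fa] obtain c where c: "\<And>z v. tangent_curve n z v \<Longrightarrow>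
    eventually (\<lambda>s. coset t n (a * low_mat n (\<lambda>k. z k s)) \<in> X) (nhds 0) \<Longrightarrow>
    \<exists>y. tangent_curve n y (\<lambda>k. \<Sum>l\<in>?J. c k l * v l) \<and>
      eventually (\<lambda>s. f (coset t n (a * low_mat n (\<lambda>k. z k s))) = coset t n (b * low_mat n (\<lambda>k. y k s))) (nhds 0)"
    by blast
  have bY: "coset t n b \<in> Y" using f aX fa unfolding morphism_def by metis
  have gb: "g (coset t n b) = coset t n a" using gf[OF aX] fa by simp
  from local_lift[OF n g X b a bY gb] obtain d where d: "\<And>z v. tangent_curve n z v \<Longrightarrow>
    eventually (\<lambda>s. coset t n (b * low_mat n (\<lambda>k. z k s)) \<in> Y) (nhds 0) \<Longrightarrow>
    \<exists>y. tangent_curve n y (\<lambda>k. \<Sum>l\<in>?J. d k l * v l) \<and>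
      eventually (\<lambda>s. g (coset t n (b * low_mat n (\<lambda>k. z k s))) = coset t n (a * low_mat n (\<lambda>k. y k s))) (nhds 0)"
    by blast
  have lift: "\<exists>y. curve_in t n Y b (\<lambda>k. \<Sum>l\<in>?J. c k l * v l) y \<and>
      eventually (\<lambda>s. f (coset t n (a * low_mat n (\<lambda>k. z k s))) = coset t n (b * low_mat n (\<lambda>k. y k s))) (nhds 0)"
    if z: "curve_in t n X a v z" for z v
  proof -
    have zX: "eventually (\<lambda>s. coset t n (a * low_mat n (\<lambda>k. z k s)) \<in> X) (nhds 0)"
      and zt: "tangent_curve n z v" using z by (auto simp: curve_in_def)
    from c[OF zt zX] obtain y where y: "tangent_curve n y (\<lambda>k. \<Sum>l\<in>?J. c k l * v l)"
      "eventually (\<lambda>s. f (coset t n (a * low_mat n (\<lambda>k. z k s))) = coset t n (b * low_mat n (\<lambda>k. y k s))) (nhds 0)"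
      by blast
    have "eventually (\<lambda>s. coset t n (b * low_mat n (\<lambda>k. y k s)) \<in> Y) (nhds 0)"
      using y(2) zX
    proof eventually_elim
      case (elim s)
      then show ?case using f unfolding morphism_def by metis
    qed
    with y show ?thesis unfolding curve_in_def by blast
  qed
  have dc: "(\<Sum>k\<in>?J. d i k * c k j) = (if i = j then 1 else 0)" if ij: "i \<in> ?J" "j \<in> ?J" for i j
  proof -
    obtain z where z: "curve_in t n X a (unit_at j) z" using cur[OF ij(2)] by blast
    have zX: "eventually (\<lambda>s. coset t n (a * low_mat n (\<lambda>k. z k s)) \<in> X) (nhds 0)"
      and zt: "tangent_curve n z (unit_at j)" using z by (auto simp: curve_in_def)
    have sj: "(\<Sum>l\<in>?J. c k l * unit_at j l) = c k j" for k
      using ij(2) finite_low_idx[of n] by (simp add: unit_at_def if_distrib[of "\<lambda>x. _ * x"] cong: if_cong)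
    from lift[OF z] obtain y where y: "curve_in t n Y b (\<lambda>k. c k j) y"
      "eventually (\<lambda>s. f (coset t n (a * low_mat n (\<lambda>k. z k s))) = coset t n (b * low_mat n (\<lambda>k. y k s))) (nhds 0)"
      unfolding sj by blast
    from y(1) d[of y "\<lambda>k. c k j"] obtain x where x: "tangent_curve n x (\<lambda>k. \<Sum>l\<in>?J. d k l * c l j)"
      "eventually (\<lambda>s. g (coset t n (b * low_mat n (\<lambda>k. y k s))) = coset t n (a * low_mat n (\<lambda>k. x k s))) (nhds 0)"
      unfolding curve_in_def by blast
    \<comment> \<open>Near 0 the returned curve passes through the same flags as the original one,
      and centred coordinates separate flags; so their velocities must agree.\<close>
    have "eventually (\<lambda>s. x i s = z i s) (nhds 0)"
      using x(2) y(2) zX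
    proof eventually_elim
      case (elim s)
      then have "coset t n (a * low_mat n (\<lambda>k. x k s)) = coset t n (a * low_mat n (\<lambda>k. z k s))"
        using gf by metis
      then show ?case using low_mat_eqD[OF low_mat_coset_inj[OF a] ij(1)] by blast
    qed
    moreover have "(x i has_field_derivative (\<Sum>l\<in>?J. d i l * c l j)) (at 0)"
      using x(1) ij(1) unfolding tangent_curve_def by blast
    ultimately have "(z i has_field_derivative (\<Sum>l\<in>?J. d i l * c l j)) (at 0)"
      using DERIV_cong_ev[OF refl _ refl] by blast
    moreover have "(z i has_field_derivative unit_at j i) (at 0)"
      using zt ij(1) unfolding tangent_curve_def by blast
    ultimately have "(\<Sum>l\<in>?J. d i l * c l j) = unit_at j i" by (rule DERIV_unique)
    then show ?thesis by (simp add: unit_at_def)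
  qed
  show ?thesis
    by (rule that[of c d]) (use finite_left_inverse_right_inverse[OF finite_low_idx dc] lift in blast)+
qed

section \<open>The equation of B(x,H)\<close>

definition lin_on :: "'k set \<Rightarrow> (('k \<Rightarrow> complex) \<Rightarrow> complex) \<Rightarrow> bool" where
  "lin_on J L \<longleftrightarrow> (\<exists>r. \<forall>A. L A = (\<Sum>k\<in>J. r k * A k))"

definition quad_on :: "'k set \<Rightarrow> (('k \<Rightarrow> complex) \<Rightarrow> complex) \<Rightarrow> bool" where
  "quad_on J Q \<longleftrightarrow> (\<exists>q. \<forall>A. Q A = (\<Sum>k\<in>J. \<Sum>l\<in>J. q k l * (A k * A l)))"

lemma lin_on_zero: "lin_on J (\<lambda>_. 0)"
  unfolding lin_on_def by (rule exI[of _ "\<lambda>_. 0"]) simp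

lemma lin_on_coord: assumes "finite J" shows "lin_on J (\<lambda>A. if k \<in> J then A k else 0)"
  unfolding lin_on_def
proof (intro exI allI)
  fix A :: "'a \<Rightarrow> complex"
  show "(if k \<in> J then A k else 0) = (\<Sum>l\<in>J. unit_at k l * A l)"
    using assms by (simp add: unit_at_def if_distrib[of "\<lambda>x. x * _"] cong: if_cong)
qed

lemma lin_on_scale: "lin_on J L \<Longrightarrow> lin_on J (\<lambda>A. c * L A)"
  unfolding lin_on_def
proof (elim exE)
  fix r assume r: "\<forall>A. L A = (\<Sum>k\<in>J. r k * A k)"
  show "\<exists>r. \<forall>A. c * L A = (\<Sum>k\<in>J. r k * A k)"
    by (rule exI[of _ "\<lambda>k. c * r k"]) (simp add: r sum_distrib_left mult.assoc)
qed

lemma lin_on_add: "lin_on J L \<Longrightarrow> lin_on J M \<Longrightarrow> lin_on J (\<lambda>A. L A + M A)"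
  unfolding lin_on_def
proof (elim exE)
  fix r q assume r: "\<forall>A. L A = (\<Sum>k\<in>J. r k * A k)" "\<forall>A. M A = (\<Sum>k\<in>J. q k * A k)"
  show "\<exists>r. \<forall>A. L A + M A = (\<Sum>k\<in>J. r k * A k)"
    by (rule exI[of _ "\<lambda>k. r k + q k"]) (simp add: r sum.distrib distrib_right)
qed

lemma lin_on_diff: "lin_on J L \<Longrightarrow> lin_on J M \<Longrightarrow> lin_on J (\<lambda>A. L A - M A)"
  using lin_on_add[OF _ lin_on_scale[of J M "-1"], of L] by simp

lemma lin_on_sum: "(\<And>i. i \<in> I \<Longrightarrow> lin_on J (L i)) \<Longrightarrow> lin_on J (\<lambda>A. \<Sum>i\<in>I. L i A)"
  by (induction I rule: infinite_finite_induct) (simp_all add: lin_on_zero lin_on_add)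

lemma quad_on_mult: "lin_on J L \<Longrightarrow> lin_on J M \<Longrightarrow> quad_on J (\<lambda>A. L A * M A)"
  unfolding lin_on_def quad_on_def
proof (elim exE)
  fix r q assume r: "\<forall>A. L A = (\<Sum>k\<in>J. r k * A k)" "\<forall>A. M A = (\<Sum>k\<in>J. q k * A k)"
  show "\<exists>q. \<forall>A. L A * M A = (\<Sum>k\<in>J. \<Sum>l\<in>J. q k l * (A k * A l))"
    by (rule exI[of _ "\<lambda>k l. r k * q l"], simp only: r sum_product, intro allI sum.cong refl)
       (simp add: mult_ac)
qed

lemma quad_on_zero: "quad_on J (\<lambda>_. 0)"
  unfolding quad_on_def by (rule exI[of _ "\<lambda>_ _. 0"]) simp

lemma quad_on_add: "quad_on J L \<Longrightarrow> quad_on J M \<Longrightarrow> quad_on J (\<lambda>A. L A + M A)"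
  unfolding quad_on_def
proof (elim exE)
  fix r q assume r: "\<forall>A. L A = (\<Sum>k\<in>J. \<Sum>l\<in>J. r k l * (A k * A l))"
    "\<forall>A. M A = (\<Sum>k\<in>J. \<Sum>l\<in>J. q k l * (A k * A l))"
  show "\<exists>q. \<forall>A. L A + M A = (\<Sum>k\<in>J. \<Sum>l\<in>J. q k l * (A k * A l))"
    by (rule exI[of _ "\<lambda>k l. r k l + q k l"]) (simp add: r sum.distrib distrib_right)
qed

lemma quad_on_sum: "(\<And>i. i \<in> I \<Longrightarrow> quad_on J (L i)) \<Longrightarrow> quad_on J (\<lambda>A. \<Sum>i\<in>I. L i A)"
  by (induction I rule: infinite_finite_induct) (simp_all add: quad_on_zero quad_on_add)

text \<open>By c d = 1 the columns of \<open>c\<close> span, and a coefficient of \<open>L\<close>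
  is recovered by expanding a unit vector in these columns.\<close>

lemma lin_on_vanish:
  assumes L: "lin_on J L" and J: "finite J"
    and cd: "\<And>i j. i \<in> J \<Longrightarrow> j \<in> J \<Longrightarrow> (\<Sum>k\<in>J. c i k * d k j) = (if i = j then 1 else 0)"
    and v: "\<And>k. k \<in> J \<Longrightarrow> L (\<lambda>m. c m k) = 0"
  shows "L A = 0"
proof -
  obtain r where r: "\<And>A. L A = (\<Sum>k\<in>J. r k * A k)" using L unfolding lin_on_def by blast
  have "r j = 0" if j: "j \<in> J" for j
  proof -
    have "r j = (\<Sum>m\<in>J. r m * (if m = j then 1 else 0))"
      using J j by (simp add: if_distrib[of "\<lambda>x. _ * x"] cong: if_cong)
    also have "\<dots> = (\<Sum>m\<in>J. r m * (\<Sum>k\<in>J. c m k * d k j))" using cd j by (intro sum.cong) auto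
    also have "\<dots> = (\<Sum>k\<in>J. (\<Sum>m\<in>J. r m * c m k) * d k j)"
      by (simp add: sum_distrib_left sum_distrib_right mult.assoc) (rule sum.swap)
    also have "\<dots> = 0" using v r by simp
    finally show ?thesis .
  qed
  then show ?thesis by (simp add: r)
qed

text \<open>Vanishing on spanning vectors and their pairwise sums kills the symmetrised bilinear
  form on these vectors, hence everywhere; division by 2 returns to \<open>Q\<close>.\<close>

lemma quad_on_vanish:
  assumes Q: "quad_on J Q" and J: "finite J"
    and cd: "\<And>i j. i \<in> J \<Longrightarrow> j \<in> J \<Longrightarrow> (\<Sum>k\<in>J. c i k * d k j) = (if i = j then 1 else 0)"
    and v: "\<And>k. k \<in> J \<Longrightarrow> Q (\<lambda>m. c m k) = 0"
    and v2: "\<And>k l. k \<in> J \<Longrightarrow> l \<in> J \<Longrightarrow> Q (\<lambda>m. c m k + c m l) = 0"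
  shows "Q A = 0"
proof -
  obtain q where q: "\<And>A. Q A = (\<Sum>k\<in>J. \<Sum>l\<in>J. q k l * (A k * A l))" using Q unfolding quad_on_def by blast
  define B where "B X Y = (\<Sum>k\<in>J. \<Sum>l\<in>J. q k l * (X k * Y l))" for X Y
  have QB: "Q X = B X X" for X by (simp add: q B_def)
  have anti: "B (\<lambda>m. c m k) (\<lambda>m. c m l) + B (\<lambda>m. c m l) (\<lambda>m. c m k) = 0" if "k \<in> J" "l \<in> J" for k l
  proof -
    have "B (\<lambda>m. c m k + c m l) (\<lambda>m. c m k + c m l) =
       B (\<lambda>m. c m k) (\<lambda>m. c m k) + B (\<lambda>m. c m k) (\<lambda>m. c m l) + (B (\<lambda>m. c m l) (\<lambda>m. c m k) + B (\<lambda>m. c m l) (\<lambda>m. c m l))"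
      unfolding B_def by (simp add: algebra_simps sum.distrib)
    then show ?thesis using v[OF that(1)] v[OF that(2)] v2[OF that] unfolding QB by simp
  qed
  \<comment> \<open>Coefficients of \<open>A\<close> with respect to the columns of
    \<open>c\<close>.\<close>
  define a where "a k = (\<Sum>j\<in>J. d k j * A j)" for k
  have A: "A m = (\<Sum>k\<in>J. a k * c m k)" if m: "m \<in> J" for m
  proof -
    have "(\<Sum>k\<in>J. a k * c m k) = (\<Sum>j\<in>J. (\<Sum>k\<in>J. c m k * d k j) * A j)"
      unfolding a_def by (simp add: sum_distrib_left sum_distrib_right mult_ac) (rule sum.swap)
    also have "\<dots> = (\<Sum>j\<in>J. (if m = j then 1 else 0) * A j)" using cd m by (intro sum.cong) auto
    also have "\<dots> = A m" using J m by (simp add: if_distrib[of "\<lambda>x. x * _"] cong: if_cong)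
    finally show ?thesis by simp
  qed
  have expand: "B A A = (\<Sum>k\<in>J. \<Sum>l\<in>J. a k * a l * B (\<lambda>m. c m k) (\<lambda>m. c m l))"
  proof -
    have "B A A = (\<Sum>m\<in>J. \<Sum>p\<in>J. q m p * ((\<Sum>k\<in>J. a k * c m k) * (\<Sum>l\<in>J. a l * c p l)))"
      unfolding B_def using A by (intro sum.cong refl) auto
    also have "\<dots> = (\<Sum>m\<in>J. \<Sum>p\<in>J. \<Sum>k\<in>J. \<Sum>l\<in>J. a k * a l * (q m p * (c m k * c p l)))"
    proof (intro sum.cong refl)
      fix m p
      have "q m p * ((\<Sum>k\<in>J. a k * c m k) * (\<Sum>l\<in>J. a l * c p l)) = (\<Sum>k\<in>J. \<Sum>l\<in>J. q m p * (a k * c m k * (a l * c p l)))"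
        by (subst sum_product) (simp only: sum_distrib_left)
      then show "q m p * ((\<Sum>k\<in>J. a k * c m k) * (\<Sum>l\<in>J. a l * c p l)) = (\<Sum>k\<in>J. \<Sum>l\<in>J. a k * a l * (q m p * (c m k * c p l)))"
        by (simp add: mult_ac)
    qed
    also have "\<dots> = (\<Sum>m\<in>J. \<Sum>k\<in>J. \<Sum>p\<in>J. \<Sum>l\<in>J. a k * a l * (q m p * (c m k * c p l)))"
      by (rule sum.cong[OF refl], rule sum.swap)
    also have "\<dots> = (\<Sum>k\<in>J. \<Sum>m\<in>J. \<Sum>p\<in>J. \<Sum>l\<in>J. a k * a l * (q m p * (c m k * c p l)))"
      by (rule sum.swap)
    also have "\<dots> = (\<Sum>k\<in>J. \<Sum>m\<in>J. \<Sum>l\<in>J. \<Sum>p\<in>J. a k * a l * (q m p * (c m k * c p l)))"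
      by (rule sum.cong[OF refl], rule sum.cong[OF refl], rule sum.swap)
    also have "\<dots> = (\<Sum>k\<in>J. \<Sum>l\<in>J. \<Sum>m\<in>J. \<Sum>p\<in>J. a k * a l * (q m p * (c m k * c p l)))"
      by (rule sum.cong[OF refl], rule sum.swap)
    finally show ?thesis unfolding B_def by (simp add: sum_distrib_left)
  qed
  \<comment> \<open>Exchanging the summation indices pairs each term with its transpose, so that
    \<open>anti\<close> applies to the doubled sum.\<close>
  have "B A A = (\<Sum>k\<in>J. \<Sum>l\<in>J. a k * a l * B (\<lambda>m. c m l) (\<lambda>m. c m k))"
    unfolding expand by (subst sum.swap) (simp add: mult_ac)
  then have "B A A + B A A = (\<Sum>k\<in>J. \<Sum>l\<in>J. a k * a l * (B (\<lambda>m. c m k) (\<lambda>m. c m l) + B (\<lambda>m. c m l) (\<lambda>m. c m k)))"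
    using expand by (simp add: sum.distrib distrib_left)
  also have "\<dots> = 0" using anti by simp
  finally show ?thesis unfolding QB by simp
qed

text \<open>Another representative of the flag replaces \<open>y\<close> by a conjugate under a
  triangular matrix. This conjugate may leave \<open>H\<close>, but its lower left entry is only
  multiplied by two diagonal entries, so the vanishing survives.\<close>

lemma hess_corner_zero:
  assumes b: "b \<in> grp t n" and n: "n > 0" and x: "x \<in> carrier_mat n n" and q: "q \<in> grp t n" "q * b = 1\<^sub>m n"
    and H: "\<And>y. y \<in> H \<Longrightarrow> y \<in> carrier_mat n n \<and> y $$ (n-1,0) = 0"
    and u: "u \<in> grp t n" and mem: "coset t n (b * u) \<in> hess t n x H"
  shows "\<exists>Y\<in>carrier_mat n n. Y $$ (n-1,0) = 0 \<and> (q * x * b) * u = u * Y"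
proof -
  note c[simp] = grp_carrier[OF b] grp_carrier[OF q(1)] grp_carrier[OF u] x
  from mem obtain g y where g: "g \<in> grp t n" "coset t n (b * u) = coset t n g" and y: "y \<in> H" "x * g = g * y"
    unfolding hess_def by blast
  from coset_eqD[OF g] obtain \<beta> where be: "\<beta> \<in> borel GL n" "b * u * \<beta> = g" by blast
  obtain \<gamma> where ga: "\<gamma> \<in> borel GL n" "\<beta> * \<gamma> = 1\<^sub>m n" using borel_inverse[OF be(1)] by blast
  have bc: "\<beta> \<in> carrier_mat n n" "upper_triangular \<beta>" and gc: "\<gamma> \<in> carrier_mat n n" "upper_triangular \<gamma>"
    using be ga by (auto simp: borel_GL_iff)
  have yc: "y \<in> carrier_mat n n" "y $$ (n-1,0) = 0" using H[OF y(1)] by auto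
  note [simp] = bc(1) gc(1) yc(1)
  note asc = assoc_mult_mat[of _ n n _ n _ n] and mc = mult_carrier_mat[of _ n n]
  let ?Y = "\<beta> * y * \<gamma>"
  have "x * (b * u) = x * (b * u * \<beta>) * \<gamma>" using ga
    by (simp add: asc mc right_mult_one_mat[of _ n n])
  also have "\<dots> = b * (u * ?Y)" unfolding be(2) y(2) unfolding be(2)[symmetric] by (simp add: asc mc)
  finally have "q * (x * (b * u)) = q * (b * (u * ?Y))" by simp
  then have "(q * x * b) * u = u * ?Y"
    using left_inverse_cancel[OF c(2) c(1) _ q(2), of "u * ?Y"] by (simp add: asc mc)
  moreover have "?Y $$ (n-1,0) = 0"
  proof -
    have 1: "(\<beta> * y) $$ (n-1,0) = 0"
    proof -
      have "(\<beta> * y) $$ (n-1,0) = (\<Sum>k<n. \<beta> $$ (n-1,k) * y $$ (k,0))" using n by (intro mult_index) auto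
      also have "\<dots> = 0"
      proof (rule sum.neutral, rule ballI)
        fix k assume "k \<in> {..<n}"
        then show "\<beta> $$ (n-1,k) * y $$ (k,0) = 0"
          using upper_triangularD[OF bc(2), of k "n-1"] n yc bc(1) by (cases "k = n-1") auto
      qed
      finally show ?thesis .
    qed
    have "?Y $$ (n-1,0) = (\<Sum>k<n. (\<beta> * y) $$ (n-1,k) * \<gamma> $$ (k,0))" using n by (intro mult_index) (auto simp: mc)
    also have "\<dots> = 0"
    proof (rule sum.neutral, rule ballI)
      fix k assume "k \<in> {..<n}"
      then show "(\<beta> * y) $$ (n-1,k) * \<gamma> $$ (k,0) = 0"
        using upper_triangularD[OF gc(2), of 0 k] n 1 gc(1) by (cases "k = 0") auto
    qed
    finally show ?thesis .
  qed
  ultimately show ?thesis by (intro bexI[of _ ?Y]) (auto simp: mc)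
qed

section \<open>Expansion of the corner equation along a curve\<close>

definition low_ext :: "nat \<Rightarrow> (nat \<times> nat \<Rightarrow> complex) \<Rightarrow> nat \<Rightarrow> nat \<Rightarrow> complex" where
  "low_ext n A i j = (if (i,j) \<in> low_idx n then A (i,j) else 0)"

lemma low_mat_deriv:
  assumes "tangent_curve n y A" "i < n" "j < n"
  shows "((\<lambda>s. low_mat n (\<lambda>k. y k s) $$ (i,j)) has_field_derivative low_ext n A i j) (at 0)"
proof (cases "(i,j) \<in> low_idx n")
  case True
  then have "(\<lambda>s. low_mat n (\<lambda>k. y k s) $$ (i,j)) = y (i,j)"
    by (auto simp: low_idx_def low_mat_index)
  then show ?thesis using tangent_curve_deriv[OF assms(1), of "(i,j)"] True by (simp add: low_ext_def)
next
  case False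
  then have "(\<lambda>s. low_mat n (\<lambda>k. y k s) $$ (i,j)) = (\<lambda>_. if i = j then 1 else 0)"
    using assms by (auto simp: low_idx_def low_mat_index)
  then show ?thesis using False by (simp add: low_ext_def)
qed

lemma low_mat_zero_index:
  assumes "tangent_curve n y A" "i < n" "j < n"
  shows "low_mat n (\<lambda>k. y k 0) $$ (i,j) = (if i = j then 1 else 0)"
  using assms tangent_curve_zero[OF assms(1)] by (auto simp: low_mat_index)

text \<open>Second-order information from first derivatives: both factors vanish at 0, so after
  division by \<open>s * s\<close> every summand is a product of two difference quotients and the
  limit is taken termwise.\<close>

lemma deriv_products_vanish:
  fixes p q :: "nat \<Rightarrow> complex \<Rightarrow> complex"
  assumes "\<And>k. k < m \<Longrightarrow> p k 0 = 0" "\<And>k. k < m \<Longrightarrow> q k 0 = 0"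
    and "\<And>k. k < m \<Longrightarrow> (p k has_field_derivative p' k) (at 0)"
    and "\<And>k. k < m \<Longrightarrow> (q k has_field_derivative q' k) (at 0)"
    and ev: "eventually (\<lambda>s. (\<Sum>k<m. p k s * q k s) = 0) (nhds 0)"
  shows "(\<Sum>k<m. p' k * q' k) = 0"
proof -
  have "((\<lambda>s. \<Sum>k<m. (p k s / s) * (q k s / s)) \<longlongrightarrow> (\<Sum>k<m. p' k * q' k)) (at 0)"
  proof (intro tendsto_sum tendsto_mult)
    fix k assume "k \<in> {..<m}"
    then have k: "k < m" by simp
    show "((\<lambda>s. p k s / s) \<longlongrightarrow> p' k) (at 0)" "((\<lambda>s. q k s / s) \<longlongrightarrow> q' k) (at 0)"
      using assms(3,4)[OF k] assms(1,2)[OF k] by (auto simp: DERIV_def)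
  qed
  moreover have "eventually (\<lambda>s. (\<Sum>k<m. (p k s / s) * (q k s / s)) = 0) (at 0)"
    using eventually_nhds_conv_at[THEN iffD1, OF ev, THEN conjunct1]
  proof eventually_elim
    case (elim s)
    have "(\<Sum>k<m. (p k s / s) * (q k s / s)) = (\<Sum>k<m. p k s * q k s) / (s * s)"
      by (simp add: sum_divide_distrib)
    with elim show ?case by simp
  qed
  then have "((\<lambda>s. \<Sum>k<m. (p k s / s) * (q k s / s)) \<longlongrightarrow> 0) (at 0)"
    by (rule tendsto_eventually)
  ultimately show ?thesis by (rule tendsto_unique[OF at_neq_bot])
qed

text \<open>Along a curve of matrices U with U(0) = 1 and U'(0) = A for which the first column of
  Y = inverse U * X * U keeps a vanishing last entry, Y' = [X, A] gives the linear condition; if moreover the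
  linear condition is void because X agrees with e in its first column and last row, the next order term
  of the Taylor expansion is already determined by A.\<close>
lemma corner_conditions:
  assumes n: "n \<ge> 2" and y: "tangent_curve n y A" and X: "X \<in> carrier_mat n n"
    and ev: "eventually (\<lambda>s. \<exists>Y\<in>carrier_mat n n. Y $$ (n-1,0) = 0 \<and>
        X * low_mat n (\<lambda>k. y k s) = low_mat n (\<lambda>k. y k s) * Y) (nhds 0)"
  shows corner_value: "X $$ (n-1,0) = 0"
    and corner_linear: "(\<Sum>l<n. X $$ (n-1,l) * low_ext n A l 0) - (\<Sum>k<n-1. low_ext n A (n-1) k * X $$ (k,0)) = 0"
    and corner_quadratic: "(\<And>k. k < n \<Longrightarrow> X $$ (k,0) = (if k = 0 then e else 0)) \<Longrightarrow>
      (\<And>k. k < n \<Longrightarrow> X $$ (n-1,k) = (if k = n-1 then e else 0)) \<Longrightarrow>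
      (\<Sum>k<n-1. low_ext n A (n-1) k * ((\<Sum>l<n. X $$ (k,l) * low_ext n A l 0) - e * low_ext n A k 0)) = 0"
proof -
  let ?U = "\<lambda>s. low_mat n (\<lambda>k. y k s)"
  define Y where "Y s = (SOME Y. Y \<in> carrier_mat n n \<and> Y $$ (n-1,0) = 0 \<and> X * ?U s = ?U s * Y)" for s
  have evY: "eventually (\<lambda>s. Y s \<in> carrier_mat n n \<and> Y s $$ (n-1,0) = 0 \<and> X * ?U s = ?U s * Y s) (nhds 0)"
    using ev
  proof eventually_elim
    case (elim s)
    then have "\<exists>Y. Y \<in> carrier_mat n n \<and> Y $$ (n-1,0) = 0 \<and> X * ?U s = ?U s * Y" by blast
    then show ?case unfolding Y_def by (rule someI_ex)
  qed
  \<comment> \<open>First column of \<open>Y s\<close>. Since \<open>?U s\<close> is lower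
    unitriangular, comparing first columns determines these entries recursively from the curve; so
    they are differentiable although \<open>Y s\<close> was merely chosen.\<close>
  define \<eta> where "\<eta> r s = Y s $$ (r,0)" for r s
  have row: "eventually (\<lambda>s. (\<Sum>l<n. X $$ (r,l) * ?U s $$ (l,0)) = \<eta> r s + (\<Sum>k<r. ?U s $$ (r,k) * \<eta> k s)) (nhds 0)"
    if r: "r < n" for r
    using evY
  proof eventually_elim
    case (elim s)
    have "(\<Sum>l<n. X $$ (r,l) * ?U s $$ (l,0)) = (X * ?U s) $$ (r,0)"
      using r by (intro mult_index[symmetric] X) auto
    also have "\<dots> = (?U s * Y s) $$ (r,0)" using elim by simp
    also have "\<dots> = (\<Sum>k<n. ?U s $$ (r,k) * \<eta> k s)" unfolding \<eta>_def
      using r elim by (intro mult_index) auto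
    also have "\<dots> = (\<Sum>k<Suc r. ?U s $$ (r,k) * \<eta> k s)"
      using r by (intro sum_lessThan_trunc) (auto simp: low_mat_index)
    also have "\<dots> = \<eta> r s + (\<Sum>k<r. ?U s $$ (r,k) * \<eta> k s)" using r by (simp add: low_mat_index)
    finally show ?case .
  qed
  have row0: "\<eta> r 0 = X $$ (r,0)" if r: "r < n" for r
  proof -
    have "(\<Sum>l<n. X $$ (r,l) * ?U 0 $$ (l,0)) = (\<Sum>l<n. if l = 0 then X $$ (r,0) else 0)"
      using n low_mat_zero_index[OF y] by (intro sum.cong) auto
    also have "\<dots> = X $$ (r,0)" using n by simp
    finally have "(\<Sum>l<n. X $$ (r,l) * ?U 0 $$ (l,0)) = X $$ (r,0)" .
    moreover have "(\<Sum>k<r. ?U 0 $$ (r,k) * \<eta> k 0) = 0"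
      using r low_mat_zero_index[OF y] by (intro sum.neutral) auto
    ultimately show ?thesis using eventually_nhds_x_imp_x[OF row[OF r]] by simp
  qed
  \<comment> \<open>First column of the commutator X A - A X; the second sum stops at
    \<open>r\<close> because A is strictly lower triangular.\<close>
  define D where "D r = (\<Sum>l<n. X $$ (r,l) * low_ext n A l 0) - (\<Sum>k<r. low_ext n A r k * X $$ (k,0))" for r
  have der: "(\<eta> r has_field_derivative D r) (at 0)" if "r < n" for r
    using that
  proof (induction r rule: less_induct)
    case (less r)
    have "((\<lambda>s. (\<Sum>l<n. X $$ (r,l) * ?U s $$ (l,0)) - (\<Sum>k<r. ?U s $$ (r,k) * \<eta> k s)) has_field_derivative
       (\<Sum>l<n. X $$ (r,l) * low_ext n A l 0) -
       (\<Sum>k<r. low_ext n A r k * \<eta> k 0 + D k * ?U 0 $$ (r,k))) (at 0)"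
      using less n
      by (intro DERIV_diff DERIV_sum DERIV_cmult DERIV_mult low_mat_deriv[OF y]) auto
    also have "(\<Sum>k<r. low_ext n A r k * \<eta> k 0 + D k * ?U 0 $$ (r,k)) = (\<Sum>k<r. low_ext n A r k * X $$ (k,0))"
      using less.prems row0 low_mat_zero_index[OF y] by (intro sum.cong) auto
    finally have d: "((\<lambda>s. (\<Sum>l<n. X $$ (r,l) * ?U s $$ (l,0)) - (\<Sum>k<r. ?U s $$ (r,k) * \<eta> k s)) has_field_derivative D r) (at 0)"
      by (simp add: D_def)
    have "eventually (\<lambda>s. \<eta> r s = (\<Sum>l<n. X $$ (r,l) * ?U s $$ (l,0)) - (\<Sum>k<r. ?U s $$ (r,k) * \<eta> k s)) (nhds 0)"
      using row[OF less.prems] by eventually_elim simp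
    from DERIV_cong_ev[OF refl this refl] d show ?case by simp
  qed
  have last: "eventually (\<lambda>s. \<eta> (n-1) s = 0) (nhds 0)"
    using evY by eventually_elim (simp add: \<eta>_def)
  show "X $$ (n-1,0) = 0" using eventually_nhds_x_imp_x[OF last] row0[of "n-1"] n by simp
  have "((\<lambda>_. 0) has_field_derivative D (n-1)) (at 0)"
    using der[of "n-1"] n DERIV_cong_ev[OF refl last refl, of "D (n-1)"] by simp
  then have "D (n-1) = 0" using DERIV_const DERIV_unique by blast
  then show "(\<Sum>l<n. X $$ (n-1,l) * low_ext n A l 0) - (\<Sum>k<n-1. low_ext n A (n-1) k * X $$ (k,0)) = 0"
    by (simp add: D_def)
  assume col: "\<And>k. k < n \<Longrightarrow> X $$ (k,0) = (if k = 0 then e else 0)"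
    and lrow: "\<And>k. k < n \<Longrightarrow> X $$ (n-1,k) = (if k = n-1 then e else 0)"
  \<comment> \<open>The first column of \<open>X\<close> is \<open>e\<close> times a unit vector, so
    this correction in row 0 makes every entry vanish at 0.\<close>
  let ?\<theta> = "\<lambda>k s. \<eta> k s - (if k = 0 then e else 0)"
  have "(\<Sum>k<n-1. low_ext n A (n-1) k * D k) = 0"
  proof (rule deriv_products_vanish[where p = "\<lambda>k s. ?U s $$ (n-1,k)" and q = ?\<theta>])
    fix k assume k: "k < n - 1"
    show "?U 0 $$ (n-1,k) = 0" using k low_mat_zero_index[OF y, of "n-1" k] by simp
    show "?\<theta> k 0 = 0" using row0[of k] col[of k] k by simp
    show "((\<lambda>s. ?U s $$ (n-1,k)) has_field_derivative low_ext n A (n-1) k) (at 0)"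
      using k by (intro low_mat_deriv[OF y]) auto
    show "(?\<theta> k has_field_derivative D k) (at 0)"
      using DERIV_diff[OF der DERIV_const[of "if k = 0 then e else 0"]] k by simp
  next
    show "eventually (\<lambda>s. (\<Sum>k<n-1. ?U s $$ (n-1,k) * ?\<theta> k s) = 0) (nhds 0)"
    proof -
      \<comment> \<open>Bottom row of X U = U Y in column 0: the left side is e U(n-1,0) by
        \<open>lrow\<close>, and the last entry of the column of Y is 0. The term \<open>e\<close>
        in row 0 of the correction absorbs the left side.\<close>
      have "n - 1 < n" using n by simp
      from row[OF this] last show ?thesis
      proof eventually_elim
        case (elim s)
        have "(\<Sum>l<n. X $$ (n-1,l) * ?U s $$ (l,0)) = (\<Sum>l<n. if l = n-1 then e * ?U s $$ (n-1,0) else 0)"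
          using lrow by (intro sum.cong) auto
        also have "\<dots> = e * ?U s $$ (n-1,0)" using n by simp
        finally have 1: "(\<Sum>k<n-1. ?U s $$ (n-1,k) * \<eta> k s) = e * ?U s $$ (n-1,0)" using elim by simp
        have "(\<Sum>k<n-1. ?U s $$ (n-1,k) * (if k = 0 then e else 0)) = (\<Sum>k<n-1. if k = 0 then e * ?U s $$ (n-1,0) else 0)"
          by (intro sum.cong) auto
        also have "\<dots> = e * ?U s $$ (n-1,0)" using n by simp
        finally have 2: "(\<Sum>k<n-1. ?U s $$ (n-1,k) * (if k = 0 then e else 0)) = e * ?U s $$ (n-1,0)" .
        show ?case using 1 2 by (simp only: right_diff_distrib sum_subtractf diff_self)
      qed
    qed
  qed
  moreover have "D k = (\<Sum>l<n. X $$ (k,l) * low_ext n A l 0) - e * low_ext n A k 0" if k: "k < n - 1" for k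
  proof -
    have "(\<Sum>j<k. low_ext n A k j * X $$ (j,0)) = (\<Sum>j<k. if j = 0 then e * low_ext n A k 0 else 0)"
      using col k by (intro sum.cong) auto
    also have "\<dots> = e * low_ext n A k 0" by (cases k) (auto simp: low_ext_def low_idx_def)
    finally show ?thesis by (simp add: D_def)
  qed
  ultimately show "(\<Sum>k<n-1. low_ext n A (n-1) k * ((\<Sum>l<n. X $$ (k,l) * low_ext n A l 0) - e * low_ext n A k 0)) = 0"
    by simp
qed

lemma lin_on_low_ext: "lin_on (low_idx n) (\<lambda>A. low_ext n A i j)"
  unfolding low_ext_def by (rule lin_on_coord[OF finite_low_idx])

lemma sum_delta_mult:
  fixes f :: "nat \<Rightarrow> complex"
  shows "i < n \<Longrightarrow> (\<Sum>k<n. (if k = i then 1 else 0) * f k) = f i"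
    "i < n \<Longrightarrow> (\<Sum>k<n. f k * (if k = i then 1 else 0)) = f i"
  by (simp_all add: if_distrib[of "\<lambda>x. x * _"] if_distrib[of "\<lambda>x. _ * x"] cong: if_cong)

text \<open>Evaluation on matrix units: position (l,0) isolates an entry of the last row of
  \<open>X\<close>, position (n-1,k) one of the first column, and the shared position (n-1,0) the
  difference of the two diagonal entries.\<close>

lemma linear_form_zero:
  assumes n: "n \<ge> 2"
    and L: "\<And>A. (\<Sum>l<n. X $$ (n-1,l) * low_ext n A l 0) - (\<Sum>k<n-1. low_ext n A (n-1) k * X $$ (k,0)) = (0::complex)"
  shows "0 < l \<Longrightarrow> l < n-1 \<Longrightarrow> X $$ (n-1,l) = 0" "0 < k \<Longrightarrow> k < n-1 \<Longrightarrow> X $$ (k,0) = 0"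
    "X $$ (n-1,n-1) = X $$ (0,0)"
proof -
  show "X $$ (n-1,l) = 0" if l: "0 < l" "l < n-1"
  proof -
    let ?A = "unit_at (l,0)"
    have "(\<Sum>l'<n. X $$ (n-1,l') * low_ext n ?A l' 0) = (\<Sum>l'<n. X $$ (n-1,l') * (if l' = l then 1 else 0))"
      using l by (intro sum.cong) (auto simp: low_ext_def unit_at_def low_idx_def)
    also have "\<dots> = X $$ (n-1,l)" using l by (intro sum_delta_mult) auto
    finally have 1: "(\<Sum>l'<n. X $$ (n-1,l') * low_ext n ?A l' 0) = X $$ (n-1,l)" .
    have 2: "(\<Sum>k<n-1. low_ext n ?A (n-1) k * X $$ (k,0)) = 0"
      using l by (intro sum.neutral) (auto simp: low_ext_def unit_at_def)
    show ?thesis using L[of ?A] 1 2 by simp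
  qed
  show "X $$ (k,0) = 0" if k: "0 < k" "k < n-1"
  proof -
    let ?A = "unit_at (n-1,k)"
    have 1: "(\<Sum>l'<n. X $$ (n-1,l') * low_ext n ?A l' 0) = 0"
      using k by (intro sum.neutral) (auto simp: low_ext_def unit_at_def)
    have "(\<Sum>k'<n-1. low_ext n ?A (n-1) k' * X $$ (k',0)) = (\<Sum>k'<n-1. (if k' = k then 1 else 0) * X $$ (k',0))"
      using k by (intro sum.cong) (auto simp: low_ext_def unit_at_def low_idx_def)
    also have "\<dots> = X $$ (k,0)" using k by (intro sum_delta_mult) auto
    finally show ?thesis using L[of ?A] 1 by simp
  qed
  show "X $$ (n-1,n-1) = X $$ (0,0)"
  proof -
    let ?A = "unit_at (n-1,0)"
    have "(\<Sum>l'<n. X $$ (n-1,l') * low_ext n ?A l' 0) = (\<Sum>l'<n. X $$ (n-1,l') * (if l' = n-1 then 1 else 0))"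
      using n by (intro sum.cong) (auto simp: low_ext_def unit_at_def low_idx_def)
    also have "\<dots> = X $$ (n-1,n-1)" using n by (intro sum_delta_mult) auto
    finally have 1: "(\<Sum>l'<n. X $$ (n-1,l') * low_ext n ?A l' 0) = X $$ (n-1,n-1)" .
    have "(\<Sum>k'<n-1. low_ext n ?A (n-1) k' * X $$ (k',0)) = (\<Sum>k'<n-1. (if k' = 0 then 1 else 0) * X $$ (k',0))"
      using n by (intro sum.cong) (auto simp: low_ext_def unit_at_def low_idx_def)
    also have "\<dots> = X $$ (0,0)" using n by (intro sum_delta_mult) auto
    finally show ?thesis using L[of ?A] 1 by simp
  qed
qed

text \<open>The form pairs the last row of A with the first column of A through X - e. One entry in
  each isolates X(k,l), except that position (n-1,0) lies in both; the cases k = 0 and l = n-1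
  therefore carry an additional term X(0,n-1), which is shown to vanish beforehand.\<close>

lemma quadratic_form_zero:
  assumes n: "n \<ge> 2"
    and Q: "\<And>A. (\<Sum>k<n-1. low_ext n A (n-1) k * ((\<Sum>l<n. X $$ (k,l) * low_ext n A l 0) - e * low_ext n A k 0)) = (0::complex)"
    and kl: "k < n-1" "0 < l" "l < n"
  shows "X $$ (k,l) = (if k = l then e else 0)"
proof -
  have main: "(\<Sum>k<n-1. p k * ((\<Sum>l<n. X $$ (k,l) * q l) - e * q k)) = 0"
    if "\<And>k. k < n-1 \<Longrightarrow> low_ext n A (n-1) k = p k" "\<And>l. l < n \<Longrightarrow> low_ext n A l 0 = q l" for A p q
  proof -
    have "(\<Sum>k<n-1. p k * ((\<Sum>l<n. X $$ (k,l) * q l) - e * q k)) =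
      (\<Sum>k<n-1. low_ext n A (n-1) k * ((\<Sum>l<n. X $$ (k,l) * low_ext n A l 0) - e * low_ext n A k 0))"
      using that by (intro sum.cong refl arg_cong2[where f = "(*)"] arg_cong2[where f = "(-)"]) auto
    then show ?thesis using Q by simp
  qed
  let ?d = "\<lambda>i j. if j = i then 1 else (0::complex)"
  have delta: "(\<Sum>k<n-1. ?d i k * ((\<Sum>l<n. X $$ (k,l) * ?d j l) - e * ?d j k)) = X $$ (i,j) - e * ?d j i"
    if "i < n-1" "j < n" for i j
    using that by (simp only: sum_delta_mult)
  \<comment> \<open>The single matrix unit at (n-1,0) supplies both factors of the form.\<close>
  have corner: "X $$ (0,n-1) = 0"
  proof -
    have "(\<Sum>k<n-1. ?d 0 k * ((\<Sum>l<n. X $$ (k,l) * ?d (n-1) l) - e * ?d (n-1) k)) = 0"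
      using n by (intro main[of "unit_at (n-1,0)"]) (auto simp: low_ext_def unit_at_def low_idx_def)
    then show ?thesis using delta[of 0 "n-1"] n by simp
  qed
  consider "0 < k" "l < n-1" | "0 < k" "l = n-1" | "k = 0" "l < n-1" | "k = 0" "l = n-1"
    using kl by linarith
  then show ?thesis
  proof cases
    case 1
    have "(\<Sum>k'<n-1. ?d k k' * ((\<Sum>l'<n. X $$ (k',l') * ?d l l') - e * ?d l k')) = 0"
      using 1 kl by (intro main[of "\<lambda>m. if m = (n-1,k) \<or> m = (l,0) then 1 else 0"])
        (auto simp: low_ext_def low_idx_def)
    then show ?thesis using delta[of k l] kl by (auto split: if_splits)
  next
    case 2
    have "(\<Sum>k'<n-1. (?d k k' + ?d 0 k') * ((\<Sum>l'<n. X $$ (k',l') * ?d l l') - e * ?d l k')) = 0"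
      using 2 kl by (intro main[of "\<lambda>m. if m = (n-1,k) \<or> m = (n-1,0) then 1 else 0"])
        (auto simp: low_ext_def low_idx_def)
    then show ?thesis using delta[of k l] delta[of 0 l] kl 2 corner
      by (simp add: distrib_right sum.distrib)
  next
    case 3
    have "(\<Sum>k'<n-1. ?d 0 k' * ((\<Sum>l'<n. X $$ (k',l') * (?d l l' + ?d (n-1) l')) - e * (?d l k' + ?d (n-1) k'))) = 0"
      using 3 kl by (intro main[of "\<lambda>m. if m = (n-1,0) \<or> m = (l,0) then 1 else 0"])
        (auto simp: low_ext_def low_idx_def)
    moreover have "?d 0 k' * ((\<Sum>l'<n. X $$ (k',l') * (?d l l' + ?d (n-1) l')) - e * (?d l k' + ?d (n-1) k'))
       = ?d 0 k' * ((\<Sum>l'<n. X $$ (k',l') * ?d l l') - e * ?d l k') +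
         ?d 0 k' * ((\<Sum>l'<n. X $$ (k',l') * ?d (n-1) l') - e * ?d (n-1) k')" for k'
      by (simp only: distrib_left sum.distrib) (simp add: algebra_simps)
    ultimately show ?thesis using delta[of 0 l] delta[of 0 "n-1"] kl 3 corner
      by (simp only: sum.distrib) simp
  next
    case 4 then show ?thesis using corner kl by simp
  qed
qed

text \<open>The value, the linear part and the quadratic part of the corner equation vanish in turn.
  The linear part gives the shape of the first column and last row of the conjugate \<open>X\<close>
  that the quadratic part presupposes; together they make \<open>X\<close>, hence \<open>x\<close>,
  scalar.\<close>

lemma hess_curves_imp_scalar:
  assumes n: "n \<ge> 2" and b: "b \<in> grp t n" and x: "x \<in> carrier_mat n n"
    and H: "\<And>y. y \<in> H \<Longrightarrow> y \<in> carrier_mat n n \<and> y $$ (n-1,0) = 0"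
    and cd: "\<And>i j. i \<in> low_idx n \<Longrightarrow> j \<in> low_idx n \<Longrightarrow> (\<Sum>k\<in>low_idx n. c i k * d k j) = (if i = j then 1 else 0)"
    and cur: "\<And>k. k \<in> low_idx n \<Longrightarrow> \<exists>y. curve_in t n (hess t n x H) b (\<lambda>m. c m k) y"
    and cur2: "\<And>k l. k \<in> low_idx n \<Longrightarrow> l \<in> low_idx n \<Longrightarrow> \<exists>y. curve_in t n (hess t n x H) b (\<lambda>m. c m k + c m l) y"
  shows "\<exists>e. x = e \<cdot>\<^sub>m 1\<^sub>m n"
proof -
  let ?J = "low_idx n"
  note bc = grp_carrier[OF b]
  obtain q where q: "q \<in> grp t n" "b * q = 1\<^sub>m n" "q * b = 1\<^sub>m n" using grp_inverse[OF b] by blast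
  note qc = grp_carrier[OF q(1)]
  define X where "X = q * x * b"
  have Xc: "X \<in> carrier_mat n n" unfolding X_def using qc x bc by (meson mult_carrier_mat)
  have ev: "eventually (\<lambda>s. \<exists>Y\<in>carrier_mat n n. Y $$ (n-1,0) = 0 \<and>
        X * low_mat n (\<lambda>k. y k s) = low_mat n (\<lambda>k. y k s) * Y) (nhds 0)" and tc: "tangent_curve n y A"
    if "curve_in t n (hess t n x H) b A y" for y A
  proof -
    show "tangent_curve n y A" using that by (simp add: curve_in_def)
    have "eventually (\<lambda>s. coset t n (b * low_mat n (\<lambda>k. y k s)) \<in> hess t n x H) (nhds 0)"
      using that by (simp add: curve_in_def)
    then show "eventually (\<lambda>s. \<exists>Y\<in>carrier_mat n n. Y $$ (n-1,0) = 0 \<and>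
        X * low_mat n (\<lambda>k. y k s) = low_mat n (\<lambda>k. y k s) * Y) (nhds 0)"
    proof eventually_elim
      case (elim s)
      show ?case unfolding X_def
        by (rule hess_corner_zero[OF b _ x q(1,3) H low_mat_grp elim]) (use n in auto)
    qed
  qed
  have n1: "(n-1,0) \<in> ?J" using n by (auto simp: low_idx_def)
  have corner: "X $$ (n-1,0) = 0"
    using cur[OF n1] corner_value[OF n tc Xc ev] by blast
  have L: "(\<Sum>l<n. X $$ (n-1,l) * low_ext n A l 0) - (\<Sum>k<n-1. low_ext n A (n-1) k * X $$ (k,0)) = 0" for A
  proof (rule lin_on_vanish[where J = ?J and c = c and d = d and L = "\<lambda>A. (\<Sum>l<n. X $$ (n-1,l) * low_ext n A l 0) - (\<Sum>k<n-1. low_ext n A (n-1) k * X $$ (k,0))"])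
    show "lin_on ?J (\<lambda>A. (\<Sum>l<n. X $$ (n-1,l) * low_ext n A l 0) - (\<Sum>k<n-1. low_ext n A (n-1) k * X $$ (k,0)))"
    proof (intro lin_on_diff lin_on_sum lin_on_scale lin_on_low_ext)
      show "lin_on ?J (\<lambda>A. low_ext n A (n-1) k * X $$ (k,0))" for k
        using lin_on_scale[OF lin_on_low_ext, of n "X $$ (k,0)"] by (simp add: mult.commute)
    qed
  next
    fix k assume "k \<in> ?J"
    from cur[OF this] corner_linear[OF n tc Xc ev]
    show "(\<Sum>l<n. X $$ (n-1,l) * low_ext n (\<lambda>m. c m k) l 0) - (\<Sum>k'<n-1. low_ext n (\<lambda>m. c m k) (n-1) k' * X $$ (k',0)) = 0"
      by blast
  qed (use finite_low_idx cd in auto)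
  define e where "e = X $$ (0,0)"
  note Lz = linear_form_zero[OF n L]
  have col: "X $$ (k,0) = (if k = 0 then e else 0)" if "k < n" for k
    using Lz(2)[of k] corner that n by (cases "k = n - 1") (auto simp: e_def)
  have lrow: "X $$ (n-1,k) = (if k = n-1 then e else 0)" if "k < n" for k
    using Lz(1)[of k] Lz(3) corner that n by (cases "k = n - 1"; cases "k = 0") (auto simp: e_def)
  have Q: "(\<Sum>k<n-1. low_ext n A (n-1) k * ((\<Sum>l<n. X $$ (k,l) * low_ext n A l 0) - e * low_ext n A k 0)) = 0" for A
  proof (rule quad_on_vanish[where J = ?J and c = c and d = d and Q = "\<lambda>A. (\<Sum>k<n-1. low_ext n A (n-1) k * ((\<Sum>l<n. X $$ (k,l) * low_ext n A l 0) - e * low_ext n A k 0))"])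
    show "quad_on ?J (\<lambda>A. (\<Sum>k<n-1. low_ext n A (n-1) k * ((\<Sum>l<n. X $$ (k,l) * low_ext n A l 0) - e * low_ext n A k 0)))"
      by (intro quad_on_sum quad_on_mult lin_on_diff lin_on_sum lin_on_scale lin_on_low_ext)
  next
    fix k assume "k \<in> ?J"
    from cur[OF this] corner_quadratic[OF n tc Xc ev col lrow]
    show "(\<Sum>k'<n-1. low_ext n (\<lambda>m. c m k) (n-1) k' * ((\<Sum>l<n. X $$ (k',l) * low_ext n (\<lambda>m. c m k) l 0) - e * low_ext n (\<lambda>m. c m k) k' 0)) = 0"
      by blast
  next
    fix k l assume "k \<in> ?J" "l \<in> ?J"
    from cur2[OF this] corner_quadratic[OF n tc Xc ev col lrow]
    show "(\<Sum>k'<n-1. low_ext n (\<lambda>m. c m k + c m l) (n-1) k' * ((\<Sum>l'<n. X $$ (k',l') * low_ext n (\<lambda>m. c m k + c m l) l' 0) - e * low_ext n (\<lambda>m. c m k + c m l) k' 0)) = 0"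
      by blast
  qed (use finite_low_idx cd in auto)
  have Xe: "X = e \<cdot>\<^sub>m 1\<^sub>m n"
  proof (rule eq_matI)
    fix k l assume "k < dim_row (e \<cdot>\<^sub>m 1\<^sub>m n)" "l < dim_col (e \<cdot>\<^sub>m 1\<^sub>m n)"
    then have kl: "k < n" "l < n" by auto
    consider "l = 0" | "k = n - 1" | "k < n-1" "0 < l" using kl by linarith
    then show "X $$ (k,l) = (e \<cdot>\<^sub>m 1\<^sub>m n) $$ (k,l)"
      using col[of k] lrow[of l] quadratic_form_zero[OF n Q, of k l] kl by cases auto
  qed (use Xc in auto)
  have "x = b * X * q"
  proof -
    have "b * X = x * b" unfolding X_def using left_inverse_cancel[OF bc qc mult_carrier_mat[OF x bc] q(2)]
        assoc_mult_mat[OF qc x bc] by simp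
    then show ?thesis using assoc_mult_mat[OF x bc qc] q(2) x by simp
  qed
  also have "\<dots> = e \<cdot>\<^sub>m 1\<^sub>m n" unfolding Xe
    using bc qc q(2) mult_smult_distrib[OF bc one_carrier_mat] mult_smult_assoc_mat[OF bc qc]
    by (simp add: right_mult_one_mat[OF bc])
  finally show ?thesis by blast
qed

section \<open>Subspaces stable under the Borel subalgebra\<close>

definition mat_unit :: "nat \<Rightarrow> nat \<Rightarrow> nat \<Rightarrow> complex mat" where
  "mat_unit n a b = mat n n (\<lambda>(i,j). if i = a \<and> j = b then 1 else 0)"

lemma mat_unit_carrier [simp]: "mat_unit n a b \<in> carrier_mat n n"
  "dim_row (mat_unit n a b) = n" "dim_col (mat_unit n a b) = n"
  by (auto simp: mat_unit_def)

lemma mat_unit_mult: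
  assumes "a < n" "b < n" "c < n" "d < n"
  shows "mat_unit n a b * mat_unit n c d = (if b = c then mat_unit n a d else 0\<^sub>m n n)"
proof (rule eq_matI)
  fix i j assume "i < dim_row (if b = c then mat_unit n a d else 0\<^sub>m n n)"
    "j < dim_col (if b = c then mat_unit n a d else 0\<^sub>m n n)"
  then have ij: "i < n" "j < n" by (auto split: if_splits)
  have "(mat_unit n a b * mat_unit n c d) $$ (i,j) = (\<Sum>k<n. mat_unit n a b $$ (i,k) * mat_unit n c d $$ (k,j))"
    using ij by (intro mult_index) auto
  also have "\<dots> = (\<Sum>k<n. if k = b then (if i = a \<and> b = c \<and> j = d then 1 else 0) else 0)"
    using ij by (intro sum.cong) (auto simp: mat_unit_def)
  also have "\<dots> = (if i = a \<and> b = c \<and> j = d then 1 else 0)" using assms by simp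
  finally show "(mat_unit n a b * mat_unit n c d) $$ (i,j) = (if b = c then mat_unit n a d else 0\<^sub>m n n) $$ (i,j)"
    using ij by (auto simp: mat_unit_def)
qed auto

lemma mtrace_mult_commute:
  assumes "A \<in> carrier_mat n n" "B \<in> carrier_mat n n"
  shows "mtrace (A * B) = mtrace (B * A)"
proof -
  have "mtrace (A * B) = (\<Sum>i<n. \<Sum>k<n. A $$ (i,k) * B $$ (k,i))"
    using assms mult_index[OF assms] by (simp add: mtrace_def del: index_mult_mat(1))
  also have "\<dots> = (\<Sum>k<n. \<Sum>i<n. B $$ (k,i) * A $$ (i,k))"
    by (subst sum.swap) (simp add: mult.commute)
  also have "\<dots> = mtrace (B * A)"
    using assms mult_index[OF assms(2,1)] by (simp add: mtrace_def del: index_mult_mat(1))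
  finally show ?thesis .
qed

lemma lie_subspace_sum:
  assumes H: "lie_subspace t n H" and I: "finite I"
    and F: "\<And>i. i \<in> I \<Longrightarrow> F i \<in> H"
  shows "mat n n (\<lambda>p. \<Sum>i\<in>I. F i $$ p) \<in> H"
  using I F
proof (induction I rule: finite_induct)
  case empty
  have "mat n n (\<lambda>p. 0) = (0\<^sub>m n n :: complex mat)" by (rule eq_matI) auto
  then show ?case using H by (simp add: lie_subspace_def)
next
  case (insert x I)
  have c: "F x \<in> carrier_mat n n" using insert.prems H by (auto simp: lie_subspace_def lie_alg_def)
  have "mat n n (\<lambda>p. \<Sum>i\<in>insert x I. F i $$ p) = F x + mat n n (\<lambda>p. \<Sum>i\<in>I. F i $$ p)"
    by (rule eq_matI) (use c insert.hyps in auto)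
  then show ?case using insert H unfolding lie_subspace_def by auto
qed

text \<open>The torus element E(0,0) - E(n-1,n-1) has eigenvalue -2 only on the matrix unit E(n-1,0), so four brackets
  with it isolate that unit from any element with a nonzero corner; this lowest weight vector generates sl(n).\<close>
lemma b_stable_contains_traceless:
  assumes n: "n \<ge> 3" and H: "lie_subspace t n H" and st: "b_stable t n H"
    and y: "y \<in> H" "y $$ (n-1,0) \<noteq> 0" and x: "x \<in> carrier_mat n n" "mtrace x = 0"
  shows "x \<in> H"
proof -
  have Hc: "h \<in> carrier_mat n n" if "h \<in> H" for h using that H by (auto simp: lie_subspace_def lie_alg_def)
  have add: "a + b \<in> H" if "a \<in> H" "b \<in> H" for a b using that H by (auto simp: lie_subspace_def)
  have scale: "c \<cdot>\<^sub>m a \<in> H" if "a \<in> H" for a c using that H by (auto simp: lie_subspace_def)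
  have br: "b * h - h * b \<in> H" if "b \<in> borel_alg t n" "h \<in> H" for b h using st that by (auto simp: b_stable_def)
  let ?E = "mat_unit n"
  have EB: "?E a b \<in> borel_alg t n" if "a < b" "b < n" for a b
    using that by (auto simp: borel_alg_def lie_alg_def mtrace_def mat_unit_def intro!: upper_triangularI sum.neutral)
  define \<delta> where "\<delta> i = (if i = 0 then 1 else if i = n-1 then -1 else (0::complex))" for i
  define h where "h = mat n n (\<lambda>(i,j). if i = j then \<delta> i else 0)"
  have hB: "h \<in> borel_alg t n"
  proof -
    have "mtrace h = (\<Sum>i<n. \<delta> i)" unfolding mtrace_def h_def by auto
    also have "\<dots> = (\<Sum>i<n. (if i = 0 then 1 else 0) - (if i = n-1 then 1 else 0))"
      using n by (intro sum.cong) (auto simp: \<delta>_def)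
    also have "\<dots> = 0" using n by (simp add: sum_subtractf)
    finally show ?thesis by (auto simp: borel_alg_def lie_alg_def h_def intro!: upper_triangularI)
  qed
  \<comment> \<open>Bracketing with \<open>h\<close> and adding \<open>\<mu>\<close> times the
    element multiplies the part of weight w by w + \<open>\<mu>\<close>.\<close>
  have hbr: "mat n n (\<lambda>(i,j). (\<delta> i - \<delta> j + \<mu>) * f i j) \<in> H" if f: "mat n n (\<lambda>(i,j). f i j) \<in> H" for f \<mu>
  proof -
    let ?m = "mat n n (\<lambda>(i,j). f i j)"
    have 1: "(h * ?m) $$ (i,j) = \<delta> i * f i j" "(?m * h) $$ (i,j) = f i j * \<delta> j" if ij: "i < n" "j < n" for i j
    proof -
      have "(h * ?m) $$ (i,j) = (\<Sum>k<n. h $$ (i,k) * ?m $$ (k,j))" using ij by (intro mult_index) (auto simp: h_def)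
      also have "\<dots> = (\<Sum>k<n. if k = i then \<delta> i * f i j else 0)" using ij by (intro sum.cong) (auto simp: h_def)
      finally show "(h * ?m) $$ (i,j) = \<delta> i * f i j" using ij by simp
      have "(?m * h) $$ (i,j) = (\<Sum>k<n. ?m $$ (i,k) * h $$ (k,j))" using ij by (intro mult_index) (auto simp: h_def)
      also have "\<dots> = (\<Sum>k<n. if k = j then f i j * \<delta> j else 0)" using ij by (intro sum.cong) (auto simp: h_def)
      finally show "(?m * h) $$ (i,j) = f i j * \<delta> j" using ij by simp
    qed
    have "mat n n (\<lambda>(i,j). (\<delta> i - \<delta> j + \<mu>) * f i j) = (h * ?m - ?m * h) + \<mu> \<cdot>\<^sub>m ?m"
      by (rule eq_matI) (use 1 in \<open>auto simp: h_def algebra_simps\<close>)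
    then show ?thesis using add[OF br[OF hB f] scale[OF f, of \<mu>]] by simp
  qed
  have "mat n n (\<lambda>(i,j). y $$ (i,j)) \<in> H"
  proof -
    have "mat n n (\<lambda>(i,j). y $$ (i,j)) = y" by (rule eq_matI) (use Hc[OF y(1)] in auto)
    then show ?thesis using y(1) by simp
  qed
  \<comment> \<open>The four factors kill the weights 2, 1, 0 and -1; at the remaining weight -2
    their product is (-4)(-3)(-2)(-1) = 24.\<close>
  from hbr[OF hbr[OF hbr[OF hbr[OF this, of "-2"], of "-1"], of 0], of 1]
  have iso: "mat n n (\<lambda>(i,j). (\<delta> i - \<delta> j + 1) * ((\<delta> i - \<delta> j + 0) * ((\<delta> i - \<delta> j + -1) * ((\<delta> i - \<delta> j + -2) * y $$ (i,j))))) \<in> H"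
    (is "?z \<in> H") .
  have "?z = (24 * y $$ (n-1,0)) \<cdot>\<^sub>m ?E (n-1) 0"
    by (rule eq_matI) (use n in \<open>auto simp: \<delta>_def mat_unit_def\<close>)
  then have "(1 / (24 * y $$ (n-1,0))) \<cdot>\<^sub>m ((24 * y $$ (n-1,0)) \<cdot>\<^sub>m ?E (n-1) 0) \<in> H"
    using scale[OF iso] by simp
  moreover have "(1 / (24 * y $$ (n-1,0))) \<cdot>\<^sub>m ((24 * y $$ (n-1,0)) \<cdot>\<^sub>m ?E (n-1) 0) = ?E (n-1) 0"
    by (rule eq_matI) (use y(2) in \<open>auto simp: mat_unit_def\<close>)
  ultimately have low: "?E (n-1) 0 \<in> H" by simp
  have bracket: "(if b = c then ?E a d else 0\<^sub>m n n) - (if d = a then ?E c b else 0\<^sub>m n n) \<in> H"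
    if "a < b" "b < n" "c < n" "d < n" "?E c d \<in> H" for a b c d
    using br[OF EB[OF that(1,2)] that(5)] that mat_unit_mult[of a n b c d] mat_unit_mult[of c n d a b] by simp
  have minus0: "A - 0\<^sub>m n n = A" "0\<^sub>m n n - A = (-1) \<cdot>\<^sub>m A" if "A \<in> carrier_mat n n" for A :: "complex mat"
    using that by (auto intro!: eq_matI)
  have neg: "A \<in> H" if "A \<in> carrier_mat n n" "(-1) \<cdot>\<^sub>m A \<in> H" for A
  proof -
    have "(-1) \<cdot>\<^sub>m ((-1) \<cdot>\<^sub>m A) = A" by (rule eq_matI) (use that in auto)
    then show ?thesis using scale[OF that(2), of "-1"] by simp
  qed
  \<comment> \<open>Brackets with strictly upper matrix units now produce the rest: E(a,0) from
    [E(a,n-1), E(n-1,0)], then E(a,b) and the diagonal differences from [E(0,b), E(a,0)], and row 0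
    last.\<close>
  have col0: "?E a 0 \<in> H" if a: "0 < a" "a < n" for a
  proof (cases "a = n-1")
    case False
    then show ?thesis using bracket[of a "n-1" "n-1" 0] a low by (simp add: minus0)
  qed (use low in simp)
  have off: "?E a b \<in> H" if ab: "0 < a" "a < n" "b < n" "a \<noteq> b" for a b
  proof (cases "b = 0")
    case False
    then have "(-1) \<cdot>\<^sub>m ?E a b \<in> H" using bracket[of 0 b a 0] ab col0[of a] by (simp add: minus0)
    then show ?thesis by (rule neg[rotated]) simp
  qed (use ab col0 in simp)
  have diag: "?E 0 0 - ?E a a \<in> H" if a: "0 < a" "a < n" for a
    using bracket[of 0 a a 0] a col0[of a] by simp
  have row0: "?E 0 b \<in> H" if b: "0 < b" "b < n" for b
  proof -
    \<comment> \<open>An index other than 0 and \<open>b\<close>, available because n is at least 3;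
      then [E(0,a), E(a,b)] = E(0,b).\<close>
    let ?a = "if b = 1 then 2 else 1 :: nat"
    have a: "0 < ?a" "?a < n" "?a \<noteq> b" using b n by auto
    have "?E ?a b \<in> H" by (rule off) (use a b in auto)
    from bracket[OF a(1,2,2) b(2) this] show ?thesis using b by (simp add: minus0)
  qed
  \<comment> \<open>The diagonal is written through E(0,0) - E(a,a). The coefficient of E(0,0)
    becomes minus the sum of the other diagonal entries, which is x(0,0) because the trace is
    0.\<close>
  define F where "F p = (case p of (a,b) \<Rightarrow>
     if a \<noteq> b then x $$ (a,b) \<cdot>\<^sub>m ?E a b else if a = 0 then 0\<^sub>m n n else (- x $$ (a,a)) \<cdot>\<^sub>m (?E 0 0 - ?E a a))" for p
  have FH: "F p \<in> H" if pn: "p \<in> {..<n} \<times> {..<n}" for p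
  proof -
    obtain a b where p: "p = (a,b)" "a < n" "b < n" using pn by auto
    have "0\<^sub>m n n \<in> H" using H by (simp add: lie_subspace_def)
    then show ?thesis using p off[of a b] row0[of b] diag[of a]
      by (cases "a = 0") (auto simp: F_def intro!: scale)
  qed
  have "x = mat n n (\<lambda>q. \<Sum>p\<in>{..<n} \<times> {..<n}. F p $$ q)"
  proof (rule eq_matI)
    fix i j assume "i < dim_row (mat n n (\<lambda>q. \<Sum>p\<in>{..<n} \<times> {..<n}. F p $$ q))"
      "j < dim_col (mat n n (\<lambda>q. \<Sum>p\<in>{..<n} \<times> {..<n}. F p $$ q))"
    then have ij: "i < n" "j < n" by auto
    have tr: "(\<Sum>a<n. x $$ (a,a)) = 0" using x by (simp add: mtrace_def)
    have Fij: "F (a,b) $$ (i,j) = (if a = i \<and> b = j then x $$ (i,j) else 0) -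
        (if a = b then (if i = 0 \<and> j = 0 then x $$ (a,a) else 0) else 0)" if "a < n" "b < n" for a b
      using ij that by (auto simp: F_def mat_unit_def)
    have "(\<Sum>p\<in>{..<n} \<times> {..<n}. F p $$ (i,j)) = (\<Sum>a<n. \<Sum>b<n. F (a,b) $$ (i,j))"
      by (simp add: sum.cartesian_product)
    also have "\<dots> = (\<Sum>a<n. \<Sum>b<n. (if a = i \<and> b = j then x $$ (i,j) else 0) -
        (if a = b then (if i = 0 \<and> j = 0 then x $$ (a,a) else 0) else 0))"
      using Fij by (intro sum.cong) auto
    also have "\<dots> = (\<Sum>a<n. \<Sum>b<n. (if a = i \<and> b = j then x $$ (i,j) else 0)) -
        (\<Sum>a<n. \<Sum>b<n. (if a = b then (if i = 0 \<and> j = 0 then x $$ (a,a) else 0) else 0))"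
      by (simp only: sum_subtractf)
    finally have 1: "(\<Sum>p\<in>{..<n} \<times> {..<n}. F p $$ (i,j)) =
        (\<Sum>a<n. \<Sum>b<n. (if a = i \<and> b = j then x $$ (i,j) else 0)) -
        (\<Sum>a<n. \<Sum>b<n. (if a = b then (if i = 0 \<and> j = 0 then x $$ (a,a) else 0) else 0))" .
    have "(\<Sum>a<n. \<Sum>b<n. (if a = b then (if i = 0 \<and> j = 0 then x $$ (a,a) else 0) else 0)) =
       (\<Sum>a<n. if i = 0 \<and> j = 0 then x $$ (a,a) else 0)"
      by (intro sum.cong) auto
    moreover have "(\<Sum>a<n. if i = 0 \<and> j = 0 then x $$ (a,a) else 0) = 0"
    proof (cases "i = 0 \<and> j = 0")
      case True
      show ?thesis unfolding if_P[OF True] by (rule tr)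
    next
      case False
      show ?thesis unfolding if_not_P[OF False] by simp
    qed
    ultimately have 2: "(\<Sum>a<n. \<Sum>b<n. (if a = b then (if i = 0 \<and> j = 0 then x $$ (a,a) else 0) else 0)) = 0"
      by (rule trans)
    have "(\<Sum>a<n. \<Sum>b<n. (if a = i \<and> b = j then x $$ (i,j) else 0)) = (\<Sum>a<n. if a = i then x $$ (i,j) else 0)"
      using ij by (intro sum.cong) auto
    then have 3: "(\<Sum>a<n. \<Sum>b<n. (if a = i \<and> b = j then x $$ (i,j) else 0)) = x $$ (i,j)" using ij by simp
    show "x $$ (i,j) = mat n n (\<lambda>q. \<Sum>p\<in>{..<n} \<times> {..<n}. F p $$ q) $$ (i,j)"
      using ij 1 unfolding 2 3 by simp
  qed (use x in auto)
  then show ?thesis using lie_subspace_sum[OF H, of "{..<n} \<times> {..<n}" F] FH by simp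
qed

section \<open>Cases in which B(x,H) is the whole flag variety\<close>

lemma conj_exists:
  assumes "g \<in> grp t n" "x \<in> carrier_mat n n"
  obtains y where "y \<in> carrier_mat n n" "x * g = g * y" "mtrace y = mtrace x"
proof -
  note gc = grp_carrier[OF assms(1)]
  obtain q where q: "q \<in> grp t n" "g * q = 1\<^sub>m n" "q * g = 1\<^sub>m n" using grp_inverse[OF assms(1)] by blast
  note qc = grp_carrier[OF q(1)]
  let ?y = "q * (x * g)"
  have xg: "x * g \<in> carrier_mat n n" using assms(2) gc by simp
  have "g * ?y = x * g" by (rule left_inverse_cancel[OF gc qc xg q(2)])
  moreover have "mtrace ?y = mtrace x"
    using mtrace_mult_commute[OF qc xg] assoc_mult_mat[OF assms(2) gc qc] q(2) assms(2) by simp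
  ultimately show ?thesis using that[of ?y] mult_carrier_mat[OF qc xg] by simp
qed

text \<open>One conjugate of \<open>x\<close> lies in \<open>H\<close>, and every other conjugate
  differs from it by a traceless matrix, which \<open>H\<close> contains.\<close>

lemma hess_full:
  assumes n: "n \<ge> 3" and H: "lie_subspace t n H" "b_stable t n H" and y: "y \<in> H" "y $$ (n-1,0) \<noteq> 0"
    and x: "x \<in> carrier_mat n n" and ne: "hess t n x H \<noteq> {}"
  shows "hess t n x H = flag t n"
proof -
  from ne obtain g z where g: "g \<in> grp t n" and z: "z \<in> H" "x * g = g * z" unfolding hess_def by blast
  have zc: "z \<in> carrier_mat n n" using z H by (auto simp: lie_subspace_def lie_alg_def)
  note gc = grp_carrier[OF g]
  obtain q where q: "q \<in> grp t n" "q * g = 1\<^sub>m n" using grp_inverse[OF g] by blast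
  obtain z' where z': "z' \<in> carrier_mat n n" "x * g = g * z'" "mtrace z' = mtrace x" using conj_exists[OF g x] .
  have "z = z'" using left_inverse_cancel[OF grp_carrier[OF q(1)] gc _ q(2), of z]
     left_inverse_cancel[OF grp_carrier[OF q(1)] gc _ q(2), of z'] z z' zc by simp
  have "C \<in> hess t n x H" if C: "C \<in> flag t n" for C
  proof -
    obtain k where k: "k \<in> grp t n" "C = coset t n k" using flagE[OF C] .
    obtain w where w: "w \<in> carrier_mat n n" "x * k = k * w" "mtrace w = mtrace x" using conj_exists[OF k(1) x] .
    have "mtrace (w - z) = mtrace w - mtrace z" using w zc by (simp add: mtrace_def sum_subtractf)
    then have "w - z \<in> H" using w z' \<open>z = z'\<close> zc by (intro b_stable_contains_traceless[OF n H y]) auto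
    then have "w - z + z \<in> H" using H(1) z(1) unfolding lie_subspace_def by blast
    moreover have "w - z + z = w" by (rule eq_matI) (use w zc in auto)
    ultimately show ?thesis unfolding hess_def using C k w by auto
  qed
  then show ?thesis unfolding hess_def by blast
qed

text \<open>A scalar matrix is its own only conjugate, so the condition does not depend on the
  flag.\<close>

lemma hess_scalar:
  assumes x: "x = e \<cdot>\<^sub>m 1\<^sub>m n" and H: "lie_subspace t n H" and ne: "hess t n x H \<noteq> {}"
  shows "hess t n x H = flag t n"
proof -
  from ne obtain g z where g: "g \<in> grp t n" and z: "z \<in> H" "x * g = g * z" unfolding hess_def by blast
  have zc: "z \<in> carrier_mat n n" using z H by (auto simp: lie_subspace_def lie_alg_def)
  have com: "x * k = k * x" if "k \<in> grp t n" for k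
    using grp_carrier[OF that] unfolding x
    by (simp add: mult_smult_distrib[of _ n n _ n] mult_smult_assoc_mat[of _ n n _ n] right_mult_one_mat[of _ n n] left_mult_one_mat[of _ n n])
  obtain q where q: "q \<in> grp t n" "q * g = 1\<^sub>m n" using grp_inverse[OF g] by blast
  have xc: "x \<in> carrier_mat n n" unfolding x by simp
  have "z = q * (g * z)" by (rule left_inverse_cancel[OF grp_carrier[OF q(1)] grp_carrier[OF g] zc q(2), symmetric])
  also have "\<dots> = q * (g * x)" using z(2) com[OF g] by argo
  also have "\<dots> = x" by (rule left_inverse_cancel[OF grp_carrier[OF q(1)] grp_carrier[OF g] xc q(2)])
  finally have "z = x" .
  have "C \<in> hess t n x H" if C: "C \<in> flag t n" for C
  proof -
    obtain k where "k \<in> grp t n" "C = coset t n k" using flagE[OF C] .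
    then show ?thesis using com[of k] z(1) C \<open>z = x\<close> unfolding hess_def by blast
  qed
  then show ?thesis unfolding hess_def by blast
qed

section \<open>The Schubert divisor\<close>

text \<open>Bruhat cells are governed by lower left minors; reversing the rows turns these into
  leading minors, to which the tools for triangular decomposition apply.\<close>

definition flip_rows :: "nat \<Rightarrow> complex mat \<Rightarrow> complex mat" where
  "flip_rows n g = mat n n (\<lambda>(r,c). g $$ (n-1-r,c))"

text \<open>Acts on columns: since s_i w_0 = w_0 s_(n-i), reversing the rows of the permutation
  matrix of s_i w_0 leaves that of \<open>adj_swap (n-i)\<close>.\<close>

definition adj_swap :: "nat \<Rightarrow> nat \<Rightarrow> nat" where
  "adj_swap m j = (if j = m-1 then m else if j = m then m-1 else j)"

abbreviation "sw_perm n i \<equiv> s_perm i \<circ> w0_perm n"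

lemma adj_swap_involution: "0 < m \<Longrightarrow> adj_swap m (adj_swap m j) = j"
  by (auto simp: adj_swap_def)

lemma adj_swap_less: "0 < m \<Longrightarrow> j < k \<Longrightarrow> k \<noteq> m \<Longrightarrow> adj_swap m j < k"
  by (auto simp: adj_swap_def)

lemma sw_perm_eq: "0 < i \<Longrightarrow> i < n \<Longrightarrow> j < n \<Longrightarrow> sw_perm n i j = n - 1 - adj_swap (n-i) j"
  by (auto simp: s_perm_def w0_perm_def adj_swap_def)

lemma flip_rows_carrier [simp]: "flip_rows n g \<in> carrier_mat n n"
  by (simp add: flip_rows_def)

lemma flip_rows_index: "r < n \<Longrightarrow> c < n \<Longrightarrow> flip_rows n g $$ (r,c) = g $$ (n-1-r,c)"
  by (simp add: flip_rows_def)

lemma flip_rows_mult: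
  assumes "g \<in> carrier_mat n n" "b \<in> carrier_mat n n"
  shows "flip_rows n (g * b) = flip_rows n g * b"
proof (rule eq_matI)
  fix r c assume "r < dim_row (flip_rows n g * b)" "c < dim_col (flip_rows n g * b)"
  then have rc: "r < n" "c < n" using assms by (auto simp: flip_rows_def)
  have "flip_rows n (g * b) $$ (r,c) = (\<Sum>k<n. g $$ (n-1-r,k) * b $$ (k,c))"
    unfolding flip_rows_index[OF rc] using rc by (intro mult_index assms) auto
  also have "\<dots> = (\<Sum>k<n. flip_rows n g $$ (r,k) * b $$ (k,c))"
    using rc by (intro sum.cong) (auto simp: flip_rows_index)
  also have "\<dots> = (flip_rows n g * b) $$ (r,c)" using rc assms by (intro mult_index[symmetric]) auto
  finally show "flip_rows n (g * b) $$ (r,c) = (flip_rows n g * b) $$ (r,c)" .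
qed (use assms in \<open>auto simp: flip_rows_def\<close>)

lemma flip_minor_borel:
  assumes "g \<in> carrier_mat n n" "b \<in> borel GL n" "k \<le> n"
  shows "lead_minor (flip_rows n (g * b)) k = 0 \<longleftrightarrow> lead_minor (flip_rows n g) k = 0"
proof -
  have b: "b \<in> carrier_mat n n" "upper_triangular b" using assms by (auto simp: borel_GL_iff)
  have "lead_minor (flip_rows n (g * b)) k = lead_minor (flip_rows n g) k * lead_minor b k"
    unfolding flip_rows_mult[OF assms(1) b(1)]
    using det_sub_product[OF flip_rows_carrier b assms(3), of "\<lambda>r. r" g] assms(3) by (simp add: lead_minor_def)
  then show ?thesis using lead_minor_upper[OF assms(2,3)] by simp
qed

lemma perm_mat_index: "p < n \<Longrightarrow> j < n \<Longrightarrow> perm_mat n w $$ (p,j) = (if p = w j then 1 else 0)"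
  by (simp add: perm_mat_def)

lemma lead_minor_zero_iff:
  "lead_minor M k = 0 \<longleftrightarrow> (\<exists>a. (\<exists>c<k. a c \<noteq> 0) \<and> (\<forall>r<k. (\<Sum>c<k. M $$ (r,c) * a c) = 0))"
  unfolding lead_minor_def by (rule det_zero_iff_kernel)

text \<open>The transposition of n-i-1 and n-i preserves {0..<k} for every k other than n-i, so the
  leading block of the reversed matrix is again a permutation matrix.\<close>

lemma sw_perm_minor_nonzero:
  assumes i: "0 < i" "i < n" and k: "k \<le> n" "k \<noteq> n - i"
  shows "lead_minor (flip_rows n (perm_mat n (sw_perm n i))) k \<noteq> 0"
proof
  let ?m = "n - i"
  have m: "0 < ?m" using i by simp
  assume "lead_minor (flip_rows n (perm_mat n (sw_perm n i))) k = 0"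
  then obtain a c where c: "c < k" "a c \<noteq> 0"
    and a: "\<And>r. r < k \<Longrightarrow> (\<Sum>c<k. flip_rows n (perm_mat n (sw_perm n i)) $$ (r,c) * a c) = 0"
    unfolding lead_minor_zero_iff by blast
  let ?r = "adj_swap ?m c"
  have r: "?r < k" using adj_swap_less[OF m c(1)] k by simp
  have "(\<Sum>c'<k. flip_rows n (perm_mat n (sw_perm n i)) $$ (?r,c') * a c') = (\<Sum>c'<k. if c' = c then a c else 0)"
  proof (rule sum.cong[OF refl])
    fix c' assume "c' \<in> {..<k}"
    then have c': "c' < k" by simp
    have r': "adj_swap ?m c' < k" using adj_swap_less[OF m c'] k by simp
    have "n - 1 - ?r = n - 1 - adj_swap ?m c' \<longleftrightarrow> ?r = adj_swap ?m c'" using r r' k by auto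
    also have "\<dots> \<longleftrightarrow> c' = c" using adj_swap_involution[OF m] by metis
    finally show "flip_rows n (perm_mat n (sw_perm n i)) $$ (?r,c') * a c' = (if c' = c then a c else 0)"
      using r c' k sw_perm_eq[OF i, of c'] by (auto simp: flip_rows_index perm_mat_index)
  qed
  also have "\<dots> = a c" using c by simp
  finally show False using a[OF r] c by simp
qed

lemma sw_perm_mat_grp:
  assumes i: "0 < i" "i < n"
  shows "perm_mat n (sw_perm n i) \<in> grp GL n"
proof -
  let ?w = "sw_perm n i" and ?m = "n - i"
  have m: "0 < ?m" using i by simp
  have ss: "adj_swap ?m c < n" if "c < n" for c using adj_swap_less[OF m that] i by simp
  have inj: "?w c = ?w d \<longleftrightarrow> c = d" if "c < n" "d < n" for c d
  proof -
    have "?w c = ?w d \<longleftrightarrow> adj_swap ?m c = adj_swap ?m d"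
      using ss[OF that(1)] ss[OF that(2)] unfolding sw_perm_eq[OF i that(1)] sw_perm_eq[OF i that(2)] by auto
    also have "\<dots> \<longleftrightarrow> c = d" using adj_swap_involution[OF m] by metis
    finally show ?thesis .
  qed
  have lt: "?w c < n" if "c < n" for c using sw_perm_eq[OF i that] that by simp
  have "det (mat n n (\<lambda>(r,c). if r = ?w c then 1 else 0 :: complex)) \<noteq> 0"
  proof
    assume "det (mat n n (\<lambda>(r,c). if r = ?w c then 1 else 0 :: complex)) = 0"
    then obtain a c where c: "c < n" "a c \<noteq> 0"
      and a: "\<And>r. r < n \<Longrightarrow> (\<Sum>c<n. (if r = ?w c then 1 else 0) * a c) = (0::complex)"
      unfolding det_zero_iff_kernel by blast
    have "(\<Sum>d<n. (if ?w c = ?w d then 1 else 0) * a d) = (\<Sum>d<n. if d = c then a c else 0)"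
      using inj[OF c(1)] by (intro sum.cong) auto
    then show False using a[OF lt[OF c(1)]] c by simp
  qed
  then show ?thesis by (simp add: grp_GL_iff perm_mat_def)
qed

text \<open>Column elimination with the pivot pattern of s_i w_0. Only the columns n-i-1 and n-i
  exchange their pivot rows: a kernel vector of the singular minor clears one row more for column
  n-i-1, and column n-i takes over the pivot row this frees.\<close>

lemma bruhat_cell_criterion:
  assumes i: "0 < i" "i < n" and g: "g \<in> grp GL n"
    and nz: "\<And>k. k \<le> n \<Longrightarrow> k \<noteq> n - i \<Longrightarrow> lead_minor (flip_rows n g) k \<noteq> 0"
    and z: "lead_minor (flip_rows n g) (n - i) = 0"
  shows "\<exists>\<beta>\<in>borel GL n. \<exists>b\<in>borel GL n. g * \<beta> = b * perm_mat n (sw_perm n i)"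
proof -
  let ?w = "sw_perm n i" and ?M = "flip_rows n g"
  define m where "m = n - i"
  have m: "0 < m" "m < n" using i by (auto simp: m_def)
  note nz = nz[folded m_def] and z = z[folded m_def]
  note gc = grp_carrier[OF g]
  obtain a0 where a0: "\<exists>c<m. a0 c \<noteq> 0" "\<And>r. r < m \<Longrightarrow> (\<Sum>c<m. ?M $$ (r,c) * a0 c) = 0"
    using z unfolding lead_minor_zero_iff by blast
  have m1: "lead_minor ?M (m-1) \<noteq> 0" using nz[of "m-1"] m by simp
  have split: "(\<Sum>c<m. f c) = (\<Sum>c<m-1. f c) + f (m-1)" for f :: "nat \<Rightarrow> complex"
    using m(1) by (cases m) auto
  have ker_triv: "\<forall>c<m. a c = 0" if "a (m-1) = 0" "\<And>r. r < m-1 \<Longrightarrow> (\<Sum>c<m. ?M $$ (r,c) * a c) = 0" for a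
  proof -
    have "(\<Sum>c<m-1. ?M $$ (r,c) * a c) = 0" if "r < m-1" for r
      using that \<open>a (m-1) = 0\<close> \<open>\<And>r. r < m-1 \<Longrightarrow> (\<Sum>c<m. ?M $$ (r,c) * a c) = 0\<close>[of r] split[of "\<lambda>c. ?M $$ (r,c) * a c"] by simp
    then have "a c = 0" if "c < m - 1" for c using lead_minor_kernel_trivial[OF m1] that by blast
    then show ?thesis using \<open>a (m-1) = 0\<close> by (metis Suc_diff_1 less_Suc_eq m(1))
  qed
  have a0m: "a0 (m-1) \<noteq> 0" using ker_triv[of a0] a0 by auto
  have "\<exists>a. a j \<noteq> 0 \<and> (\<forall>c>j. a c = 0) \<and> (\<forall>r<adj_swap m j. (\<Sum>c<Suc j. ?M $$ (r,c) * a c) = 0)"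
    if j: "j < n" for j
  proof -
    consider "j = m-1" | "j = m" | "j \<noteq> m-1" "j \<noteq> m" by blast
    then show ?thesis
    proof cases
      case 1
      let ?a = "\<lambda>c. if c \<le> j then a0 c else 0"
      have "(\<Sum>c<Suc j. ?M $$ (r,c) * ?a c) = 0" if "r < m" for r
      proof -
        have "(\<Sum>c<Suc j. ?M $$ (r,c) * ?a c) = (\<Sum>c<m. ?M $$ (r,c) * a0 c)"
          using 1 m by (intro sum.cong) auto
        then show ?thesis using a0(2)[OF that] by simp
      qed
      then show ?thesis using 1 a0m by (intro exI[of _ ?a]) (auto simp: adj_swap_def)
    next
      case 3
      have "lead_minor ?M j \<noteq> 0" "lead_minor ?M (Suc j) \<noteq> 0" using nz[of j] nz[of "Suc j"] j 3 by auto
      then obtain a where "a j \<noteq> 0" "\<And>c. c > j \<Longrightarrow> a c = 0" "\<And>r. r < j \<Longrightarrow> (\<Sum>c<Suc j. ?M $$ (r,c) * a c) = 0"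
        by (rule pivot_vector) blast
      then show ?thesis using 3 by (intro exI[of _ a]) (auto simp: adj_swap_def)
    next
      case 2
      have "lead_minor ?M (Suc m) \<noteq> 0" using nz[of "Suc m"] m by simp
      \<comment> \<open>The right-hand side sits at row m-1, the pivot row given up by column
        m-1.\<close>
      then obtain a where a: "\<And>r. r < Suc m \<Longrightarrow> (\<Sum>c<Suc m. ?M $$ (r,c) * a c) = (if r = m-1 then 1 else 0)"
        using det_nonzero_solve[of "Suc m" "\<lambda>r c. ?M $$ (r,c)" "\<lambda>r. if r = m-1 then 1 else 0"]
        unfolding lead_minor_def by blast
      \<comment> \<open>If \<open>a m\<close> were 0, subtracting a multiple of \<open>a0\<close>
        would clear coordinate m-1 without changing the values in the first m rows; then
        \<open>ker_triv\<close> yields the zero vector, against the value 1 in row m-1.\<close>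
      have am: "a m \<noteq> 0"
      proof
        assume "a m = 0"
        then have am: "(\<Sum>c<m. ?M $$ (r,c) * a c) = (if r = m-1 then 1 else 0)" if "r < m" for r
          using a[of r] that by simp
        define l where "l = a (m-1) / a0 (m-1)"
        have s: "(\<Sum>c<m. ?M $$ (r,c) * (a c - l * a0 c)) = (if r = m-1 then 1 else 0)" if "r < m" for r
        proof -
          have "(\<Sum>c<m. ?M $$ (r,c) * (a c - l * a0 c)) = (\<Sum>c<m. ?M $$ (r,c) * a c) - l * (\<Sum>c<m. ?M $$ (r,c) * a0 c)"
            by (simp add: algebra_simps sum_subtractf sum_distrib_left)
          then show ?thesis using am[OF that] a0(2)[OF that] by simp
        qed
        have "\<forall>c<m. a c - l * a0 c = 0"
        proof (rule ker_triv)
          show "a (m-1) - l * a0 (m-1) = 0" using a0m by (simp add: l_def)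
          show "(\<Sum>c<m. ?M $$ (r,c) * (a c - l * a0 c)) = 0" if "r < m-1" for r using s[of r] that by simp
        qed
        then have "(\<Sum>c<m. ?M $$ (m-1,c) * (a c - l * a0 c)) = 0" by simp
        with s[of "m-1"] m show False by simp
      qed
      let ?a = "\<lambda>c. if c \<le> m then a c else 0"
      have "(\<Sum>c<Suc m. ?M $$ (r,c) * ?a c) = 0" if "r < m-1" for r
      proof -
        have "(\<Sum>c<Suc m. ?M $$ (r,c) * ?a c) = (\<Sum>c<Suc m. ?M $$ (r,c) * a c)" by (intro sum.cong) auto
        then show ?thesis using a[of r] that by simp
      qed
      then show ?thesis using 2 am m by (intro exI[of _ ?a]) (auto simp: adj_swap_def)
    qed
  qed
  then have "\<forall>j. \<exists>a. j < n \<longrightarrow> a j \<noteq> 0 \<and> (\<forall>c>j. a c = 0) \<and> (\<forall>r<adj_swap m j. (\<Sum>c<Suc j. ?M $$ (r,c) * a c) = 0)"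
    by blast
  from choice[OF this] obtain a where a: "\<And>j. j < n \<Longrightarrow> a j j \<noteq> 0 \<and> (\<forall>c>j. a j c = 0) \<and>
     (\<forall>r<adj_swap m j. (\<Sum>c<Suc j. ?M $$ (r,c) * a j c) = 0)" by blast
  let ?\<beta> = "mat n n (\<lambda>(c,j). a j c)"
  have be: "?\<beta> \<in> borel GL n" by (rule borel_GLI) (use a in auto)
  let ?N = "g * ?\<beta>"
  have Nc: "?N \<in> carrier_mat n n" using gc by simp
  have sl: "adj_swap m j < n" if "j < n" for j using adj_swap_less[OF m(1) that] m by simp
  have N: "?N $$ (p,j) = 0" if pj: "p < n" "j < n" "n - 1 - p < adj_swap m j" for p j
  proof -
    have "?N $$ (p,j) = flip_rows n ?N $$ (n-1-p,j)" using pj by (simp add: flip_rows_index del: index_mult_mat(1))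
    also have "\<dots> = (?M * ?\<beta>) $$ (n-1-p,j)" using flip_rows_mult[OF gc, of ?\<beta>] by simp
    also have "\<dots> = (\<Sum>c<Suc j. ?M $$ (n-1-p,c) * a j c)"
      using pj a by (intro upper_matrix_mult) auto
    finally show ?thesis using a[OF pj(2)] pj(3) by simp
  qed
  \<comment> \<open>The product of \<open>?N\<close> with the inverse permutation matrix, written as
    a rearrangement of columns; the zero pattern \<open>N\<close> becomes triangularity.\<close>
  define b where "b = mat n n (\<lambda>(p,q). ?N $$ (p, adj_swap m (n-1-q)))"
  have bc: "b \<in> carrier_mat n n" by (simp add: b_def)
  have ub: "upper_triangular b"
  proof
    fix p q assume "q < p" "p < dim_row b"
    then have pq: "q < p" "p < n" "q < n" by (auto simp: b_def)
    have "?N $$ (p, adj_swap m (n-1-q)) = 0"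
      by (rule N) (use pq sl[of "n-1-q"] adj_swap_involution[OF m(1)] in auto)
    then show "b $$ (p,q) = 0" using pq by (simp add: b_def)
  qed
  have bW: "b * perm_mat n ?w = ?N"
  proof (rule eq_matI)
    fix p j assume "p < dim_row ?N" "j < dim_col ?N"
    then have pj: "p < n" "j < n" using Nc by auto
    have wj: "?w j = n - 1 - adj_swap m j" using sw_perm_eq[OF i pj(2)] by (simp add: m_def)
    have wl: "?w j < n" unfolding wj using pj by simp
    have "(b * perm_mat n ?w) $$ (p,j) = (\<Sum>q<n. b $$ (p,q) * perm_mat n ?w $$ (q,j))"
      using pj bc by (intro mult_index) auto
    also have "\<dots> = (\<Sum>q<n. if q = ?w j then b $$ (p, ?w j) else 0)"
      using pj by (intro sum.cong) (auto simp: perm_mat_index)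
    also have "\<dots> = b $$ (p, ?w j)" using wl by simp
    also have "\<dots> = ?N $$ (p, adj_swap m (n - 1 - ?w j))" using pj wl by (simp add: b_def del: index_mult_mat(1))
    also have "n - 1 - ?w j = adj_swap m j" unfolding wj using sl[OF pj(2)] by simp
    finally show "(b * perm_mat n ?w) $$ (p,j) = ?N $$ (p,j)" unfolding adj_swap_involution[OF m(1)] .
  qed (use Nc bc in \<open>auto simp: perm_mat_def\<close>)
  have "?N \<in> grp GL n" by (rule grp_mult[OF g]) (use be borel_sub(3) in blast)
  then have "b \<in> grp GL n" using left_factor_invertible[OF bc perm_mat_carrier] bW by metis
  then have "b \<in> borel GL n" using ub by (simp add: borel_def)
  then show ?thesis using be bW by metis
qed

section \<open>The cell, its closure and the minor that vanishes on them\<close>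

lemma schubert_cellI:
  assumes n: "n > 0" and g: "g \<in> grp t n" and \<beta>: "\<beta> \<in> borel GL n" and b: "b \<in> borel GL n"
    and e: "g * \<beta> = b * perm_mat n w"
  shows "coset t n g \<in> schubert_cell t n w"
proof -
  note gc = grp_carrier[OF g] and bc = borel_carrier[OF b] and \<beta>c = borel_carrier[OF \<beta>]
  obtain c1 where c1: "c1 \<noteq> 0" "c1 \<cdot>\<^sub>m \<beta> \<in> borel t n" using borel_scale[OF \<beta> n] .
  obtain c2 where c2: "c2 \<noteq> 0" "c2 \<cdot>\<^sub>m b \<in> borel t n" using borel_scale[OF b n] .
  have "(c2 \<cdot>\<^sub>m b) * ((c1 / c2) \<cdot>\<^sub>m perm_mat n w) = (c1 / c2) \<cdot>\<^sub>m (c2 \<cdot>\<^sub>m (b * perm_mat n w))"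
    using mult_smult_distrib[of "c2 \<cdot>\<^sub>m b" n n "perm_mat n w" n "c1 / c2"] mult_smult_assoc_mat[OF bc perm_mat_carrier, of c2] bc
    by simp
  also have "\<dots> = c1 \<cdot>\<^sub>m (b * perm_mat n w)" using c2(1) by (intro eq_matI) (auto simp: perm_mat_def)
  also have "\<dots> = g * (c1 \<cdot>\<^sub>m \<beta>)" using e mult_smult_distrib[OF gc \<beta>c, of c1] by simp
  finally have "(c2 \<cdot>\<^sub>m b) * ((c1 / c2) \<cdot>\<^sub>m perm_mat n w) \<in> coset t n g"
    unfolding coset_def using c1(2) by blast
  moreover have "c1 / c2 \<noteq> 0" using c1 c2 by simp
  ultimately show ?thesis unfolding schubert_cell_def using flagI[OF g] c2(2) by blast
qed

lemma schubert_sub_flag: "schubert t n w \<subseteq> flag t n"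
proof -
  have "zclosed t n (flag t n)" unfolding zclosed_def by (auto intro!: exI[of _ "{}"])
  moreover have "schubert_cell t n w \<subseteq> flag t n" unfolding schubert_cell_def by blast
  ultimately show ?thesis unfolding schubert_def zclosure_def by blast
qed

lemma cell_sub_schubert: "schubert_cell t n w \<subseteq> schubert t n w"
  unfolding schubert_def zclosure_def by blast

text \<open>The vanishing of this minor is independent of the representative and polynomial in every
  chart, so it defines a closed set; this set contains the cell and hence its closure.\<close>

lemma schubert_minor_zero:
  assumes i: "0 < i" "i < n" and g: "g \<in> grp t n" and mem: "coset t n g \<in> schubert t n (sw_perm n i)"
  shows "lead_minor (flip_rows n g) (n - i) = 0"
proof -
  define m where "m = n - i"
  have m: "0 < m" "m < n" using i by (auto simp: m_def)
  have n0: "n > 0" using i by simp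
  let ?D = "{coset t n g | g. g \<in> grp t n \<and> lead_minor (flip_rows n g) m = 0}"
  have memD: "coset t n h \<in> ?D \<longleftrightarrow> lead_minor (flip_rows n h) m = 0" if h: "h \<in> grp t n" for h
  proof
    assume "coset t n h \<in> ?D"
    then obtain g where g: "g \<in> grp t n" "lead_minor (flip_rows n g) m = 0" "coset t n h = coset t n g" by blast
    from coset_eqD[OF h g(3)[symmetric]] obtain b where b: "b \<in> borel GL n" "g * b = h" by blast
    show "lead_minor (flip_rows n h) m = 0"
      using flip_minor_borel[OF grp_carrier[OF g(1)] b(1), of m] g(2) b(2) m by simp
  qed (use h in blast)
  have "zclosed t n ?D" unfolding zclosed_def
  proof (intro conjI allI impI)
    show "?D \<subseteq> flag t n" by (auto intro: flagI)
    fix w assume "w permutes {..<n}"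
    let ?p = "\<lambda>z. det (mat m m (\<lambda>(r,c). \<Sum>k<n. perm_mat n w $$ (n-1-r,k) * z (k,c)))"
    have "?p \<in> polyfun"
      by (rule polyfun_det, rule polyfun_sum) (intro polyfun.pmult polyfun.pconst polyfun.pvar)
    moreover have "C \<in> ?D \<longleftrightarrow> ?p (coords u) = 0" if C: "C \<in> flag t n" and u: "in_chart n w C u" for C u
    proof -
      obtain g where g: "g \<in> grp t n" "C = coset t n g" using flagE[OF C] .
      from u obtain b where b: "b \<in> borel GL n" "g * b = perm_mat n w * u" and ul: "u \<in> lower_uni n"
        unfolding g(2) in_chart_iff[OF g(1) n0] by blast
      have uc: "u \<in> carrier_mat n n" using ul by (simp add: lower_uni_def)
      have "?p (coords u) = lead_minor (flip_rows n (perm_mat n w * u)) m"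
        unfolding lead_minor_def
      proof (rule arg_cong[where f = det], rule cong_mat)
        fix r c assume "r < m" "c < m"
        then show "(case (r,c) of (r,c) \<Rightarrow> \<Sum>k<n. perm_mat n w $$ (n-1-r,k) * coords u (k,c)) =
          (case (r,c) of (r,c) \<Rightarrow> flip_rows n (perm_mat n w * u) $$ (r,c))"
          using m mult_index[OF perm_mat_carrier uc, of "n-1-r" c w]
          by (simp add: flip_rows_index coords_def del: index_mult_mat(1))
      qed auto
      then show ?thesis unfolding g(2) memD[OF g(1)]
        using flip_minor_borel[OF grp_carrier[OF g(1)] b(1), of m] b(2) m by simp
    qed
    ultimately show "\<exists>F\<subseteq>polyfun. \<forall>C\<in>flag t n. \<forall>u. in_chart n w C u \<longrightarrow> (C \<in> ?D \<longleftrightarrow> (\<forall>p\<in>F. p (coords u) = 0))"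
      by (intro exI[of _ "{?p}"]) simp
  qed
  moreover have "schubert_cell t n (sw_perm n i) \<subseteq> ?D"
  proof
    fix C assume "C \<in> schubert_cell t n (sw_perm n i)"
    then obtain b c where C: "C \<in> flag t n" and b: "b \<in> borel t n"
      and mem: "b * (c \<cdot>\<^sub>m perm_mat n (sw_perm n i)) \<in> C"
      unfolding schubert_cell_def by blast
    obtain g where g: "g \<in> grp t n" "C = coset t n g" using flagE[OF C] .
    let ?W = "c \<cdot>\<^sub>m perm_mat n (sw_perm n i)"
    from coset_memD mem obtain \<beta> where be: "\<beta> \<in> borel GL n" "g * \<beta> = b * ?W" unfolding g(2) by blast
    note bc = borel_carrier[OF b]
    have ub: "upper_triangular b" using b by (simp add: borel_def)
    \<comment> \<open>Column m-1 of \<open>?W\<close> is a multiple of the unit vector with index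
      i-1, and the upper triangular \<open>b\<close> keeps it within the first i coordinates; so the
      last m = n-i rows have a zero column.\<close>
    have "lead_minor (flip_rows n (b * ?W)) m = 0" unfolding lead_minor_zero_iff
    proof (intro exI[of _ "\<lambda>j. if j = m-1 then 1 else 0"] conjI allI impI)
      show "\<exists>c<m. (if c = m-1 then 1 else 0) \<noteq> (0::complex)" using m by (intro exI[of _ "m-1"]) auto
      fix r assume r: "r < m"
      have w: "sw_perm n i (m-1) = i - 1" using sw_perm_eq[OF i, of "m-1"] m i by (simp add: adj_swap_def m_def)
      have m1: "m-1 < n" using m by simp
      have "(\<Sum>c'<m. flip_rows n (b * ?W) $$ (r,c') * (if c' = m-1 then 1 else 0)) = flip_rows n (b * ?W) $$ (r,m-1)"
        using m by (intro sum_delta_mult) auto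
      also have "\<dots> = (b * ?W) $$ (n-1-r, m-1)" using r m by (simp add: flip_rows_index del: index_mult_mat(1))
      also have "\<dots> = (\<Sum>k<n. b $$ (n-1-r,k) * ?W $$ (k,m-1))" using m r by (intro mult_index bc) auto
      also have "\<dots> = 0"
      proof (rule sum.neutral, rule ballI)
        fix k assume "k \<in> {..<n}"
        then show "b $$ (n-1-r,k) * ?W $$ (k,m-1) = 0"
          using upper_triangularD[OF ub, of k "n-1-r"] bc w m1 r i m_def
          by (cases "k = i - 1") (auto simp: perm_mat_index perm_mat_def)
      qed
      finally show "(\<Sum>c'<m. flip_rows n (b * ?W) $$ (r,c') * (if c' = m-1 then 1 else 0)) = 0" .
    qed
    then have "lead_minor (flip_rows n g) m = 0"
      using flip_minor_borel[OF grp_carrier[OF g(1)] be(1), of m] be(2) m by simp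
    then show "C \<in> ?D" using g by blast
  qed
  ultimately have "coset t n g \<in> ?D" using mem unfolding schubert_def zclosure_def by blast
  then show ?thesis using memD[OF g] by (simp add: m_def)
qed

section \<open>Curves through the base point that run inside the cell\<close>

lemma lu_coord_low_mat:
  assumes "k \<in> low_idx n" shows "lu_coord (low_mat n z) k = z k"
proof -
  have 1: "low_mat n z * 1\<^sub>m n = low_mat n z" by (simp add: right_mult_one_mat[of _ n n])
  then have "low_mat n z = low_mat n (lu_coord (low_mat n z))"
    using LU_coords(1)[OF low_mat_carrier one_borel(1), of n z] by (simp add: low_mat_in_lower_uni)
  from low_mat_eqD[OF this assms] show ?thesis by simp
qed

lemma lead_minor_low_mat: "k \<le> n \<Longrightarrow> lead_minor (low_mat n z) k \<noteq> 0"
  using LU_coords(2)[OF low_mat_carrier one_borel(1), of n z k]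
  by (simp add: low_mat_in_lower_uni right_mult_one_mat[of _ n n])

lemma polyfun_line:
  assumes "p \<in> polyfun" shows "\<exists>q. \<forall>s. p (\<lambda>_. s) = poly q s"
  using assms
proof (induction rule: polyfun.induct)
  case (pconst c) show ?case by (rule exI[of _ "[:c:]"]) simp
next
  case (pvar v) show ?case by (rule exI[of _ "[:0,1:]"]) simp
next
  case (padd p q)
  then obtain a b where "\<forall>s. p (\<lambda>_. s) = poly a s" "\<forall>s. q (\<lambda>_. s) = poly b s" by blast
  then show ?case by (intro exI[of _ "a + b"]) simp
next
  case (pmult p q)
  then obtain a b where "\<forall>s. p (\<lambda>_. s) = poly a s" "\<forall>s. q (\<lambda>_. s) = poly b s" by blast
  then show ?case by (intro exI[of _ "a * b"]) simp
qed

text \<open>One-variable polynomials are encoded over \<open>unit\<close> so that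
  \<open>polyfun_det\<close> applies; the passage to \<open>poly\<close> gives access to finiteness
  of roots.\<close>

lemma lead_minor_flip_poly:
  assumes "\<And>r c. (\<lambda>z :: unit \<Rightarrow> complex. E r c (z ())) \<in> polyfun" "k \<le> n"
  shows "\<exists>q. \<forall>s. lead_minor (flip_rows n (mat n n (\<lambda>(r,c). E r c s))) k = poly q s"
proof -
  have "(\<lambda>z :: unit \<Rightarrow> complex. det (mat k k (\<lambda>(r,c). E (n-1-r) c (z ())))) \<in> polyfun"
    by (rule polyfun_det) (rule assms(1))
  moreover have "lead_minor (flip_rows n (mat n n (\<lambda>(r,c). E r c s))) k = det (mat k k (\<lambda>(r,c). E (n-1-r) c s))" for s
    unfolding lead_minor_def using assms(2) by (intro arg_cong[where f = det] cong_mat) (auto simp: flip_rows_index)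
  ultimately show ?thesis using polyfun_line by metis
qed

text \<open>A polynomial path through the identity with velocity V that stays in the divisor: column c of the inner
  factor 1 + sV + s^2 P T lies in the span of the first i basis vectors, and the outer factor 1 + s^2 T mixes it
  with column m - 1, so that the leading coefficient in s is the permutation matrix P itself. The parameter r
  homogenises the path.\<close>
definition path_inner :: "nat \<Rightarrow> nat \<Rightarrow> nat \<Rightarrow> (nat \<Rightarrow> nat \<Rightarrow> complex) \<Rightarrow> complex \<Rightarrow> complex \<Rightarrow> nat \<Rightarrow> nat \<Rightarrow> complex" where
  "path_inner n i c V r s p j = r * r * (if p = j then 1 else 0) + r * s * V p j +
     s * s * (if p = sw_perm n i (transpose c (n-i-1) j) then 1 else 0)"

definition path_entry :: "nat \<Rightarrow> nat \<Rightarrow> nat \<Rightarrow> (nat \<Rightarrow> nat \<Rightarrow> complex) \<Rightarrow> complex \<Rightarrow> complex \<Rightarrow> nat \<Rightarrow> nat \<Rightarrow> complex" where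
  "path_entry n i c V r s p j = r * r * path_inner n i c V r s p j + s * s * path_inner n i c V r s p (transpose c (n-i-1) j)"

definition path_mat :: "nat \<Rightarrow> nat \<Rightarrow> nat \<Rightarrow> (nat \<Rightarrow> nat \<Rightarrow> complex) \<Rightarrow> complex \<Rightarrow> complex \<Rightarrow> complex mat" where
  "path_mat n i c V r s = mat n n (\<lambda>(p,j). path_entry n i c V r s p j)"

lemma path_mat_carrier [simp]: "path_mat n i c V r s \<in> carrier_mat n n"
  by (simp add: path_mat_def)

text \<open>For c other than n-i-1, column c minus s^2 times column n-i-1 of the path is (1 - s^4)
  times column c of the inner factor. Rows i and below of the latter are zero, so the coefficients
  form a kernel vector.\<close>

lemma path_minor_zero:
  assumes i: "0 < i" "i < n" and c: "c < i" "c < n - i" and V: "\<And>p. V p c = 0"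
  shows "lead_minor (flip_rows n (path_mat n i c V 1 s)) (n - i) = 0"
proof -
  define m where "m = n - i"
  have m: "0 < m" "m < n" using i by (auto simp: m_def)
  let ?h = "path_inner n i c V 1 s"
  have h: "?h p c = 0" if p: "i \<le> p" for p
  proof -
    have "sw_perm n i (m-1) = i - 1" using sw_perm_eq[OF i, of "m-1"] m i by (simp add: adj_swap_def m_def)
    then have "sw_perm n i (transpose c (n-i-1) c) = i - 1" by (simp add: m_def)
    then show ?thesis using p c i V unfolding path_inner_def by auto
  qed
  let ?G = "flip_rows n (path_mat n i c V 1 s)"
  have G: "?G $$ (r,j) = path_entry n i c V 1 s (n-1-r) j" if "r < m" "j < m" for r j
    using that m by (simp add: flip_rows_index path_mat_def)
  \<comment> \<open>For c = n-i-1 the transposition is trivial and column c alone is a multiple of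
    the inner column, hence the coefficient 0.\<close>
  let ?a = "\<lambda>j. (if j = c then 1 else 0) - (if c = m-1 then 0 else s * s) * (if j = m-1 then 1 else 0)"
  show ?thesis unfolding m_def[symmetric] lead_minor_zero_iff
  proof (intro exI[of _ ?a] conjI allI impI)
    show "\<exists>j<m. ?a j \<noteq> 0" using c m by (intro exI[of _ c]) (auto simp: m_def)
    fix r assume r: "r < m"
    have "(\<Sum>j<m. ?G $$ (r,j) * ?a j) = (\<Sum>j<m. ?G $$ (r,j) * (if j = c then 1 else 0)) -
       (if c = m-1 then 0 else s * s) * (\<Sum>j<m. ?G $$ (r,j) * (if j = m-1 then 1 else 0))"
      by (simp only: right_diff_distrib sum_subtractf sum_distrib_left mult.left_commute)
    also have "\<dots> = ?G $$ (r,c) - (if c = m-1 then 0 else s * s) * ?G $$ (r,m-1)"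
      using c m by (subst (1 2) sum_delta_mult(2)) (auto simp: m_def)
    also have "\<dots> = 0"
    proof -
      have p: "?h (n-1-r) c = 0" by (rule h) (use r i in \<open>auto simp: m_def\<close>)
      have e1: "?G $$ (r,c) = ?h (n-1-r) c + s * s * ?h (n-1-r) (m-1)"
        using G[of r c] r c by (simp add: path_entry_def m_def)
      have e2: "?G $$ (r,m-1) = ?h (n-1-r) (m-1) + s * s * ?h (n-1-r) c"
        using G[of r "m-1"] r m by (simp add: path_entry_def m_def)
      show ?thesis using e1 e2 p by (cases "c = m - 1") auto
    qed
    finally show "(\<Sum>j<m. ?G $$ (r,j) * ?a j) = 0" .
  qed
qed

lemma path_homogeneous:
  assumes "r \<noteq> 0"
  shows "path_mat n i c V r 1 = (r ^ 4) \<cdot>\<^sub>m path_mat n i c V 1 (1 / r)"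
proof -
  have "path_inner n i c V r 1 p j = r ^ 2 * path_inner n i c V 1 (1 / r) p j" for p j
    using assms unfolding path_inner_def by (simp add: field_simps power2_eq_square)
  then have "path_entry n i c V r 1 p j = r ^ 4 * path_entry n i c V 1 (1 / r) p j" for p j
    using assms unfolding path_entry_def by (simp add: field_simps power2_eq_square power4_eq_xxxx)
  then show ?thesis by (intro eq_matI) (auto simp: path_mat_def)
qed

lemma path_entry_polyfun:
  "(\<lambda>z :: unit \<Rightarrow> complex. path_entry n i c V (z ()) s p j) \<in> polyfun"
  "(\<lambda>z :: unit \<Rightarrow> complex. path_entry n i c V r (z ()) p j) \<in> polyfun"
  unfolding path_entry_def path_inner_def
  by (intro polyfun.padd polyfun.pmult polyfun.pvar polyfun.pconst)+

text \<open>The minor is a polynomial in s. If it were identically 0, homogeneity of degree 4 would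
  make it vanish at s = 1 for all nonzero r, and by continuity at r = 0, where the path is the
  permutation matrix with nonzero minor. Its roots are therefore isolated.\<close>

lemma path_minor_nonzero:
  assumes i: "0 < i" "i < n" and k: "k \<le> n" "k \<noteq> n - i"
  shows "eventually (\<lambda>s. lead_minor (flip_rows n (path_mat n i c V 1 s)) k \<noteq> 0) (at 0)"
proof -
  obtain q where q: "\<And>s. lead_minor (flip_rows n (path_mat n i c V 1 s)) k = poly q s"
    using lead_minor_flip_poly[of "\<lambda>p j s. path_entry n i c V 1 s p j", OF path_entry_polyfun(2) k(1)]
    unfolding path_mat_def by blast
  obtain q' where q': "\<And>r. lead_minor (flip_rows n (path_mat n i c V r 1)) k = poly q' r"
    using lead_minor_flip_poly[of "\<lambda>p j r. path_entry n i c V r 1 p j", OF path_entry_polyfun(1) k(1)]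
    unfolding path_mat_def by blast
  have "q \<noteq> 0"
  proof
    assume "q = 0"
    have "poly q' r = 0" if r: "r \<noteq> 0" for r
    proof -
      have "flip_rows n (path_mat n i c V r 1) = (r ^ 4) \<cdot>\<^sub>m flip_rows n (path_mat n i c V 1 (1 / r))"
        unfolding path_homogeneous[OF r] by (rule eq_matI) (auto simp: flip_rows_def path_mat_def)
      then have "lead_minor (flip_rows n (path_mat n i c V r 1)) k = (r ^ 4) ^ k * lead_minor (flip_rows n (path_mat n i c V 1 (1 / r))) k"
      proof -
        have "mat k k (\<lambda>(p,j). ((r ^ 4) \<cdot>\<^sub>m flip_rows n (path_mat n i c V 1 (1 / r))) $$ (p,j)) =
           (r ^ 4) \<cdot>\<^sub>m mat k k (\<lambda>(p,j). flip_rows n (path_mat n i c V 1 (1 / r)) $$ (p,j))"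
          using k by (intro eq_matI) (auto simp: flip_rows_def)
        then show ?thesis unfolding lead_minor_def \<open>flip_rows n (path_mat n i c V r 1) = _\<close> by simp
      qed
      then show ?thesis using q[of "1 / r"] q'[of r] \<open>q = 0\<close> by simp
    qed
    then have "eventually (\<lambda>r. poly q' r = 0) (at 0)" by (auto simp: eventually_at_filter)
    then have "((\<lambda>r. poly q' r) \<longlongrightarrow> 0) (at 0)" by (rule tendsto_eventually)
    moreover have "((\<lambda>r. poly q' r) \<longlongrightarrow> poly q' 0) (at 0)" using poly_isCont[of 0 q'] by (simp add: isCont_def)
    ultimately have "poly q' 0 = 0" by (rule tendsto_unique[OF at_neq_bot, rotated])
    moreover have "path_mat n i c V 0 1 = perm_mat n (sw_perm n i)"
      by (rule eq_matI) (auto simp: path_mat_def perm_mat_def path_entry_def path_inner_def)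
    ultimately show False using q'[of 0] sw_perm_minor_nonzero[OF i k] by simp
  qed
  then have fin: "finite {s. poly q s = 0}" by (rule poly_roots_finite)
  have "eventually (\<lambda>s. s \<notin> {s. poly q s = 0} - {0}) (nhds 0)"
    using fin by (intro open_Compl[THEN eventually_nhds_in_open, unfolded Compl_iff] finite_imp_closed) auto
  then have "eventually (\<lambda>s. poly q s \<noteq> 0) (at 0)"
    unfolding eventually_at_filter by (rule eventually_mono) auto
  then show ?thesis by (simp add: q)
qed

lemma smooth_at_lu_entries:
  assumes "k \<in> low_idx n"
  shows "smooth_at (\<lambda>e. lu_coord (mat n n (\<lambda>(i,j). e (i,j))) k) (\<lambda>(i,j). if i < n \<and> i = j then 1 else 0)"
proof -
  obtain p q where k: "k = (p,q)" by (cases k)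
  have q: "Suc q \<le> n" using assms k by (auto simp: low_idx_def)
  have "mat n n (\<lambda>(i,j). case (i,j) of (i,j) \<Rightarrow> if i < n \<and> i = j then 1 else 0) = low_mat n (\<lambda>_. 0)"
    by (rule eq_matI) (auto simp: low_mat_def)
  then have "lead_minor (mat n n (\<lambda>(i,j). case (i,j) of (i,j) \<Rightarrow> if i < n \<and> i = j then 1 else 0)) (Suc q) \<noteq> 0"
    using lead_minor_low_mat[OF q] by simp
  then show ?thesis unfolding k
    by (intro smooth_at_lu_coord[where F = "\<lambda>i j e. e (i,j)"] smooth_at_var) (use assms k in auto)
qed

text \<open>The curve consists of the triangular coordinates of the path. For small nonzero s
  exactly the minor of size n-i vanishes among the reversed ones, so the flags lie in the cell; the
  base point is reached as a limit.\<close>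

lemma schubert_curve_exists:
  assumes i: "0 < i" "i < n" and c: "c < i" "c < n - i" and v: "\<And>p. v (p,c) = 0"
  shows "\<exists>z. curve_in t n (schubert t n (sw_perm n i)) (1\<^sub>m n) v z" "coset t n (1\<^sub>m n) \<in> schubert t n (sw_perm n i)"
proof -
  let ?S = "schubert t n (sw_perm n i)"
  let ?G = "path_mat n i c (low_ext n v) 1"
  have n0: "n > 0" using i by simp
  define z where "z k s = (if k \<in> low_idx n then lu_coord (?G s) k else 0)" for k s
  let ?e0 = "\<lambda>(i,j). if i < n \<and> i = j then 1 else (0::complex)"
  define e1 where "e1 = (\<lambda>(p,j) s. if p < n \<and> j < n then path_entry n i c (low_ext n v) 1 s p j else 0)"
  \<comment> \<open>A comparison path with the value and velocity of \<open>e1\<close> at 0 and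
    known coordinates \<open>s * v k\<close>: it reveals the derivative of \<open>lu_coord\<close>
    at the identity without computing it.\<close>
  define e2 where "e2 = (\<lambda>(p,j) s. if p < n \<and> j < n then low_mat n (\<lambda>k. s * v k) $$ (p,j) else 0)"
  let ?e' = "\<lambda>(p,j). low_ext n v p j"
  have e10: "e1 k 0 = ?e0 k" for k
    by (cases k) (auto simp: e1_def path_entry_def path_inner_def)
  have e20: "e2 k 0 = ?e0 k" for k
    by (cases k) (auto simp: e2_def low_mat_index)
  have e1d: "(e1 k has_field_derivative ?e' k) (at 0)" for k
  proof -
    obtain p j where k: "k = (p,j)" by (cases k)
    show ?thesis
    proof (cases "p < n \<and> j < n")
      case True
      have "((\<lambda>s. path_entry n i c (low_ext n v) 1 s p j) has_field_derivative low_ext n v p j) (at 0)"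
        unfolding path_entry_def path_inner_def by (auto intro!: derivative_eq_intros)
      then show ?thesis using True by (simp add: k e1_def)
    next
      case False
      then show ?thesis by (auto simp: k e1_def low_ext_def low_idx_def)
    qed
  qed
  have tc2: "tangent_curve n (\<lambda>k s. if k \<in> low_idx n then s * v k else 0) v"
    unfolding tangent_curve_def by (auto intro!: derivative_eq_intros)
  have e2d: "(e2 k has_field_derivative ?e' k) (at 0)" for k
  proof -
    obtain p j where k: "k = (p,j)" by (cases k)
    show ?thesis
    proof (cases "p < n \<and> j < n")
      case True
      have "low_mat n (\<lambda>k. s * v k) = low_mat n (\<lambda>k. if k \<in> low_idx n then s * v k else 0)" for s
        by (rule low_mat_cong) simp
      then show ?thesis using True low_mat_deriv[OF tc2, of p j] by (simp add: k e2_def)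
    next
      case False
      then show ?thesis by (auto simp: k e2_def low_ext_def low_idx_def)
    qed
  qed
  have m1: "mat n n (\<lambda>(p,j). e1 (p,j) s) = ?G s" for s
    by (rule eq_matI) (auto simp: e1_def path_mat_def)
  have m2: "mat n n (\<lambda>(p,j). e2 (p,j) s) = low_mat n (\<lambda>k. s * v k)" for s
    by (rule eq_matI) (auto simp: e2_def)
  have G0: "?G 0 = 1\<^sub>m n"
    by (rule eq_matI) (auto simp: path_mat_def path_entry_def path_inner_def)
  have zd: "(z k has_field_derivative v k) (at 0)" if k: "k \<in> low_idx n" for k
  proof -
    let ?F = "\<lambda>e. lu_coord (mat n n (\<lambda>(i,j). e (i,j))) k"
    from smooth_at_lu_entries[OF k] obtain S d where d: "\<And>z z'. (\<And>k. z k 0 = ?e0 k) \<Longrightarrow>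
      (\<And>k. (z k has_field_derivative z' k) (at 0)) \<Longrightarrow>
      ((\<lambda>s. ?F (\<lambda>k. z k s)) has_field_derivative (\<Sum>k\<in>S. d k * z' k)) (at 0)"
      unfolding smooth_at_def by blast
    have 1: "((\<lambda>s. lu_coord (?G s) k) has_field_derivative (\<Sum>k\<in>S. d k * ?e' k)) (at 0)"
      using d[of e1 ?e', OF e10 e1d] unfolding m1 .
    have "((\<lambda>s. lu_coord (low_mat n (\<lambda>k. s * v k)) k) has_field_derivative (\<Sum>k\<in>S. d k * ?e' k)) (at 0)"
      using d[of e2 ?e', OF e20 e2d] unfolding m2 .
    then have "((\<lambda>s. s * v k) has_field_derivative (\<Sum>k\<in>S. d k * ?e' k)) (at 0)"
      by (simp add: lu_coord_low_mat[OF k])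
    moreover have "((\<lambda>s. s * v k) has_field_derivative v k) (at 0)" by (auto intro!: derivative_eq_intros)
    ultimately have "(\<Sum>k\<in>S. d k * ?e' k) = v k" by (rule DERIV_unique)
    then show ?thesis using 1 k by (simp add: z_def[abs_def])
  qed
  have tc: "tangent_curve n z v"
    unfolding tangent_curve_def
  proof (intro conjI allI impI ballI)
    show "z k 0 = 0" for k
      using lu_coord_low_mat[of k n "\<lambda>_. 0"] by (simp add: z_def G0 low_mat_zero)
    show "z k = (\<lambda>_. 0)" if "k \<notin> low_idx n" for k using that by (auto simp: z_def)
  qed (rule zd)
  have ev1: "eventually (\<lambda>s. \<forall>k\<in>{..n}. lead_minor (?G s) k \<noteq> 0) (at 0)"
  proof (rule eventually_ball_finite, simp, rule ballI)
    fix k assume "k \<in> {..n}"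
    then have k: "k \<le> n" by simp
    have sm: "smooth_at (\<lambda>e. lead_minor (mat n n (\<lambda>(i,j). e (i,j))) k) ?e0"
      by (rule smooth_at_lead_minor[where F = "\<lambda>i j e. e (i,j)"]) (use k smooth_at_var in auto)
    have "mat n n (\<lambda>(i,j). ?e0 (i,j)) = low_mat n (\<lambda>_. 0)"
      by (rule eq_matI) (auto simp: low_mat_def)
    then have "lead_minor (mat n n (\<lambda>(i,j). ?e0 (i,j))) k \<noteq> 0" using lead_minor_low_mat[OF k] by simp
    then have "eventually (\<lambda>s. lead_minor (mat n n (\<lambda>(i,j). e1 (i,j) s)) k \<noteq> 0) (nhds 0)"
      by (rule smooth_at_eventually_nonzero[OF sm, where z = e1 and z' = ?e', OF _ e10 e1d])
    then show "eventually (\<lambda>s. lead_minor (?G s) k \<noteq> 0) (at 0)"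
      unfolding m1 eventually_nhds_conv_at by blast
  qed
  have ev2: "eventually (\<lambda>s. \<forall>k\<in>{..n} - {n-i}. lead_minor (flip_rows n (?G s)) k \<noteq> 0) (at 0)"
    by (rule eventually_ball_finite) (use path_minor_nonzero[OF i] in auto)
  have cell: "eventually (\<lambda>s. coset t n (low_mat n (\<lambda>k. z k s)) \<in> schubert_cell t n (sw_perm n i)) (at 0)"
    using ev1 ev2
  proof eventually_elim
    case (elim s)
    have "mat n n (\<lambda>(r,c). ?G s $$ (r,c)) = ?G s" by (rule eq_matI) (auto simp: path_mat_def)
    then have gr: "?G s \<in> grp GL n" using elim(1) unfolding grp_GL_iff lead_minor_def by force
    obtain b where b: "b \<in> borel GL n" "?G s * b = low_mat n (lu_coord (?G s))"
      using LU_decomposition[OF path_mat_carrier] elim(1) by blast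
    have lz: "low_mat n (lu_coord (?G s)) = low_mat n (\<lambda>k. z k s)" by (rule low_mat_cong) (simp add: z_def)
    have "lead_minor (flip_rows n (?G s)) (n - i) = 0"
      by (rule path_minor_zero[OF i c]) (simp add: low_ext_def v)
    then obtain \<beta> b' where bb: "\<beta> \<in> borel GL n" "b' \<in> borel GL n" "?G s * \<beta> = b' * perm_mat n (sw_perm n i)"
      using bruhat_cell_criterion[OF i gr] elim(2) by (metis Diff_iff atMost_iff singletonD)
    obtain bi where bi: "bi \<in> borel GL n" "b * bi = 1\<^sub>m n" using borel_inverse[OF b(1)] by blast
    note cs = borel_carrier[OF b(1)] borel_carrier[OF bi(1)] borel_carrier[OF bb(1)]
    have "low_mat n (\<lambda>k. z k s) * (bi * \<beta>) = ?G s * (b * (bi * \<beta>))"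
      unfolding lz[symmetric] b(2)[symmetric] by (rule assoc_mult_mat[OF path_mat_carrier cs(1) mult_carrier_mat[OF cs(2,3)]])
    also have "b * (bi * \<beta>) = \<beta>" by (rule left_inverse_cancel[OF cs bi(2)])
    finally have "low_mat n (\<lambda>k. z k s) * (bi * \<beta>) = b' * perm_mat n (sw_perm n i)" using bb(3) by simp
    then show ?case by (rule schubert_cellI[OF n0 low_mat_grp borel_mult[OF bi(1) bb(1)] bb(2)])
  qed
  have z0: "low_mat n (\<lambda>k. z k 0) = 1\<^sub>m n" using tangent_curve_zero[OF tc] by (simp add: low_mat_zero)
  have idc: "in_chart n id (coset t n (low_mat n y)) (low_mat n y)" for y
  proof -
    have "perm_mat n id = 1\<^sub>m n" by (rule eq_matI) (auto simp: perm_mat_def)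
    then show ?thesis unfolding in_chart_iff[OF low_mat_grp n0]
      using one_borel(1)[of n GL] low_mat_in_lower_uni by (intro conjI bexI[of _ "1\<^sub>m n"]) (auto simp: right_mult_one_mat[of _ n n] left_mult_one_mat[of _ n n])
  qed
  show base: "coset t n (1\<^sub>m n) \<in> ?S"
    unfolding schubert_def zclosure_def
  proof (rule InterI, clarify)
    fix S assume S: "zclosed t n S" and sub: "schubert_cell t n (sw_perm n i) \<subseteq> S"
    from S[unfolded zclosed_def, THEN conjunct2, THEN spec, THEN mp, OF permutes_id]
    obtain F where F: "F \<subseteq> polyfun" and
      Fc': "\<forall>C\<in>flag t n. \<forall>u. in_chart n id C u \<longrightarrow> (C \<in> S \<longleftrightarrow> (\<forall>p\<in>F. p (coords u) = 0))"
      by (elim exE conjE)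
    have Fc: "C \<in> S \<longleftrightarrow> (\<forall>p\<in>F. p (coords u) = 0)" if "C \<in> flag t n" "in_chart n id C u" for C u
      using Fc'[THEN bspec, OF that(1), THEN spec, THEN mp, OF that(2)] .
    \<comment> \<open>An equation of \<open>S\<close> in the identity chart vanishes along the curve
      for small nonzero s and is continuous there, so it also vanishes at s = 0.\<close>
    have "p (coords (low_mat n (\<lambda>k. z k 0))) = 0" if p: "p \<in> F" for p
    proof -
      let ?f = "\<lambda>s. p (coords (low_mat n (\<lambda>k. z k s)))"
      have "smooth_at (\<lambda>y. p (\<lambda>k. coords (low_mat n y) k)) (\<lambda>_. 0)"
        by (rule smooth_at_comp[OF polyfun_smooth_at smooth_at_coords_low_mat]) (use p F in blast)
      from smooth_at_tangent[OF this, of n] tc have "\<exists>D. (?f has_field_derivative D) (at 0)" by blast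
      then have lim: "(?f \<longlongrightarrow> ?f 0) (at 0)" using DERIV_isCont isCont_def by blast
      have "eventually (\<lambda>s. ?f s = 0) (at 0)"
        using cell
      proof eventually_elim
        case (elim s)
        then show ?case using Fc[OF flagI[OF low_mat_grp] idc, of "\<lambda>k. z k s"] sub p by blast
      qed
      then have "(?f \<longlongrightarrow> 0) (at 0)" by (rule tendsto_eventually)
      with lim show ?thesis by (rule tendsto_unique[OF at_neq_bot])
    qed
    then have "coset t n (low_mat n (\<lambda>k. z k 0)) \<in> S" using Fc[OF flagI[OF low_mat_grp] idc] by blast
    then show "coset t n (1\<^sub>m n) \<in> S" by (simp add: z0)
  qed
  have "eventually (\<lambda>s. coset t n (low_mat n (\<lambda>k. z k s)) \<in> ?S) (nhds 0)"
    unfolding eventually_nhds_conv_at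
  proof
    show "eventually (\<lambda>s. coset t n (low_mat n (\<lambda>k. z k s)) \<in> ?S) (at 0)"
      using cell by (rule eventually_mono) (use cell_sub_schubert in blast)
    show "coset t n (low_mat n (\<lambda>k. z k 0)) \<in> ?S" using base by (simp add: z0)
  qed
  then show "\<exists>z. curve_in t n ?S (1\<^sub>m n) v z"
    using tc unfolding curve_in_def by (intro exI[of _ z]) (simp add: left_mult_one_mat[of _ n n])
qed

section \<open>Comparison\<close>

text \<open>With m = n-i, the vanishing minor is, up to a power of \<open>c0\<close>, that of rows
  0..m-2 and m of the unitriangular matrix. This block is lower triangular with diagonal 1, ..., 1,
  y(m,m-1).\<close>

lemma schubert_local_coord:
  assumes i: "0 < i" "i < n" and b: "b = c0 \<cdot>\<^sub>m perm_mat n (sw_perm n i)" "b \<in> grp t n" "c0 \<noteq> 0"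
    and mem: "coset t n (b * low_mat n y) \<in> schubert t n (sw_perm n i)"
  shows "y (n-i, n-i-1) = 0"
proof -
  define m where "m = n - i"
  have m: "0 < m" "m < n" using i by (auto simp: m_def)
  let ?W = "perm_mat n (sw_perm n i)" and ?U = "low_mat n y"
  have ss: "adj_swap m r < n" if "r < n" for r using adj_swap_less[OF m(1) that] m by simp
  have ent: "flip_rows n (b * ?U) $$ (r,c) = c0 * ?U $$ (adj_swap m r, c)" if rc: "r < m" "c < m" for r c
  proof -
    have rn: "r < n" "c < n" "n - 1 - r < n" using rc m by auto
    have bk: "b $$ (n-1-r,k) = (if k = adj_swap m r then c0 else 0)" if k: "k < n" for k
    proof -
      have "n - 1 - r = n - 1 - adj_swap m k \<longleftrightarrow> r = adj_swap m k" using ss[OF k] rn by auto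
      also have "\<dots> \<longleftrightarrow> k = adj_swap m r" using adj_swap_involution[OF m(1)] by metis
      finally show ?thesis using sw_perm_eq[OF i k] rn k by (simp add: b(1) perm_mat_def m_def)
    qed
    have "flip_rows n (b * ?U) $$ (r,c) = (\<Sum>k<n. b $$ (n-1-r,k) * ?U $$ (k,c))"
      unfolding flip_rows_index[OF rn(1,2)] using rn by (intro mult_index grp_carrier[OF b(2)]) auto
    also have "\<dots> = (\<Sum>k<n. if k = adj_swap m r then c0 * ?U $$ (adj_swap m r, c) else 0)"
      using bk by (intro sum.cong) auto
    also have "\<dots> = c0 * ?U $$ (adj_swap m r, c)" using ss[OF rn(1)] by simp
    finally show ?thesis .
  qed
  have "lead_minor (flip_rows n (b * ?U)) m = 0"
    unfolding m_def by (rule schubert_minor_zero[OF i grp_mult[OF b(2) low_mat_grp] mem])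
  then obtain a c where c: "c < m" "a c \<noteq> 0"
    and a: "\<And>r. r < m \<Longrightarrow> (\<Sum>c<m. flip_rows n (b * ?U) $$ (r,c) * a c) = 0"
    unfolding lead_minor_zero_iff by blast
  have row: "(\<Sum>c<m. ?U $$ (adj_swap m r, c) * a c) = 0" if r: "r < m" for r
  proof -
    have "(\<Sum>c<m. flip_rows n (b * ?U) $$ (r,c) * a c) = c0 * (\<Sum>c<m. ?U $$ (adj_swap m r, c) * a c)"
      unfolding sum_distrib_left using ent[OF r] by (intro sum.cong) (auto simp: mult.assoc)
    then show ?thesis using a[OF r] b(3) by simp
  qed
  have a0: "a r = 0" if "r < m - 1" for r
    using that
  proof (induction r rule: less_induct)
    case (less r)
    have "0 = (\<Sum>c<m. ?U $$ (r, c) * a c)" using row[of r] less.prems by (simp add: adj_swap_def)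
    also have "\<dots> = (\<Sum>c<m. if c = r then a r else 0)"
    proof (rule sum.cong[OF refl])
      fix c assume "c \<in> {..<m}"
      then show "?U $$ (r,c) * a c = (if c = r then a r else 0)"
        using less m by (auto simp: low_mat_index)
    qed
    also have "\<dots> = a r" using less.prems by simp
    finally show ?case by simp
  qed
  have "0 = (\<Sum>c<m. ?U $$ (m, c) * a c)" using row[of "m-1"] m by (simp add: adj_swap_def)
  also have "\<dots> = (\<Sum>c<m. if c = m-1 then ?U $$ (m,m-1) * a (m-1) else 0)"
    using a0 by (intro sum.cong) auto
  also have "\<dots> = y (m,m-1) * a (m-1)" using m by (simp add: low_mat_index)
  finally have "y (m,m-1) * a (m-1) = 0" by simp
  moreover have "a (m-1) \<noteq> 0" using c a0[of c] by (cases "c = m-1") auto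
  ultimately show ?thesis by (simp add: m_def)
qed

lemma sum_unit_at:
  "k \<in> low_idx n \<Longrightarrow> (\<Sum>l\<in>low_idx n. c l * unit_at k l) = c k"
  using finite_low_idx[of n] by (simp add: unit_at_def if_distrib[of "\<lambda>x. _ * x"] cong: if_cong)

text \<open>Every velocity occurs in the flag variety, whereas image velocities at the fixed point
  have coordinate (n-i, n-i-1) equal to 0. The Jacobian would then have a zero row, against its
  invertibility.\<close>

lemma flag_not_iso_schubert:
  assumes i: "0 < i" "i < n"
  shows "\<not> iso_var t n (flag t n) (schubert t n (sw_perm n i))"
proof
  let ?S = "schubert t n (sw_perm n i)" and ?W = "perm_mat n (sw_perm n i)"
  assume "iso_var t n (flag t n) ?S"
  then obtain f g where f: "morphism t n (flag t n) ?S f" and g: "morphism t n ?S (flag t n) g"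
    and gf': "\<forall>C\<in>flag t n. g (f C) = C" and fg': "\<forall>D\<in>?S. f (g D) = D"
    unfolding iso_var_def by (elim exE conjE)
  note gf = bspec[OF gf'] and fg = bspec[OF fg']
  have n0: "n > 0" using i by simp
  obtain c0 where c0: "c0 \<noteq> 0" "c0 \<cdot>\<^sub>m ?W \<in> grp t n" using grp_scale[OF sw_perm_mat_grp[OF i] n0] .
  let ?b = "c0 \<cdot>\<^sub>m ?W"
  have "1\<^sub>m n * ?b \<in> coset t n ?b" using coset_self[OF c0(2)] left_mult_one_mat[OF grp_carrier[OF c0(2)]] by simp
  then have "coset t n ?b \<in> schubert_cell t n (sw_perm n i)"
    unfolding schubert_cell_def using flagI[OF c0(2)] one_borel(1)[of n t] c0(1) by blast
  then have bS: "coset t n ?b \<in> ?S" using cell_sub_schubert by blast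
  then have "g (coset t n ?b) \<in> flag t n" using g unfolding morphism_def by blast
  then obtain a where a: "a \<in> grp t n" "g (coset t n ?b) = coset t n a" by (rule flagE)
  have fa: "f (coset t n a) = coset t n ?b" using fg[OF bS] a(2) by simp
  have cur: "\<exists>z. curve_in t n (flag t n) a (unit_at k) z" for k
  proof -
    have "tangent_curve n (\<lambda>l s. if l \<in> low_idx n then s * unit_at k l else 0) (unit_at k)"
      unfolding tangent_curve_def by (auto intro!: derivative_eq_intros)
    moreover have "coset t n (a * low_mat n y) \<in> flag t n" for y
      by (rule flagI[OF grp_mult[OF a(1) low_mat_grp]])
    ultimately show ?thesis unfolding curve_in_def by (intro exI conjI always_eventually allI)
  qed
  obtain c d where cd: "\<And>i j. i \<in> low_idx n \<Longrightarrow> j \<in> low_idx n \<Longrightarrow> (\<Sum>k\<in>low_idx n. c i k * d k j) = (if i = j then 1 else 0)"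
    and lift: "\<And>z v. curve_in t n (flag t n) a v z \<Longrightarrow> \<exists>y. curve_in t n ?S ?b (\<lambda>k. \<Sum>l\<in>low_idx n. c k l * v l) y"
    using iso_differential[OF n0 f g gf subset_refl schubert_sub_flag a(1) c0(2) flagI[OF a(1)] fa cur] by blast
  let ?\<kappa> = "(n-i, n-i-1)"
  have k: "?\<kappa> \<in> low_idx n" using i by (auto simp: low_idx_def)
  have "c ?\<kappa> j = 0" if j: "j \<in> low_idx n" for j
  proof -
    obtain z where "curve_in t n (flag t n) a (unit_at j) z" using cur by blast
    from lift[OF this] obtain y where y: "curve_in t n ?S ?b (\<lambda>k. c k j) y"
      unfolding sum_unit_at[OF j] by blast
    have "eventually (\<lambda>s. coset t n (?b * low_mat n (\<lambda>k. y k s)) \<in> ?S) (nhds 0)"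
      using y by (simp add: curve_in_def)
    then have "eventually (\<lambda>s. y ?\<kappa> s = 0) (nhds 0)"
      by (rule eventually_mono) (rule schubert_local_coord[OF i refl c0(2,1)])
    moreover have "(y ?\<kappa> has_field_derivative c ?\<kappa> j) (at 0)"
      using y k unfolding curve_in_def tangent_curve_def by blast
    ultimately have "((\<lambda>_. 0) has_field_derivative c ?\<kappa> j) (at 0)"
      using DERIV_cong_ev[OF refl _ refl, of "y ?\<kappa>" "\<lambda>_. 0" 0 "c ?\<kappa> j"] by blast
    then show ?thesis using DERIV_const DERIV_unique by blast
  qed
  then show False using cd[OF k k] by simp
qed

text \<open>The inverse isomorphism is the one to differentiate, since curves are supplied in the
  divisor. The conclusion that \<open>x\<close> is scalar makes the nonempty B(x,H) the whole flag
  variety, against \<open>nf\<close>.\<close>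

lemma hess_not_full_not_iso_schubert:
  assumes i: "3 \<le> i" "i + 3 \<le> n" and x: "x \<in> lie_alg t n" and H: "lie_subspace t n H" "b_stable t n H"
    and nf: "hess t n x H \<noteq> flag t n"
  shows "\<not> iso_var t n (hess t n x H) (schubert t n (sw_perm n i))"
proof
  let ?S = "schubert t n (sw_perm n i)" and ?X = "hess t n x H"
  assume "iso_var t n ?X ?S"
  then obtain f g where f: "morphism t n ?X ?S f" and g: "morphism t n ?S ?X g"
    and fg': "\<forall>D\<in>?S. f (g D) = D"
    unfolding iso_var_def by (elim exE conjE)
  note fg = bspec[OF fg']
  have i': "0 < i" "i < n" and n: "n \<ge> 3" "n \<ge> 2" "n > 0" using i by auto
  have xc: "x \<in> carrier_mat n n" using x by (simp add: lie_alg_def)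
  \<comment> \<open>The columns 0, 1, 2 all lie below min(i, n - i), and two matrix units occupy at
    most two of them.\<close>
  have col: "\<exists>c. c < i \<and> c < n - i \<and> c \<noteq> p \<and> c \<noteq> q" for p q
  proof -
    have "\<exists>c\<in>{0,1,2::nat}. c \<noteq> p \<and> c \<noteq> q" by auto
    then obtain c where c: "c \<in> {0,1,2::nat}" "c \<noteq> p" "c \<noteq> q" by blast
    then have "c < 3" by auto
    then show ?thesis using i c(2,3) by (intro exI[of _ c]) auto
  qed
  have cur2: "\<exists>z. curve_in t n ?S (1\<^sub>m n) (\<lambda>m. unit_at k m + unit_at l m) z"
    and cur: "\<exists>z. curve_in t n ?S (1\<^sub>m n) (unit_at k) z" and one: "coset t n (1\<^sub>m n) \<in> ?S" for k l
  proof -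
    obtain c where c: "c < i" "c < n - i" "c \<noteq> snd k" "c \<noteq> snd l" using col by blast
    show "\<exists>z. curve_in t n ?S (1\<^sub>m n) (\<lambda>m. unit_at k m + unit_at l m) z"
      by (rule schubert_curve_exists(1)[OF i' c(1,2)]) (use c in \<open>auto simp: unit_at_def\<close>)
    show "\<exists>z. curve_in t n ?S (1\<^sub>m n) (unit_at k) z"
      by (rule schubert_curve_exists(1)[OF i' c(1,2)]) (use c in \<open>auto simp: unit_at_def\<close>)
    show "coset t n (1\<^sub>m n) \<in> ?S"
      by (rule schubert_curve_exists(2)[OF i' c(1,2), of "\<lambda>_. 0"]) simp
  qed
  have gX: "g (coset t n (1\<^sub>m n)) \<in> ?X" using g one unfolding morphism_def by blast
  then have ne: "?X \<noteq> {}" by blast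
  have Xf: "?X \<subseteq> flag t n" unfolding hess_def by blast
  have "g (coset t n (1\<^sub>m n)) \<in> flag t n" using gX Xf by (rule subsetD[rotated])
  then obtain b where b: "b \<in> grp t n" "g (coset t n (1\<^sub>m n)) = coset t n b" by (rule flagE)
  have Hz: "y \<in> carrier_mat n n \<and> y $$ (n-1,0) = 0" if y: "y \<in> H" for y
  proof
    show "y \<in> carrier_mat n n" using H(1) y by (auto simp: lie_subspace_def lie_alg_def)
    show "y $$ (n-1,0) = 0" using hess_full[OF n(1) H y _ xc ne] nf by blast
  qed
  obtain c d where cd: "\<And>i j. i \<in> low_idx n \<Longrightarrow> j \<in> low_idx n \<Longrightarrow> (\<Sum>k\<in>low_idx n. c i k * d k j) = (if i = j then 1 else 0)"
    and lift: "\<And>z v. curve_in t n ?S (1\<^sub>m n) v z \<Longrightarrow> \<exists>y. curve_in t n ?X b (\<lambda>k. \<Sum>l\<in>low_idx n. c k l * v l) y"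
    using iso_differential[OF n(3) g f fg schubert_sub_flag Xf one_borel(2) b(1) one b(2) cur] by blast
  have "\<exists>e. x = e \<cdot>\<^sub>m 1\<^sub>m n"
  proof (rule hess_curves_imp_scalar[OF n(2) b(1) xc Hz cd])
    fix k assume k: "k \<in> low_idx n"
    obtain z where "curve_in t n ?S (1\<^sub>m n) (unit_at k) z" using cur by blast
    from lift[OF this] show "\<exists>y. curve_in t n ?X b (\<lambda>m. c m k) y" unfolding sum_unit_at[OF k] .
  next
    fix k l assume k: "k \<in> low_idx n" and l: "l \<in> low_idx n"
    obtain z where "curve_in t n ?S (1\<^sub>m n) (\<lambda>m. unit_at k m + unit_at l m) z" using cur2 by blast
    from lift[OF this] show "\<exists>y. curve_in t n ?X b (\<lambda>m. c m k + c m l) y"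
      unfolding distrib_left sum.distrib sum_unit_at[OF k] sum_unit_at[OF l] .
  qed
  then show False using hess_scalar[OF _ H(1) ne] nf by blast
qed

theorem theorem1p9:
  fixes n i :: nat and t :: grp_type
  assumes "n \<ge> 6" and "3 \<le> i" and "i \<le> n - 3"
  shows "\<not> (\<exists>x H. x \<in> lie_alg t n \<and> lie_subspace t n H \<and> b_stable t n H \<and>
            iso_var t n (hess t n x H) (schubert t n (s_perm i \<circ> w0_perm n)))"
proof
  assume "\<exists>x H. x \<in> lie_alg t n \<and> lie_subspace t n H \<and> b_stable t n H \<and>
            iso_var t n (hess t n x H) (schubert t n (s_perm i \<circ> w0_perm n))"
  then obtain x H where h: "x \<in> lie_alg t n" "lie_subspace t n H" "b_stable t n H"
    and iso: "iso_var t n (hess t n x H) (schubert t n (s_perm i \<circ> w0_perm n))" by blast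
  have i: "i + 3 \<le> n" "0 < i" "i < n" using assms by auto
  show False
  proof (cases "hess t n x H = flag t n")
    case True
    then show ?thesis using iso flag_not_iso_schubert[OF i(2,3)] by simp
  next
    case False
    then show ?thesis using iso hess_not_full_not_iso_schubert[OF assms(2) i(1) h] by blast
  qed
qed

end
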